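(* Let $G=(V,E)$ be a graph with edge weights $w:E\to\mathbb{R}$ and sets $B(v)\subseteq\{0,\ldots,d_G(v)\}$ ($v\in V$) none of which contains a gap of length greater than $1$. Let $M$ be a $B$-matching of $G$. If there exists a $B$-matching of greater weight than $M$, then there exists a $B$-matching $N$ with $w(N)>w(M)$ that is of the same uniform type as $M$ or of neighbouring type to $M$.
   Context: $d_F(v)$ is the number of edges of $F\subseteq E$ incident to $v$; a $B$-matching is $F\subseteq E$ with $d_F(v)\in B(v)$ for all $v$; $w(F)=\sum_{e\in F}w(e)$. A set $B(v)$ has a gap of length $p$ if some $k\in B(v)$ has $k+1,\ldots,k+p\notin B(v)$ and $k+p+1\in B(v)$. For $k\in B(v)$, let $u_k(v)$ be the maximum element of $B(v)$ such that $B(v)\cap[k,u_k(v)]$ contains no element of parity different from $k$, and $l_k(v)$ the minimum element of $B(v)$ such that $B(v)\cap[l_k(v),k]$ contains no element of parity different from $k$; set $B_k(v)=B(v)\cap[l_k(v),u_k(v)]$, and for a $B$-matching $M$ set $B_M(v)=B_{d_M(v)}(v)$. A $B$-matching $N$ is of the same uniform type as $M$ if $d_N(v)\in B_M(v)$ for all $v$. $N$ is of neighbouring type to $M$ if there is a set $W$ of at most two vertices with $d_N(w)\notin B_M(w)$ for $w\in W$ and $d_N(v)\in B_M(v)$ for $v\notin W$, and either $|W|=0$; or $|W|=2$ and for each $w\in W$ the sets $B_M(w)$ and $B_N(w)$ are adjacent, i.e. $\max B_M(w)+1=\min B_N(w)$ or $\max B_N(w)+1=\min B_M(w)$; or $|W|=1$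 and for $w\in W$ there is $k\in B(w)$ such that $B_k(w)$ is adjacent to both $B_M(w)$ and $B_N(w)$. *)

theory Defs
  imports Complex_Main
begin

definition simple_graph :: "'v set \<Rightarrow> 'v set set \<Rightarrow> bool" where
  "simple_graph V E \<longleftrightarrow> finite V \<and> (\<forall>e\<in>E. e \<subseteq> V \<and> card e = 2)"

definition deg :: "'v set set \<Rightarrow> 'v \<Rightarrow> nat" where
  "deg F v = card {e \<in> F. v \<in> e}"

definition B_matching :: "'v set \<Rightarrow> 'v set set \<Rightarrow> ('v \<Rightarrow> nat set) \<Rightarrow> 'v set set \<Rightarrow> bool" where
  "B_matching V E B F \<longleftrightarrow> F \<subseteq> E \<and> (\<forall>v\<in>V. deg F v \<in> B v)"

definition has_gap :: "nat set \<Rightarrow> nat \<Rightarrow> bool" where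
  "has_gap S p \<longleftrightarrow> (\<exists>k\<in>S. (\<forall>i\<in>{k+1..k+p}. i \<notin> S) \<and> k + p + 1 \<in> S)"

text \<open>For finite \<open>S\<close> and \<open>k \<in> S\<close>, the candidate sets below are finite and contain \<open>k\<close>,
  so \<open>upper_end S k \<ge> k\<close> and \<open>lower_end S k \<le> k\<close>; the candidates on the wrong side of \<open>k\<close>,
  for which the interval is empty, do not affect the extremum.\<close>

definition upper_end :: "nat set \<Rightarrow> nat \<Rightarrow> nat" where
  "upper_end S k = Max {u \<in> S. \<forall>i \<in> S \<inter> {k..u}. even i \<longleftrightarrow> even k}"

definition lower_end :: "nat set \<Rightarrow> nat \<Rightarrow> nat" where
  "lower_end S k = Min {l \<in> S. \<forall>i \<in> S \<inter> {l..k}. even i \<longleftrightarrow> even k}"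

text \<open>\<open>uniform_part (B v) k\<close> is $B_k(v)$, and \<open>matching_part B M v\<close> is $B_M(v)$.\<close>

definition uniform_part :: "nat set \<Rightarrow> nat \<Rightarrow> nat set" where
  "uniform_part S k = S \<inter> {lower_end S k..upper_end S k}"

definition matching_part :: "('v \<Rightarrow> nat set) \<Rightarrow> 'v set set \<Rightarrow> 'v \<Rightarrow> nat set" where
  "matching_part B M v = uniform_part (B v) (deg M v)"

definition adjacent :: "nat set \<Rightarrow> nat set \<Rightarrow> bool" where
  "adjacent S T \<longleftrightarrow> Max S + 1 = Min T \<or> Max T + 1 = Min S"

definition same_uniform_type ::
    "'v set \<Rightarrow> ('v \<Rightarrow> nat set) \<Rightarrow> 'v set set \<Rightarrow> 'v set set \<Rightarrow> bool" where
  "same_uniform_type V B M N \<longleftrightarrow> (\<forall>v\<in>V. deg N v \<in> matching_part B M v)"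

definition neighbouring_type ::
    "'v set \<Rightarrow> ('v \<Rightarrow> nat set) \<Rightarrow> 'v set set \<Rightarrow> 'v set set \<Rightarrow> bool" where
  "neighbouring_type V B M N \<longleftrightarrow>
    (\<exists>W\<subseteq>V. card W \<le> 2 \<and>
      (\<forall>x\<in>W. deg N x \<notin> matching_part B M x) \<and>
      (\<forall>v\<in>V - W. deg N v \<in> matching_part B M v) \<and>
      (card W = 0 \<or>
       card W = 2 \<and> (\<forall>x\<in>W. adjacent (matching_part B M x) (matching_part B N x)) \<or>
       card W = 1 \<and>
         (\<forall>x\<in>W. \<exists>k\<in>B x. adjacent (uniform_part (B x) k) (matching_part B M x) \<and>
                           adjacent (uniform_part (B x) k) (matching_part B N x))))"

end

theory Submission
  imports Defs "HOL-Library.Disjoint_Sets"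
begin

text \<open>
  Among the \<open>B\<close>-matchings of greater weight take \<open>N\<close> with the smallest symmetric difference to \<open>M\<close>, and
  split this difference into as few blocks as possible, each changing the degrees by at most 2 in
  total. A block that changes no degree must be the whole difference, which then preserves all
  degrees. Otherwise the blocks are the edges of a multigraph, and a set of blocks may be exchanged
  iff its degree at each vertex lies in a set without two consecutive missing numbers.

  Counting for each vertex \<open>v\<close> how often the parity changes within \<open>B v\<close> between the degrees of \<open>v\<close>
  in \<open>M\<close> and \<open>N\<close> gives their type distance, which is even. If it is at least 3, some proper subset
  of the blocks is admissible and has positive gain, contrary to the choice of \<open>N\<close>; hence it is 0 or
  2, and \<open>N\<close> has the same uniform or a neighbouring type.

  The claim about distance at least 3 is proved by induction on the number of blocks. If the distance
  is at least 5, the weights are perturbed until an admissible proper subset has gain 0, which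
  allows induction below or above this subset. For distance 4, filling a missing number at one vertex
  raises the distance to 6, and the sets obtained there show that each degree set contains all odd or
  all even numbers, as well as all numbers near its maximum. Vertices without parity changes are
  removed by merging blocks, so at most four vertices remain, and in each of the resulting small
  multigraphs suitable admissible sets (of gain at most 0) and complements of admissible sets (of gain
  at least that of all blocks) contradict each other.
\<close>

text \<open>Using as few blocks as possible matters because two blocks that pull the degree of a
  vertex in opposite directions could be merged. So all degrees move monotonically from
  \<open>M\<close> to \<open>N\<close>, and admissibility becomes a condition on counts measured
  from \<open>M\<close>. The bound 5 is 2 + 3. Every nonempty instance contains a nonempty
  admissible set of distance at most 2, and distances add up when an instance is cut at an
  admissible set. If a tight set has distance at most 2, the rest keeps at least 3 and induction
  applies there; otherwise it applies inside the tight set. Distance 4 is the obstacle, since it can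
  split as 2 + 2 and then neither half is covered. The final contradictions are linear: two families
  of sets that cover the same items get incompatible bounds. Passing to complements reverses the
  degree sets. With one parity change per vertex this interchanges the two possible shapes, so many
  arguments come in mirrored pairs.\<close>

section \<open>Instances\<close>

text \<open>If no two consecutive numbers up to \<open>t\<close> are missing from \<open>C\<close>, then \<open>jumps C t\<close> is the number of
  parity changes between successive elements of \<open>C\<close> up to \<open>t\<close>.\<close>

definition jumps :: "nat set \<Rightarrow> nat \<Rightarrow> nat" where
  "jumps C t = card {c. c < t \<and> c \<in> C \<and> Suc c \<in> C}"

definition isolated_holes :: "nat set \<Rightarrow> nat \<Rightarrow> bool" where
  "isolated_holes C n \<longleftrightarrow> 0 \<in> C \<and> n \<in> C \<and> (\<forall>h<n. h \<notin> C \<longrightarrow> Suc h \<in> C)"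

lemma jumps_0 [simp]: "jumps C 0 = 0"
  by (simp add: jumps_def)

lemma jumps_Suc [simp]: "jumps C (Suc t) = jumps C t + of_bool (t \<in> C \<and> Suc t \<in> C)"
proof -
  have "{c. c < Suc t \<and> c \<in> C \<and> Suc c \<in> C}
      = (if t \<in> C \<and> Suc t \<in> C then insert t else id) {c. c < t \<and> c \<in> C \<and> Suc c \<in> C}"
    by (auto simp: less_Suc_eq)
  then show ?thesis
    by (auto simp: jumps_def)
qed

lemma jumps_mono: "s \<le> t \<Longrightarrow> jumps C s \<le> jumps C t"
  by (induction t) (auto simp: le_Suc_eq)

lemma jumps_le: "jumps C t \<le> t"
  by (induction t) auto

text \<open>A step from \<open>t\<close> to \<open>Suc t\<close> switches membership unless both
  numbers belong to \<open>C\<close>, and exactly then \<open>jumps\<close> grows by one as well.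
  This ties membership to a parity and is the source of all parity arguments below.\<close>

lemma mem_iff_even_jumps:
  assumes "isolated_holes C n" "t \<le> n"
  shows "t \<in> C \<longleftrightarrow> even (t + jumps C t)"
  using assms(2)
proof (induction t)
  case 0
  then show ?case using assms(1) by (simp add: isolated_holes_def)
next
  case (Suc t)
  then have "t \<notin> C \<longrightarrow> Suc t \<in> C"
    using assms(1) by (simp add: isolated_holes_def)
  then show ?case using Suc by auto
qed

lemma even_mem_of_no_jumps:
  assumes "isolated_holes C n" "t \<le> n" "jumps C t = 0" "s \<le> t" "even s"
  shows "s \<in> C"
  using mem_iff_even_jumps[OF assms(1), of s] jumps_mono[OF assms(4), of C] assms by simp

lemma jumps_shift: "jumps C (s + m) = jumps C s + jumps {c. s + c \<in> C} m"
  by (induction m) auto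

text \<open>Both neighbours of an isolated hole belong to \<open>C\<close>, so filling it creates
  the jumps from \<open>h - 1\<close> and from \<open>h\<close>; only the first is counted by
  \<open>jumps\<close> at \<open>h\<close>.\<close>

lemma jumps_insert_hole:
  assumes "h \<notin> C" "h > 0" "h - 1 \<in> C"
  shows "jumps (insert h C) h = Suc (jumps C h)"
    and "Suc h \<in> C \<Longrightarrow> h < n \<Longrightarrow> jumps (insert h C) n = jumps C n + 2"
proof -
  have below: "jumps (insert h C) t = jumps C t" if "t < h" for t
    using that by (induction t) auto
  obtain k where k: "h = Suc k"
    using assms(2) by (cases h) auto
  show *: "jumps (insert h C) h = Suc (jumps C h)"
    using below[of k] assms by (simp add: k)
  show "jumps (insert h C) n = jumps C n + 2" if "Suc h \<in> C" "h < n"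
    using \<open>h < n\<close>
  proof (induction n)
    case (Suc n)
    show ?case
    proof (cases "n = h")
      case True
      then show ?thesis using * assms that by simp
    next
      case False
      then show ?thesis using Suc by auto
    qed
  qed simp
qed

lemma isolated_holes_insert:
  assumes "isolated_holes C n"
  shows "isolated_holes (insert h C) n"
  using assms by (auto simp: isolated_holes_def)

lemma isolated_holes_below:
  assumes "isolated_holes C n" "t \<le> n" "t \<in> C"
  shows "isolated_holes C t"
  using assms by (auto simp: isolated_holes_def)

lemma isolated_holes_shift:
  assumes "isolated_holes C n" "t \<le> n" "t \<in> C"
  shows "isolated_holes {c. t + c \<in> C} (n - t)"
  using assms by (auto simp: isolated_holes_def)

lemma isolated_holes_pred:
  assumes "isolated_holes C n" "h \<le> n" "h \<notin> C"
  shows "h > 0 \<and> h - 1 \<in> C"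
proof (cases h)
  case (Suc k)
  then have "k < n" using assms(2) by simp
  then show ?thesis using assms(1,3) Suc by (auto simp: isolated_holes_def)
qed (use assms in \<open>auto simp: isolated_holes_def\<close>)

lemma sum_two:
  assumes "finite V" "x \<in> V" "y \<in> V"
  shows "(\<Sum>v\<in>V. of_bool (v = x) + of_bool (v = y)) = (2 :: nat)"
  using assms by (simp add: sum.distrib of_bool_def)

text \<open>Items are edges of a multigraph with loops: \<open>inc i v\<close> is the number of ends of \<open>i\<close> at \<open>v\<close>, and \<open>C v\<close>
  is the set of degrees that are admissible at \<open>v\<close>.\<close>

definition link :: "'v set \<Rightarrow> ('v \<Rightarrow> nat) \<Rightarrow> bool" where
  "link V f \<longleftrightarrow> (\<exists>x\<in>V. \<exists>y\<in>V. f = (\<lambda>v. of_bool (v = x) + of_bool (v = y)))"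

definition ideg :: "('i \<Rightarrow> 'v \<Rightarrow> nat) \<Rightarrow> 'i set \<Rightarrow> 'v \<Rightarrow> nat" where
  "ideg inc T v = (\<Sum>i\<in>T. inc i v)"

definition valid :: "'v set \<Rightarrow> ('i \<Rightarrow> 'v \<Rightarrow> nat) \<Rightarrow> ('v \<Rightarrow> nat set) \<Rightarrow> 'i set \<Rightarrow> bool" where
  "valid V inc C T \<longleftrightarrow> (\<forall>v\<in>V. ideg inc T v \<in> C v)"

definition norm_type :: "'v set \<Rightarrow> ('i \<Rightarrow> 'v \<Rightarrow> nat) \<Rightarrow> ('v \<Rightarrow> nat set) \<Rightarrow> 'i set \<Rightarrow> nat" where
  "norm_type V inc C T = (\<Sum>v\<in>V. jumps (C v) (ideg inc T v))"

definition inst :: "'v set \<Rightarrow> ('i \<Rightarrow> 'v \<Rightarrow> nat) \<Rightarrow> ('v \<Rightarrow> nat set) \<Rightarrow> 'i set \<Rightarrow> bool" where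
  "inst V inc C I \<longleftrightarrow> finite V \<and> finite I \<and> (\<forall>i\<in>I. link V (inc i)) \<and>
     (\<forall>v\<in>V. isolated_holes (C v) (ideg inc I v))"

lemma ideg_mono: "finite I \<Longrightarrow> T \<subseteq> I \<Longrightarrow> ideg inc T v \<le> ideg inc I v"
  unfolding ideg_def by (rule sum_mono2) auto

lemma ideg_Un: "finite S \<Longrightarrow> finite T \<Longrightarrow> S \<inter> T = {} \<Longrightarrow> ideg inc (S \<union> T) v = ideg inc S v + ideg inc T v"
  unfolding ideg_def by (rule sum.union_disjoint)

lemma ideg_Diff: "finite I \<Longrightarrow> T \<subseteq> I \<Longrightarrow> ideg inc (I - T) v = ideg inc I v - ideg inc T v"
  using ideg_Un[of T "I - T" inc v] by (simp add: finite_subset Un_absorb1)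

lemma ideg_empty [simp]: "ideg inc {} v = 0"
  by (simp add: ideg_def)

lemma ideg_insert: "finite T \<Longrightarrow> i \<notin> T \<Longrightarrow> ideg inc (insert i T) v = inc i v + ideg inc T v"
  by (simp add: ideg_def)

lemma link_total: "finite V \<Longrightarrow> link V f \<Longrightarrow> sum f V = 2"
  using sum_two by (auto simp: link_def)

lemma link_endpoint:
  assumes "link V f" "f v > 0"
  obtains y where "y \<in> V" "f = (\<lambda>w. of_bool (w = v) + of_bool (w = y))"
proof -
  obtain a b where ab: "a \<in> V" "b \<in> V" "f = (\<lambda>w. of_bool (w = a) + of_bool (w = b))"
    using assms(1) by (auto simp: link_def)
  then have "v = a \<or> v = b"
    using assms(2) by (auto simp: of_bool_def split: if_splits)
  then show ?thesis
    using that[of b] that[of a] ab by (auto simp: add.commute)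
qed

lemma handshake:
  assumes "finite V" "finite T" "\<forall>i\<in>T. link V (inc i)"
  shows "(\<Sum>v\<in>V. ideg inc T v) = 2 * card T"
proof -
  have "(\<Sum>v\<in>V. ideg inc T v) = (\<Sum>i\<in>T. \<Sum>v\<in>V. inc i v)"
    unfolding ideg_def by (rule sum.swap)
  also have "\<dots> = (\<Sum>i\<in>T. 2)"
    using assms by (intro sum.cong) (auto simp: link_total)
  finally show ?thesis by simp
qed

lemma inst_sub:
  assumes "inst V inc C I" "T \<subseteq> I" "valid V inc C T"
  shows "inst V inc C T"
proof -
  have "isolated_holes (C v) (ideg inc T v)" if "v \<in> V" for v
    using isolated_holes_below[of "C v" "ideg inc I v" "ideg inc T v"] ideg_mono[of I T inc v] assms that
    by (auto simp: inst_def valid_def)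
  then show ?thesis
    using assms by (auto simp: inst_def intro: finite_subset)
qed

lemma inst_base:
  assumes "inst V inc C I" "T \<subseteq> I" "valid V inc C T"
  shows "inst V inc (\<lambda>v. {c. ideg inc T v + c \<in> C v}) (I - T)"
proof -
  have "isolated_holes {c. ideg inc T v + c \<in> C v} (ideg inc (I - T) v)" if "v \<in> V" for v
    using isolated_holes_shift[of "C v" "ideg inc I v" "ideg inc T v"] ideg_mono[of I T inc v]
      ideg_Diff[of I T inc v] assms that
    by (auto simp: inst_def valid_def)
  then show ?thesis
    using assms by (auto simp: inst_def)
qed

text \<open>Measuring degrees from those of \<open>T\<close> turns the part above \<open>T\<close>
  into an instance of its own. Since the norm is additive, a part of small norm leaves a rest of
  large norm.\<close>

lemma norm_type_base:
  assumes "finite I" "T \<subseteq> I"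
  shows "norm_type V inc C I
    = norm_type V inc C T + norm_type V inc (\<lambda>v. {c. ideg inc T v + c \<in> C v}) (I - T)"
proof -
  have "ideg inc I v = ideg inc T v + ideg inc (I - T) v" for v
    using ideg_Diff[OF assms, of inc v] ideg_mono[OF assms, of inc v] by simp
  then show ?thesis
    unfolding norm_type_def by (simp add: jumps_shift sum.distrib)
qed

text \<open>Each full degree is admissible, hence congruent modulo 2 to its number of jumps, and the
  degrees add up to twice the number of items.\<close>

lemma norm_type_even:
  assumes "inst V inc C I"
  shows "even (norm_type V inc C I)"
proof -
  have "even (ideg inc I v + jumps (C v) (ideg inc I v))" if "v \<in> V" for v
    using assms mem_iff_even_jumps[of "C v" "ideg inc I v" "ideg inc I v"] that
    by (simp add: inst_def isolated_holes_def)
  then have "even (\<Sum>v\<in>V. ideg inc I v + jumps (C v) (ideg inc I v))"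
    by (rule dvd_sum)
  moreover have "(\<Sum>v\<in>V. ideg inc I v) = 2 * card I"
    using handshake[of V I inc] assms by (simp add: inst_def)
  ultimately show ?thesis
    by (simp add: norm_type_def sum.distrib)
qed

subsection \<open>Existence of valid sets of small type\<close>

text \<open>A potential that also makes sense for degrees in holes: it grows by at most one when the
  degree grows by one, and it drops by one on stepping out of a hole.\<close>

definition defect :: "nat set \<Rightarrow> nat \<Rightarrow> nat" where
  "defect C t = jumps C t + of_bool (t \<notin> C)"

lemma sum_defect_step:
  assumes "finite V" "x \<in> V"
  shows "(\<Sum>v\<in>V. defect (C v) (f v + of_bool (v = x))) \<le> Suc (\<Sum>v\<in>V. defect (C v) (f v))"
    and "f x \<notin> C x \<Longrightarrow> Suc (f x) \<in> C x \<Longrightarrow>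
      Suc (\<Sum>v\<in>V. defect (C v) (f v + of_bool (v = x))) = (\<Sum>v\<in>V. defect (C v) (f v))"
proof -
  have *: "(\<Sum>v\<in>V - {x}. defect (C v) (f v + of_bool (v = x))) = (\<Sum>v\<in>V - {x}. defect (C v) (f v))"
    by (intro sum.cong) auto
  show "(\<Sum>v\<in>V. defect (C v) (f v + of_bool (v = x))) \<le> Suc (\<Sum>v\<in>V. defect (C v) (f v))"
    using assms by (simp add: sum.remove[of V x] * ) (simp add: defect_def)
  show "Suc (\<Sum>v\<in>V. defect (C v) (f v + of_bool (v = x))) = (\<Sum>v\<in>V. defect (C v) (f v))"
    if "f x \<notin> C x" "Suc (f x) \<in> C x"
    using assms that by (simp add: sum.remove[of V x] * ) (simp add: defect_def)
qed

text \<open>Take a largest nonempty set of potential at most 2; single items qualify, since each end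
  costs at most 1. If one of its degrees were in a hole, a further item would end there: that end
  lowers the potential by 1 and the other end raises it by at most 1, so the set could be
  enlarged.\<close>

lemma ex_valid_small_type:
  assumes I: "inst V inc C I" and "I \<noteq> {}"
  obtains T where "T \<subseteq> I" "T \<noteq> {}" "valid V inc C T" "norm_type V inc C T \<le> 2"
proof -
  define \<phi> where "\<phi> T = (\<Sum>v\<in>V. defect (C v) (ideg inc T v))" for T
  have fin: "finite V" "finite I"
    and lk: "\<And>i. i \<in> I \<Longrightarrow> link V (inc i)"
    and ih: "\<And>v. v \<in> V \<Longrightarrow> isolated_holes (C v) (ideg inc I v)"
    using I by (auto simp: inst_def)
  define Q where "Q T \<longleftrightarrow> T \<subseteq> I \<and> T \<noteq> {} \<and> \<phi> T \<le> 2" for T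
  obtain i where i: "i \<in> I" using \<open>I \<noteq> {}\<close> by blast
  obtain x y where xy: "x \<in> V" "y \<in> V" "inc i = (\<lambda>v. of_bool (v = x) + of_bool (v = y))"
    using lk[OF i] by (auto simp: link_def)
  have "\<phi> {} = 0"
    using ih by (auto simp: \<phi>_def defect_def isolated_holes_def)
  then have "\<phi> {i} \<le> 2"
    using sum_defect_step(1)[OF fin(1) xy(1), of C "\<lambda>v. 0"]
      sum_defect_step(1)[OF fin(1) xy(2), of C "\<lambda>v. of_bool (v = x)"] xy(3)
    by (simp add: \<phi>_def ideg_def)
  then have "Q {i}" using i by (simp add: Q_def)
  moreover have bd: "\<forall>T. Q T \<longrightarrow> card T < Suc (card I)"
    using fin by (auto simp: Q_def less_Suc_eq_le intro: card_mono)
  ultimately obtain T where T: "Q T" "\<And>S. Q S \<Longrightarrow> card S \<le> card T"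
    using ex_has_greatest_nat[of Q "{i}" card "Suc (card I)"] by (metis less_imp_le)
  have TI: "T \<subseteq> I" "finite T" using T(1) fin by (auto simp: Q_def intro: finite_subset)
  have "valid V inc C T"
  proof (rule ccontr)
    assume "\<not> valid V inc C T"
    then obtain v where v: "v \<in> V" "ideg inc T v \<notin> C v"
      by (auto simp: valid_def)
    have "ideg inc I v \<in> C v" using ih[OF v(1)] by (simp add: isolated_holes_def)
    then have lt: "ideg inc T v < ideg inc I v"
      using ideg_mono[OF fin(2) TI(1), of inc v] v(2) by (metis le_neq_implies_less)
    then have "ideg inc (I - T) v > 0"
      using ideg_Diff[OF fin(2) TI(1), of inc v] by simp
    then obtain j where j: "j \<in> I - T" "inc j v > 0"
      unfolding ideg_def by (metis bot_nat_0.not_eq_extremum sum.neutral)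
    then obtain y where y: "y \<in> V" "inc j = (\<lambda>w. of_bool (w = v) + of_bool (w = y))"
      using link_endpoint[of V "inc j" v] lk[of j] by auto
    have "Suc (ideg inc T v) \<in> C v"
      using ih[OF v(1)] lt v(2) by (auto simp: isolated_holes_def)
    from sum_defect_step(2)[OF fin(1) v(1), of "ideg inc T" C, OF v(2) this]
      sum_defect_step(1)[OF fin(1) y(1), of C "\<lambda>w. ideg inc T w + of_bool (w = v)"]
    have "\<phi> (insert j T) \<le> \<phi> T"
      using j TI by (simp add: \<phi>_def ideg_insert y(2) add_ac)
    then have "Q (insert j T)"
      using T(1) j by (auto simp: Q_def)
    from T(2)[OF this] show False
      using j TI by simp
  qed
  moreover from this have "norm_type V inc C T \<le> 2"
    using T(1) by (simp add: Q_def \<phi>_def norm_type_def defect_def valid_def)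
  ultimately show ?thesis
    using that T(1) by (auto simp: Q_def)
qed

section \<open>Splitting an instance of type distance at least 5 at a tight set\<close>

definition improvable ::
    "'v set \<Rightarrow> ('i \<Rightarrow> 'v \<Rightarrow> nat) \<Rightarrow> ('v \<Rightarrow> nat set) \<Rightarrow> 'i set \<Rightarrow> ('i \<Rightarrow> real) \<Rightarrow> bool" where
  "improvable V inc C I \<Delta> \<longleftrightarrow> (\<exists>T. T \<subset> I \<and> T \<noteq> {} \<and> valid V inc C T \<and> sum \<Delta> T > 0)"

lemma instD:
  assumes "inst V inc C I"
  shows "finite V" "finite I" "\<And>i. i \<in> I \<Longrightarrow> link V (inc i)"
    "\<And>v. v \<in> V \<Longrightarrow> isolated_holes (C v) (ideg inc I v)"
  using assms by (auto simp: inst_def)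

lemma valid_Un_base:
  assumes "finite I" "T \<subseteq> I" "X \<subseteq> I - T" "valid V inc (\<lambda>v. {c. ideg inc T v + c \<in> C v}) X"
  shows "valid V inc C (T \<union> X)"
proof -
  have "finite T" "finite X" "T \<inter> X = {}"
    using assms by (auto intro: finite_subset)
  then show ?thesis
    using assms(4) by (simp add: valid_def ideg_Un)
qed

text \<open>The parameter \<open>inc0\<close> only serves to fix the type of the items.\<close>

locale induction_step =
  fixes V :: "'v set" and N :: nat and inc0 :: "'i \<Rightarrow> 'v \<Rightarrow> nat"
  assumes IH: "\<And>(I :: 'i set) inc C \<Delta>. inst V inc C I \<Longrightarrow> card I < N \<Longrightarrow> norm_type V inc C I \<ge> 3 \<Longrightarrow>
    sum \<Delta> I > 0 \<Longrightarrow> improvable V inc C I \<Delta>"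
begin

text \<open>Raising a weight until some valid proper subset \<open>T\<close> becomes tight keeps all assumptions, and
  then both the part below \<open>T\<close> and the part above \<open>T\<close> are smaller instances.\<close>

lemma improvable_large_norm:
  assumes I: "inst V inc C I" and N: "card I = N" and large: "norm_type V inc C I \<ge> 5"
    and pos: "sum \<Delta> I > 0"
  shows "improvable V inc C (I :: 'i set) \<Delta>"
proof (rule ccontr)
  assume no: "\<not> improvable V inc C I \<Delta>"
  define F where "F = {T. T \<subset> I \<and> T \<noteq> {} \<and> valid V inc C T}"
  note fin = instD(1,2)[OF I]
  have finF: "finite F"
    using fin by (auto simp: F_def intro: finite_subset[of _ "Pow I"])
  have FI: "finite T" if "T \<in> F" for T
    using that fin by (auto simp: F_def intro: finite_subset)
  have nonpos: "sum \<Delta> T \<le> 0" if "T \<in> F" for T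
    using no that by (fastforce simp: F_def improvable_def)
  have "I \<noteq> {}" using pos by auto
  then obtain T0 where T0: "T0 \<subseteq> I" "T0 \<noteq> {}" "valid V inc C T0" "norm_type V inc C T0 \<le> 2"
    using ex_valid_small_type[OF I] by blast
  have "T0 \<noteq> I" using T0(4) large by auto
  then have T0F: "T0 \<in> F" using T0 by (auto simp: F_def)
  \<comment> \<open>Only the weight of \<open>e\<close> is raised. As \<open>T0\<close> contains
    \<open>e\<close>, the slacks whose minimum is \<open>s\<close> form a nonempty family, and a set
    attaining the minimum becomes tight.\<close>
  obtain e where e: "e \<in> T0" using T0 by blast
  define s where "s = Min ((\<lambda>T. - sum \<Delta> T) ` {T \<in> F. e \<in> T})"
  define \<Delta>' where "\<Delta>' = \<Delta>(e := \<Delta> e + s)"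
  have sum': "sum \<Delta>' T = sum \<Delta> T + (if e \<in> T then s else 0)" if "finite T" for T
  proof (cases "e \<in> T")
    case True
    have "sum \<Delta>' (T - {e}) = sum \<Delta> (T - {e})"
      by (intro sum.cong) (auto simp: \<Delta>'_def)
    then show ?thesis
      using True that by (simp add: sum.remove[of T e]) (simp add: \<Delta>'_def)
  next
    case False
    then show ?thesis by (auto simp: \<Delta>'_def intro!: sum.cong)
  qed
  have finFe: "finite ((\<lambda>T. - sum \<Delta> T) ` {T \<in> F. e \<in> T})" using finF by simp
  have neFe: "(\<lambda>T. - sum \<Delta> T) ` {T \<in> F. e \<in> T} \<noteq> {}" using T0F e by auto
  obtain T1 where T1: "T1 \<in> F" "e \<in> T1" "s = - sum \<Delta> T1"
    using Min_in[OF finFe neFe] by (auto simp: s_def)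
  have s_le: "s \<le> - sum \<Delta> T" if "T \<in> F" "e \<in> T" for T
    using Min_le[OF finFe] that by (auto simp: s_def)
  have s_ge: "s \<ge> 0" using T1 nonpos by simp
  have nonpos': "sum \<Delta>' T \<le> 0" if "T \<in> F" for T
    using nonpos[OF that] s_le[OF that] FI[OF that] by (auto simp: sum')
  have "\<exists>T. T \<in> F \<and> sum \<Delta>' T = 0"
    using T1 FI by (auto simp: sum' intro!: exI[of _ T1])
  then obtain T where T: "T \<in> F" "sum \<Delta>' T = 0"
    and min: "\<And>S. S \<in> F \<Longrightarrow> sum \<Delta>' S = 0 \<Longrightarrow> card T \<le> card S"
    using ex_has_least_nat[of "\<lambda>T. T \<in> F \<and> sum \<Delta>' T = 0" _ card] by blast
  have TI: "T \<subset> I" "T \<noteq> {}" "valid V inc C T" "finite T"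
    using T FI by (auto simp: F_def)
  have cards: "card T < N" "card (I - T) < N"
    using TI fin N psubset_card_mono[of I T] by (auto intro: psubset_card_mono)
  define F' where "F' = {X. X \<subset> T \<and> X \<noteq> {} \<and> valid V inc C X}"
  have finF': "finite F'"
    using TI(4) by (auto simp: F'_def intro: finite_subset[of _ "Pow T"])
  have F': "sum \<Delta>' X < 0" "card X > 0" "finite X" if "X \<in> F'" for X
  proof -
    have X: "X \<in> F" "card X < card T" "finite X"
      using that TI psubset_card_mono[of T X] by (auto simp: F_def F'_def intro: finite_subset)
    then show "sum \<Delta>' X < 0"
      using nonpos'[of X] min[of X] by fastforce
    show "card X > 0" "finite X"
      using X that by (auto simp: F'_def card_gt_0_iff)
  qed
  \<comment> \<open>Adding \<open>\<epsilon>\<close> to every item makes the tight \<open>T\<close>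
    positive but leaves its admissible proper subsets nonpositive. The 1 covers the case that there
    are none.\<close>
  define \<epsilon> where "\<epsilon> = Min (insert 1 ((\<lambda>X. - sum \<Delta>' X / card X) ` F'))"
  have "\<epsilon> > 0"
    using finF' F' by (auto simp: \<epsilon>_def divide_neg_pos)
  have eps: "sum \<Delta>' X + \<epsilon> * card X \<le> 0" if "X \<in> F'" for X
  proof -
    have "\<epsilon> \<le> - sum \<Delta>' X / card X"
      using finF' that by (auto simp: \<epsilon>_def intro!: Min_le)
    then show ?thesis
      using F'(2)[OF that] by (simp add: field_simps)
  qed
  have small: "norm_type V inc C T \<le> 2"
  proof (rule ccontr)
    assume "\<not> norm_type V inc C T \<le> 2"
    then have "norm_type V inc C T \<ge> 3" by simp
    moreover have "sum (\<lambda>i. \<Delta>' i + \<epsilon>) T > 0"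
      using T(2) TI \<open>\<epsilon> > 0\<close> by (simp add: sum.distrib card_gt_0_iff)
    ultimately have "improvable V inc C T (\<lambda>i. \<Delta>' i + \<epsilon>)"
      using IH[OF inst_sub[OF I]] TI cards by blast
    then obtain X where "X \<in> F'" "sum (\<lambda>i. \<Delta>' i + \<epsilon>) X > 0"
      by (auto simp: improvable_def F'_def)
    then show False
      using eps[of X] F'[of X] by (simp add: sum.distrib mult.commute)
  qed
  let ?C = "\<lambda>v. {c. ideg inc T v + c \<in> C v}"
  have TI': "T \<subseteq> I" using TI by blast
  have "norm_type V inc ?C (I - T) \<ge> 3"
    using norm_type_base[OF fin(2) TI', of V inc C] large small by simp
  moreover have "sum \<Delta>' (I - T) > 0"
    using pos s_ge T(2) fin TI' by (simp add: sum_diff sum')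
  ultimately have "improvable V inc ?C (I - T) \<Delta>'"
    using IH[OF inst_base[OF I TI' TI(3)]] cards by blast
  then obtain X where X: "X \<subset> I - T" "X \<noteq> {}" "valid V inc ?C X" "sum \<Delta>' X > 0"
    by (auto simp: improvable_def)
  have "T \<union> X \<in> F"
    using X TI valid_Un_base[OF fin(2) TI' _ X(3)] by (auto simp: F_def)
  moreover have "sum \<Delta>' (T \<union> X) = sum \<Delta>' T + sum \<Delta>' X"
    using X TI fin by (intro sum.union_disjoint) (auto intro: finite_subset)
  ultimately show False
    using nonpos'[of "T \<union> X"] X(4) T(2) by simp
qed

end

section \<open>Type distance four\<close>

text \<open>In \<open>typeA\<close> one jump precedes every hole, so holes are even; in
  \<open>typeB\<close> no jump does, so holes are odd. The other jumps, out of \<open>r\<close> in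
  all, need room between the last hole and \<open>n\<close>, which forces the top numbers into the
  set.\<close>

definition typeA :: "nat set \<Rightarrow> nat \<Rightarrow> nat \<Rightarrow> bool" where
  "typeA C n r \<longleftrightarrow> (\<forall>k\<le>n. odd k \<longrightarrow> k \<in> C) \<and> (\<forall>k\<le>n. n < k + r \<longrightarrow> k \<in> C) \<and> r \<le> n"

definition typeB :: "nat set \<Rightarrow> nat \<Rightarrow> nat \<Rightarrow> bool" where
  "typeB C n r \<longleftrightarrow> (\<forall>k\<le>n. even k \<longrightarrow> k \<in> C) \<and> (\<forall>k\<le>n. n \<le> k + r \<longrightarrow> k \<in> C) \<and> r + 2 \<le> n"

lemma jumps_add_le: "jumps C (s + m) \<le> jumps C s + m"
  by (induction m) auto

text \<open>By \<open>H1\<close> at most one jump precedes a hole. If \<open>1 \<in> C\<close>, this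
  is the jump from 0. If not, \<open>H2\<close> rules out a hole with one jump before it.\<close>

lemma typeA_or_typeB:
  assumes C: "isolated_holes C n" and pos: "jumps C n \<ge> 1"
    and H1: "\<And>h. h < n \<Longrightarrow> h \<notin> C \<Longrightarrow> jumps C h \<le> 1"
    and H2: "\<And>a. a + 2 < n \<Longrightarrow> a \<ge> 2 \<Longrightarrow> a \<in> C \<Longrightarrow> a + 1 \<in> C \<Longrightarrow> a + 2 \<notin> C \<Longrightarrow> jumps C a = 0 \<Longrightarrow> False"
  shows "typeA C n (jumps C n) \<or> typeB C n (jumps C n)"
proof -
  have above: "jumps C n \<le> jumps C h + (n - Suc h)" if "h < n" "h \<notin> C" for h
    using jumps_add_le[of C "Suc h" "n - Suc h"] that by simp
  have mem: "k \<in> C \<longleftrightarrow> even (k + jumps C k)" if "k \<le> n" for k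
    using mem_iff_even_jumps[OF C that] .
  have "n \<noteq> 0" using pos by (cases n) auto
  have "n \<in> C" "0 \<in> C" using C by (auto simp: isolated_holes_def)
  show ?thesis
  proof (cases "1 \<in> C")
    case True
    have hole: "jumps C h = 1" if "h < n" "h \<notin> C" for h
    proof -
      have "h > 0" using \<open>0 \<in> C\<close> that by (cases h) auto
      then have "jumps C (Suc 0) \<le> jumps C h" by (intro jumps_mono) simp
      then show ?thesis using H1[OF that] True \<open>0 \<in> C\<close> by simp
    qed
    have "k \<in> C" if "k \<le> n" "odd k" for k
      using hole[of k] mem[of k] that \<open>n \<in> C\<close> by (cases "k = n") auto
    moreover have "k \<in> C" if "k \<le> n" "n < k + jumps C n" for k
    proof (rule ccontr)
      assume k: "k \<notin> C"
      then have "k < n" using that \<open>n \<in> C\<close> by (metis le_neq_implies_less)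
      then show False using above[of k] hole[of k] k that by simp
    qed
    ultimately show ?thesis
      using jumps_le[of C n] by (simp add: typeA_def)
  next
    case False
    have hole: "jumps C h = 0" if h: "h < n" "h \<notin> C" for h
    proof (rule ccontr)
      assume "jumps C h \<noteq> 0"
      then have 1: "jumps C h = 1" using H1[OF h] by simp
      then have "\<exists>c. c < h \<and> c \<in> C \<and> Suc c \<in> C"
        unfolding jumps_def by (auto dest: card_eq_SucD)
      \<comment> \<open>The first jump starts at \<open>a\<close>. Then \<open>a + 2\<close> is a
        hole, for otherwise the jump from \<open>a + 1\<close> would be a second one below
        \<open>h\<close>; this is the situation excluded by \<open>H2\<close>.\<close>
      then obtain a where a: "a < h" "a \<in> C" "Suc a \<in> C"
        and least: "\<And>c. c < a \<Longrightarrow> \<not> (c < h \<and> c \<in> C \<and> Suc c \<in> C)"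
        using exists_least_iff[of "\<lambda>c. c < h \<and> c \<in> C \<and> Suc c \<in> C"] by blast
      have no: "{c. c < a \<and> c \<in> C \<and> Suc c \<in> C} = {}"
        using least a(1) by auto
      have ja: "jumps C a = 0"
        unfolding jumps_def no by simp
      have "a \<noteq> 0" using a(3) False by (metis One_nat_def)
      moreover have "even a" using mem[of a] a h ja by simp
      ultimately have "a \<ge> 2" by presburger
      have "h \<noteq> Suc a" using a h by auto
      then have le: "a + 2 \<le> h" using a by simp
      have "a + 2 \<notin> C"
      proof
        assume "a + 2 \<in> C"
        then have "jumps C (a + 2) = 2" using a ja by simp
        then show False using jumps_mono[OF le, of C] 1 by simp
      qed
      then show False
        using H2[of a] le h a ja \<open>a \<ge> 2\<close> by simp
    qed
    have "k \<in> C" if "k \<le> n" "even k" for k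
      using hole[of k] mem[of k] that \<open>n \<in> C\<close> by (cases "k = n") auto
    moreover have "k \<in> C" if "k \<le> n" "n \<le> k + jumps C n" for k
    proof (rule ccontr)
      assume k: "k \<notin> C"
      then have "k < n" using that \<open>n \<in> C\<close> by (metis le_neq_implies_less)
      then show False using above[of k] hole[of k] k that by simp
    qed
    moreover have "jumps C n + 2 \<le> n"
    proof -
      have "1 < n" using False \<open>n \<in> C\<close> \<open>n \<noteq> 0\<close> by (cases "n = 1") auto
      then show ?thesis using above[of 1] hole[of 1] False by simp
    qed
    ultimately show ?thesis by (simp add: typeB_def)
  qed
qed

section \<open>The critical instance of type distance 4 and the shape of its degree sets\<close>

locale critical = induction_step V N inc
  for V :: "'v set" and N and inc :: "'i \<Rightarrow> 'v \<Rightarrow> nat" +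
  fixes C :: "'v \<Rightarrow> nat set" and I :: "'i set" and \<Delta> :: "'i \<Rightarrow> real"
  assumes I: "inst V inc C I" and card_I: "card I = N" and norm_I: "norm_type V inc C I = 4"
    and pos: "sum \<Delta> I > 0" and not_improvable: "\<not> improvable V inc C I \<Delta>"
begin

abbreviation "n v \<equiv> ideg inc I v"
abbreviation "d T v \<equiv> ideg inc T v"
abbreviation "r v \<equiv> jumps (C v) (n v)"

lemma finV [simp]: "finite V" and finI [simp]: "finite I"
  and link: "i \<in> I \<Longrightarrow> link V (inc i)"
  and holes: "v \<in> V \<Longrightarrow> isolated_holes (C v) (n v)"
  using instD[OF I] by auto

lemma fin_sub: "T \<subseteq> I \<Longrightarrow> finite T"
  using finI by (rule finite_subset[rotated])

lemma d_le: "T \<subseteq> I \<Longrightarrow> d T v \<le> n v"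
  by (simp add: ideg_mono)

lemma valid_nonpos:
  assumes "T \<subseteq> I" "T \<noteq> I" "\<forall>v\<in>V. d T v \<in> C v"
  shows "sum \<Delta> T \<le> 0"
proof (rule ccontr)
  assume "\<not> sum \<Delta> T \<le> 0"
  then have "T \<noteq> {}" "sum \<Delta> T > 0" by auto
  moreover have "T \<subset> I" "valid V inc C T" using assms by (auto simp: valid_def)
  ultimately show False
    using not_improvable unfolding improvable_def by blast
qed

text \<open>Here the complement of \<open>T\<close> is valid.\<close>

lemma covalid_ge:
  assumes "T \<subseteq> I" "T \<noteq> {}" "\<forall>v\<in>V. n v - d T v \<in> C v"
  shows "sum \<Delta> T \<ge> sum \<Delta> I"
proof -
  have "sum \<Delta> (I - T) \<le> 0"
    using assms by (intro valid_nonpos) (auto simp: ideg_Diff)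
  then show ?thesis
    using assms by (simp add: sum_diff)
qed

lemma valid_covalid:
  assumes "T \<subseteq> I" "T \<noteq> {}" "T \<noteq> I" "\<forall>v\<in>V. d T v \<in> C v" "\<forall>v\<in>V. n v - d T v \<in> C v"
  shows False
  using valid_nonpos[of T] covalid_ge[of T] assms pos by simp

text \<open>Filling the hole \<open>h\<close> adds two jumps at \<open>v\<close>, so that the case of large norm applies; a minimal
  improving set for the enlarged \<open>C v\<close> has degree \<open>h\<close> at \<open>v\<close>.\<close>

lemma hole_set:
  assumes v: "v \<in> V" and h: "h < n v" "h \<notin> C v"
  obtains T where "T \<subset> I" "d T v = h" "\<And>w. w \<in> V \<Longrightarrow> w \<noteq> v \<Longrightarrow> d T w \<in> C w" "sum \<Delta> T > 0"
    "Suc (jumps (C v) h) + (\<Sum>w\<in>V - {v}. jumps (C w) (d T w)) \<le> 2"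
    "\<And>X. X \<subset> T \<Longrightarrow> X \<noteq> {} \<Longrightarrow> (\<And>w. w \<in> V \<Longrightarrow> w \<noteq> v \<Longrightarrow> d X w \<in> C w) \<Longrightarrow>
       d X v \<in> insert h (C v) \<Longrightarrow> sum \<Delta> X \<le> 0"
proof -
  define C' where "C' = C(v := insert h (C v))"
  have pred: "h > 0" "h - 1 \<in> C v"
    using isolated_holes_pred[OF holes[OF v], of h] h by auto
  have suc: "Suc h \<in> C v"
    using holes[OF v] h by (auto simp: isolated_holes_def)
  have inst': "inst V inc C' I"
    using I isolated_holes_insert by (auto simp: inst_def C'_def)
  have "norm_type V inc C' I = norm_type V inc C I + 2"
    using jumps_insert_hole(2)[OF h(2) pred suc h(1)] v
    by (simp add: norm_type_def sum.remove[of V v] C'_def)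
  \<comment> \<open>The norm has become 6, so the case of norm at least 5 applies although
    \<open>I\<close> has \<open>N\<close> items.\<close>
  then have "improvable V inc C' I \<Delta>"
    using improvable_large_norm[OF inst' card_I _ pos] norm_I by simp
  then obtain T1 where "T1 \<subset> I \<and> T1 \<noteq> {} \<and> valid V inc C' T1 \<and> sum \<Delta> T1 > 0"
    by (auto simp: improvable_def)
  then obtain T where T: "T \<subset> I" "T \<noteq> {}" "valid V inc C' T" "sum \<Delta> T > 0"
    and min: "\<And>S. S \<subset> I \<and> S \<noteq> {} \<and> valid V inc C' S \<and> sum \<Delta> S > 0 \<Longrightarrow> card T \<le> card S"
    using ex_has_least_nat[of "\<lambda>T. T \<subset> I \<and> T \<noteq> {} \<and> valid V inc C' T \<and> sum \<Delta> T > 0" _ card] by metis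
  have finT: "finite T" using T fin_sub by blast
  have minimal: "sum \<Delta> X \<le> 0" if "X \<subset> T" "X \<noteq> {}" "valid V inc C' X" for X
    using min[of X] that T psubset_card_mono[OF finT that(1)] by fastforce
  have "\<not> valid V inc C T"
    using valid_nonpos[of T] T by (auto simp: valid_def)
  moreover have w: "d T w \<in> C w" if "w \<in> V" "w \<noteq> v" for w
    using T(3) that by (auto simp: valid_def C'_def)
  moreover have dv: "d T v \<in> insert h (C v)"
    using T(3) v by (auto simp: valid_def C'_def)
  ultimately have dTv: "d T v = h"
    by (auto simp: valid_def)
  have "norm_type V inc C' T \<le> 2"
  proof (rule ccontr)
    assume "\<not> norm_type V inc C' T \<le> 2"
    then have "improvable V inc C' T \<Delta>"
      using IH[OF inst_sub[OF inst']] T psubset_card_mono[OF finI T(1)] card_I by auto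
    then show False
      using minimal unfolding improvable_def by (meson not_less)
  qed
  moreover have "norm_type V inc C' T = Suc (jumps (C v) h) + (\<Sum>w\<in>V - {v}. jumps (C w) (d T w))"
    using jumps_insert_hole(1)[OF h(2) pred] v
    by (simp add: norm_type_def sum.remove[of V v] C'_def dTv)
  moreover have "sum \<Delta> X \<le> 0" if "X \<subset> T" "X \<noteq> {}" "\<And>w. w \<in> V \<Longrightarrow> w \<noteq> v \<Longrightarrow> d X w \<in> C w"
    "d X v \<in> insert h (C v)" for X
    using that by (intro minimal) (auto simp: valid_def C'_def)
  ultimately show ?thesis
    using that[of T] T dTv w by auto
qed

text \<open>The set given by \<open>hole_set\<close> has no jumps away from \<open>v\<close>. With even degrees at all other vertices and
  arbitrary ones at \<open>v\<close> it is a smaller instance, where the handshake lemma makes the degree at \<open>v\<close>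
  even as well.\<close>

lemma no_hole_after_first_jump:
  assumes v: "v \<in> V" and a: "a + 2 < n v" "a \<ge> 2" "a \<in> C v" "a + 1 \<in> C v" "a + 2 \<notin> C v" "jumps (C v) a = 0"
  shows False
proof -
  obtain T where T: "T \<subset> I" "d T v = a + 2" "\<And>w. w \<in> V \<Longrightarrow> w \<noteq> v \<Longrightarrow> d T w \<in> C w" "sum \<Delta> T > 0"
    "Suc (jumps (C v) (a + 2)) + (\<Sum>w\<in>V - {v}. jumps (C w) (d T w)) \<le> 2"
    and minimal: "\<And>X. X \<subset> T \<Longrightarrow> X \<noteq> {} \<Longrightarrow> (\<And>w. w \<in> V \<Longrightarrow> w \<noteq> v \<Longrightarrow> d X w \<in> C w) \<Longrightarrow>
       d X v \<in> insert (a + 2) (C v) \<Longrightarrow> sum \<Delta> X \<le> 0"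
    using hole_set[OF v a(1) a(5)] by blast
  have finT: "finite T" using T fin_sub by blast
  \<comment> \<open>The norm bound 2 is used up at \<open>v\<close>, by the jump from
    \<open>a\<close> and the one into the filled hole.\<close>
  have "jumps (C v) (a + 2) = 1" using a by simp
  then have "(\<Sum>w\<in>V - {v}. jumps (C w) (d T w)) = 0" using T(5) by simp
  then have j0: "jumps (C w) (d T w) = 0" if "w \<in> V" "w \<noteq> v" for w
    using that by simp
  have dTle: "d T w \<le> n w" for w using T d_le by blast
  have evenT: "even (d T w)" if "w \<in> V" "w \<noteq> v" for w
    using mem_iff_even_jumps[OF holes dTle] T(3) j0 that by simp
  have even_a: "even a"
    using mem_iff_even_jumps[OF holes[OF v], of a] a by simp
  define E where "E = (\<lambda>w. if w = v then UNIV else {k :: nat. even k})"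
  have "jumps UNIV t = t" for t by (induction t) auto
  have inst': "inst V inc E T"
    using T(1) link finT evenT by (auto simp: inst_def E_def isolated_holes_def)
  have "jumps (E v) (d T v) \<le> norm_type V inc E T"
    unfolding norm_type_def using v by (intro member_le_sum) auto
  \<comment> \<open>Since every degree is allowed at \<open>v\<close>, each of the
    \<open>a + 2\<close> steps there is a jump.\<close>
  then have "norm_type V inc E T \<ge> 3"
    using \<open>\<And>t. jumps UNIV t = t\<close> a T by (simp add: E_def)
  then have "improvable V inc E T \<Delta>"
    using IH[OF inst'] T psubset_card_mono[OF finI T(1)] card_I by auto
  then obtain X where X: "X \<subset> T" "X \<noteq> {}" "valid V inc E X" "sum \<Delta> X > 0"
    by (auto simp: improvable_def)
  have Xle: "d X w \<le> d T w" for w using X(1) finT by (intro ideg_mono) auto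
  have evenX: "even (d X w)" if "w \<in> V" "w \<noteq> v" for w
    using X(3) that by (auto simp: valid_def E_def)
  have "even (\<Sum>w\<in>V - {v}. d X w)"
    using evenX by (intro dvd_sum) auto
  moreover have "(\<Sum>w\<in>V. d X w) = 2 * card X"
    using X(1) T(1) link fin_sub[of X] by (intro handshake) auto
  ultimately have even_Xv: "even (d X v)"
    using v by (simp add: sum.remove[of V v]) (metis dvd_triv_left even_add)
  have "d X w \<in> C w" if "w \<in> V" "w \<noteq> v" for w
    using even_mem_of_no_jumps[OF holes dTle j0 Xle evenX] that by simp
  moreover have "d X v \<in> insert (a + 2) (C v)"
  proof (cases "d X v = a + 2")
    case False
    then have "d X v \<noteq> a + 1" "d X v \<le> a + 2"
      using even_Xv even_a Xle[of v] T(2) by auto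
    then have "d X v \<le> a" using False by simp
    then show ?thesis
      using even_mem_of_no_jumps[OF holes[OF v] _ a(6) _ even_Xv] a by simp
  qed simp
  ultimately show False
    using minimal[of X] X by fastforce
qed

lemma types:
  assumes "v \<in> V" "r v \<ge> 1"
  shows "typeA (C v) (n v) (r v) \<or> typeB (C v) (n v) (r v)"
proof (rule typeA_or_typeB[OF holes[OF assms(1)] assms(2)])
  show "jumps (C v) h \<le> 1" if "h < n v" "h \<notin> C v" for h
  proof -
    note h = that
    obtain T where "Suc (jumps (C v) h) + (\<Sum>w\<in>V - {v}. jumps (C w) (d T w)) \<le> 2"
      using hole_set[OF assms(1) h] by metis
    then show ?thesis by simp
  qed
  show False if "a + 2 < n v" "a \<ge> 2" "a \<in> C v" "a + 1 \<in> C v" "a + 2 \<notin> C v" "jumps (C v) a = 0" for a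
    using no_hole_after_first_jump[OF assms(1) that] .
qed

text \<open>Replacing two items that meet at \<open>v\<close> by one item joining their other ends gives a smaller instance
  whose norm is still at least 3.\<close>

lemma merge:
  assumes e: "e \<in> I" "e' \<in> I" "e \<noteq> e'" and V: "v \<in> V" "x \<in> V" "y \<in> V"
    and inc: "inc e = (\<lambda>w. of_bool (w = v) + of_bool (w = x))"
      "inc e' = (\<lambda>w. of_bool (w = v) + of_bool (w = y))"
    and D: "isolated_holes D (n v - 2)" "r v \<le> Suc (jumps D (n v - 2))"
    and lift: "\<And>X t. X \<subseteq> I - {e'} \<Longrightarrow> t \<in> D \<Longrightarrow> t \<le> n v - 2 \<Longrightarrow>
       t = d (X - {e}) v + (if e \<in> X then of_bool (v = x) + of_bool (v = y) else 0) \<Longrightarrow>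
       (if e \<in> X then t + 2 else t) \<in> C v"
  shows False
proof -
  define inc' where "inc' = inc(e := \<lambda>w. of_bool (w = x) + of_bool (w = y))"
  define J where "J = I - {e'}"
  \<comment> \<open>\<open>\<phi>\<close> puts the two original items back in place of the merged
    one; this changes only the degree at \<open>v\<close>, by 2.\<close>
  define \<phi> where "\<phi> X = (if e \<in> X then insert e' X else X)" for X
  have same: "ideg inc' (X - {e}) w = d (X - {e}) w" for X w
    unfolding ideg_def by (intro sum.cong) (auto simp: inc'_def)
  have d': "ideg inc' X w = d (X - {e}) w + (if e \<in> X then of_bool (w = x) + of_bool (w = y) else 0)"
    if "X \<subseteq> J" for X w
  proof (cases "e \<in> X")
    case True
    have "finite X" using that fin_sub[of X] by (auto simp: J_def)
    then show ?thesis
      using True ideg_insert[of "X - {e}" e inc' w] same[of X w]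
      by (simp add: insert_absorb) (simp add: inc'_def)
  next
    case False
    then show ?thesis using same[of X w] by simp
  qed
  have d\<phi>: "d (\<phi> X) w = ideg inc' X w + (if e \<in> X \<and> w = v then 2 else 0)" if "X \<subseteq> J" for X w
  proof (cases "e \<in> X")
    case True
    have "finite X" "e' \<notin> X" using that fin_sub[of X] by (auto simp: J_def)
    then have "d (insert e' X) w = inc e' w + (inc e w + d (X - {e}) w)"
      using True ideg_insert[of "X - {e}" e inc w] by (simp add: ideg_insert insert_absorb)
    then show ?thesis
      using True d'[OF that, of w] by (simp add: \<phi>_def inc)
  next
    case False
    then show ?thesis using d'[OF that, of w] by (simp add: \<phi>_def)
  qed
  have \<phi>J: "\<phi> J = I" using e by (auto simp: \<phi>_def J_def)
  have eJ: "e \<in> J" using e by (auto simp: J_def)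
  have nJ: "n w = ideg inc' J w + (if w = v then 2 else 0)" for w
    using d\<phi>[of J w] \<phi>J eJ by simp
  define C' where "C' = C(v := D)"
  have inst': "inst V inc' C' J"
    unfolding inst_def
  proof (intro conjI ballI)
    show "link V (inc' i)" if "i \<in> J" for i
      using that link[of i] V by (auto simp: inc'_def J_def link_def)
    show "isolated_holes (C' w) (ideg inc' J w)" if "w \<in> V" for w
      using that holes[OF that] D(1) nJ[of w] by (cases "w = v") (auto simp: C'_def)
  qed (auto simp: J_def)
  \<comment> \<open>Of the 4 jumps at most one is lost, namely at \<open>v\<close>, by assumption on
    \<open>D\<close>.\<close>
  have "norm_type V inc' C' J \<ge> 3"
  proof -
    have "(\<Sum>w\<in>V - {v}. jumps (C' w) (ideg inc' J w)) = (\<Sum>w\<in>V - {v}. r w)"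
      using nJ by (intro sum.cong) (auto simp: C'_def)
    then show ?thesis
      using norm_I D(2) nJ[of v] V
      by (simp add: norm_type_def sum.remove[of V v]) (simp add: C'_def)
  qed
  moreover define \<Delta>' where "\<Delta>' = \<Delta>(e := \<Delta> e + \<Delta> e')"
  have sum': "sum \<Delta>' X = sum \<Delta> (\<phi> X)" if "X \<subseteq> J" for X
  proof -
    have X: "finite X" "e' \<notin> X" using that fin_sub[of X] by (auto simp: J_def)
    have *: "sum \<Delta>' (X - {e}) = sum \<Delta> (X - {e})"
      by (intro sum.cong) (auto simp: \<Delta>'_def)
    show ?thesis
    proof (cases "e \<in> X")
      case True
      then show ?thesis
        using X * by (simp add: \<phi>_def sum.remove[of X e]) (simp add: \<Delta>'_def)
    next
      case False
      then show ?thesis using * by (simp add: \<phi>_def)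
    qed
  qed
  have "card J < N"
    using e card_I card_Diff1_less[OF finI e(2)] by (simp add: J_def)
  ultimately have "improvable V inc' C' J \<Delta>'"
    using IH[OF inst'] sum'[of J] \<phi>J pos by simp
  then obtain X where X: "X \<subset> J" "X \<noteq> {}" "valid V inc' C' X" "sum \<Delta>' X > 0"
    by (auto simp: improvable_def)
  have XJ: "X \<subseteq> J" using X by blast
  have "\<phi> X \<subseteq> I" "\<phi> X \<noteq> I"
    using X(1) e by (auto simp: \<phi>_def J_def)
  moreover have "d (\<phi> X) w \<in> C w" if w: "w \<in> V" for w
  proof (cases "w = v")
    case True
    have "ideg inc' X v \<le> ideg inc' J v"
      using XJ by (intro ideg_mono) (auto simp: J_def)
    then have "ideg inc' X v \<le> n v - 2" using nJ[of v] by simp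
    moreover have "ideg inc' X v \<in> D"
      using X(3) V by (auto simp: valid_def C'_def)
    ultimately have "(if e \<in> X then ideg inc' X v + 2 else ideg inc' X v) \<in> C v"
      using lift[of X "ideg inc' X v"] XJ d'[OF XJ, of v] by (auto simp: J_def)
    then show ?thesis
      using d\<phi>[OF XJ, of v] True by (auto split: if_splits)
  next
    case False
    then have "d (\<phi> X) w = ideg inc' X w" using d\<phi>[OF XJ, of w] by simp
    then show ?thesis
      using X(3) w False by (auto simp: valid_def C'_def)
  qed
  ultimately show False
    using valid_nonpos[of "\<phi> X"] sum'[OF XJ] X(4) by simp
qed

end

text \<open>Pairs are split off one after the other. If three elements remain, their three pairs
  show that twice their sum is at least three times \<open>\<delta>\<close>.\<close>

lemma sum_pairs_ge:
  fixes \<Delta> :: "'i \<Rightarrow> real"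
  assumes "finite F" "card F \<ge> 2" "\<And>a b. a \<in> F \<Longrightarrow> b \<in> F \<Longrightarrow> a \<noteq> b \<Longrightarrow> \<Delta> a + \<Delta> b \<ge> \<delta>" "\<delta> \<ge> 0"
  shows "sum \<Delta> F \<ge> real (card F div 2) * \<delta>"
  using assms(1-3)
proof (induction "card F" arbitrary: F rule: less_induct)
  case less
  have "F \<noteq> {}" using less.prems(2) by auto
  then obtain a where aF: "a \<in> F" by blast
  define G where "G = F - {a}"
  have a: "F = insert a G" "a \<notin> G" "card G = card F - 1" "finite G"
    using aF less.prems(1) by (auto simp: G_def)
  have "G \<noteq> {}" using a(3) less.prems(2) by auto
  then obtain b where bG: "b \<in> G" by blast
  define H where "H = G - {b}"
  have b: "G = insert b H" "b \<notin> H" "card H = card G - 1" "finite H"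
    using bG a(4) by (auto simp: H_def)
  have cF: "card F = card H + 2" using a(3) b(3) less.prems(2) by linarith
  have in_F: "a \<in> F" "b \<in> F" "H \<subseteq> F" "a \<noteq> b" "a \<notin> H"
    using aF bG by (auto simp: G_def H_def)
  have ab: "\<Delta> a + \<Delta> b \<ge> \<delta>" using less.prems(3)[OF in_F(1,2,4)] .
  have F: "sum \<Delta> F = \<Delta> a + \<Delta> b + sum \<Delta> H"
    using a(2,4) b(2,4) unfolding a(1) b(1) by simp
  consider "card H = 0" | "card H = 1" | "card H \<ge> 2" by linarith
  then show ?case
  proof cases
    case 1
    then have "H = {}" using b(4) by simp
    then show ?thesis using F ab cF by simp
  next
    case 2
    then obtain c where c: "H = {c}" by (auto simp: card_1_singleton_iff)
    have "c \<in> F" "a \<noteq> c" "b \<noteq> c" using in_F b(2) c by auto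
    then have "\<Delta> a + \<Delta> c \<ge> \<delta>" "\<Delta> b + \<Delta> c \<ge> \<delta>"
      using less.prems(3)[OF in_F(1)] less.prems(3)[OF in_F(2)] by blast+
    then have "sum \<Delta> F \<ge> \<delta>" using F ab c assms(4) by simp
    then show ?thesis using cF 2 by simp
  next
    case 3
    have "\<And>a b. a \<in> H \<Longrightarrow> b \<in> H \<Longrightarrow> a \<noteq> b \<Longrightarrow> \<Delta> a + \<Delta> b \<ge> \<delta>"
      using less.prems(3) in_F(3) by blast
    moreover have "card H < card F" using cF by simp
    ultimately have "sum \<Delta> H \<ge> real (card H div 2) * \<delta>"
      using less.hyps b(4) 3 by blast
    moreover have "real (card F div 2) * \<delta> = real (card H div 2) * \<delta> + \<delta>"
      using cF by (simp add: algebra_simps)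
    ultimately show ?thesis using F ab by linarith
  qed
qed

section \<open>Parallel items; vertices without jumps and loops are excluded\<close>

context critical
begin

definition L :: "'v \<Rightarrow> 'v \<Rightarrow> 'i set" where
  "L x y = {i \<in> I. inc i = (\<lambda>w. of_bool (w = x) + of_bool (w = y))}"

definition S :: "'v set" where "S = {v \<in> V. n v > 0}"

lemma L_sym: "L x y = L y x"
proof -
  have "(\<lambda>w. of_bool (w = x) + of_bool (w = y) :: nat) = (\<lambda>w. of_bool (w = y) + of_bool (w = x))"
    by (rule ext) (rule add.commute)
  then show ?thesis by (simp add: L_def)
qed

lemma L_sub: "L x y \<subseteq> I" and fin_L [simp]: "finite (L x y)"
  by (auto simp: L_def)

lemma inc_L: "i \<in> L x y \<Longrightarrow> inc i w = of_bool (w = x) + of_bool (w = y)"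
  by (auto simp: L_def)

lemma L_in: "i \<in> L x y \<Longrightarrow> i \<in> I"
  by (auto simp: L_def)

lemma d_L: "T \<subseteq> L x y \<Longrightarrow> d T w = card T * (of_bool (w = x) + of_bool (w = y))"
proof -
  assume T: "T \<subseteq> L x y"
  have "d T w = (\<Sum>i\<in>T. of_bool (w = x) + of_bool (w = y))"
    unfolding ideg_def
  proof (rule sum.cong[OF refl])
    fix i assume "i \<in> T"
    then show "inc i w = of_bool (w = x) + of_bool (w = y)"
      using T inc_L[of i x y w] by blast
  qed
  then show ?thesis by simp
qed

lemma S_V: "v \<in> S \<Longrightarrow> v \<in> V" and S_pos: "v \<in> S \<Longrightarrow> n v > 0"
  by (auto simp: S_def)

lemma finS [simp]: "finite S"
  by (simp add: S_def)

lemma inc_le_n: "i \<in> I \<Longrightarrow> inc i w \<le> n w"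
  unfolding ideg_def by (rule member_le_sum) auto

lemma L_ends:
  assumes "i \<in> I"
  obtains x y where "x \<in> S" "y \<in> S" "i \<in> L x y"
proof -
  obtain x y where xy: "x \<in> V" "y \<in> V" "inc i = (\<lambda>w. of_bool (w = x) + of_bool (w = y))"
    using link[OF assms] by (auto simp: link_def)
  have "n x > 0" "n y > 0"
    using inc_le_n[OF assms, of x] inc_le_n[OF assms, of y] xy(3) by auto
  then show ?thesis
    using that[of x y] xy assms by (auto simp: S_def L_def)
qed

lemma L_disjoint: "{x, y} \<noteq> {x', y'} \<Longrightarrow> L x y \<inter> L x' y' = {}"
proof (rule ccontr)
  assume ne: "{x, y} \<noteq> {x', y'}" and "L x y \<inter> L x' y' \<noteq> {}"
  then obtain i where i: "i \<in> L x y" "i \<in> L x' y'" by blast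
  have "w \<in> {x, y} \<longleftrightarrow> inc i w > 0" for w
    using inc_L[OF i(1), of w] by auto
  moreover have "w \<in> {x', y'} \<longleftrightarrow> inc i w > 0" for w
    using inc_L[OF i(2), of w] by auto
  ultimately have "w \<in> {x, y} \<longleftrightarrow> w \<in> {x', y'}" for w by blast
  then show False using ne by blast
qed

lemma I_two: "S = {v, w} \<Longrightarrow> I = L v v \<union> L w w \<union> L v w"
proof
  assume S: "S = {v, w}"
  show "I \<subseteq> L v v \<union> L w w \<union> L v w"
  proof
    fix i assume "i \<in> I"
    then obtain x y where "x \<in> S" "y \<in> S" "i \<in> L x y" by (rule L_ends)
    then show "i \<in> L v v \<union> L w w \<union> L v w"
      using S L_sym[of w v] by auto
  qed
qed (use L_sub in auto)

lemma zero_C: "v \<in> V \<Longrightarrow> 0 \<in> C v" and n_C: "v \<in> V \<Longrightarrow> n v \<in> C v"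
  using holes by (auto simp: isolated_holes_def)

lemma nonposI:
  assumes "T \<subseteq> I" "T \<noteq> I" "\<And>v. v \<in> S \<Longrightarrow> d T v \<in> C v"
  shows "sum \<Delta> T \<le> 0"
proof (rule valid_nonpos[OF assms(1,2)], rule ballI)
  fix v assume v: "v \<in> V"
  show "d T v \<in> C v"
  proof (cases "v \<in> S")
    case False
    then have "d T v = 0" using d_le[OF assms(1), of v] v by (simp add: S_def)
    then show ?thesis using zero_C[OF v] by simp
  qed (rule assms(3))
qed

lemma geI:
  assumes "T \<subseteq> I" "T \<noteq> {}" "\<And>v. v \<in> S \<Longrightarrow> n v - d T v \<in> C v"
  shows "sum \<Delta> T \<ge> sum \<Delta> I"
proof (rule covalid_ge[OF assms(1,2)], rule ballI)
  fix v assume v: "v \<in> V"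
  show "n v - d T v \<in> C v"
  proof (cases "v \<in> S")
    case False
    then have "n v = 0" using v by (simp add: S_def)
    then show ?thesis using zero_C[OF v] by simp
  qed (rule assms(3))
qed

lemma parity_n: "v \<in> V \<Longrightarrow> even (n v + r v)"
  using mem_iff_even_jumps[OF holes, of v "n v"] n_C by simp

lemma sum_r: "(\<Sum>v\<in>S. r v) = 4"
proof -
  have "(\<Sum>v\<in>S. r v) = (\<Sum>v\<in>V. r v)"
    by (rule sum.mono_neutral_left) (auto simp: S_def)
  then show ?thesis using norm_I by (simp add: norm_type_def)
qed

lemma card_I_ge: "card I \<ge> 2"
proof -
  have "norm_type V inc C I \<le> (\<Sum>v\<in>V. n v)"
    unfolding norm_type_def by (intro sum_mono jumps_le)
  then have "4 \<le> (\<Sum>v\<in>V. n v)" using norm_I by simp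
  then show ?thesis
    using handshake[of V I inc] link by simp
qed

text \<open>Without jumps the admissible degrees up to \<open>n v\<close> are exactly the even ones.
  A loop at \<open>v\<close> would then be admissible together with its complement, and two items
  meeting at \<open>v\<close> can be merged without losing any jump.\<close>

lemma r_pos:
  assumes "v \<in> S"
  shows "r v \<ge> 1"
proof (rule ccontr)
  assume "\<not> r v \<ge> 1"
  then have r0: "r v = 0" by simp
  have v: "v \<in> V" using assms S_V by blast
  have even_C: "k \<in> C v" if "k \<le> n v" "even k" for k
    using even_mem_of_no_jumps[OF holes[OF v] _ r0] that by simp
  have C_even: "even k" if "k \<le> n v" "k \<in> C v" for k
    using mem_iff_even_jumps[OF holes[OF v] that(1)] jumps_mono[OF that(1), of "C v"] r0 that by simp
  have evn: "even (n v)" using C_even n_C[OF v] by simp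
  show False
  proof (cases "L v v = {}")
    case False
    then obtain i where i: "i \<in> L v v" by blast
    have di: "d {i} w = (if w = v then 2 else 0)" for w
      using d_L[of "{i}" v v w] i by simp
    have ne: "{i} \<noteq> I" using card_I_ge by auto
    have "2 \<le> n v" using di[of v] d_le[of "{i}" v] i L_in by auto
    then show False
      using i L_in even_C evn zero_C n_C by (intro valid_covalid[OF _ _ ne]) (auto simp: di)
  next
    case True
    obtain e where e: "e \<in> I" "inc e v > 0"
      using S_pos[OF assms] unfolding ideg_def by (metis bot_nat_0.not_eq_extremum sum.neutral)
    obtain x where x: "x \<in> V" "inc e = (\<lambda>w. of_bool (w = v) + of_bool (w = x))"
      using link_endpoint[OF link[OF e(1)] e(2)] by blast
    have "x \<noteq> v" using True e x by (auto simp: L_def)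
    then have "d (I - {e}) v = n v - 1"
      using ideg_Diff[of I "{e}" inc v] e x by (simp add: ideg_def)
    moreover have n2: "n v \<ge> 2" using evn S_pos[OF assms] by (cases "n v = 1") auto
    ultimately have "d (I - {e}) v > 0" by simp
    then obtain e' where e': "e' \<in> I - {e}" "inc e' v > 0"
      unfolding ideg_def by (metis bot_nat_0.not_eq_extremum sum.neutral)
    obtain y where y: "y \<in> V" "inc e' = (\<lambda>w. of_bool (w = v) + of_bool (w = y))"
      using link_endpoint[OF link[of e'] e'(2)] e' by blast
    show False
    proof (rule merge[OF e(1) _ _ v x(1) y(1) x(2) y(2), of "C v"])
      show "isolated_holes (C v) (n v - 2)"
        using even_C evn by (intro isolated_holes_below[OF holes[OF v]]) auto
      show "(if e \<in> X then t + 2 else t) \<in> C v" if "t \<in> C v" "t \<le> n v - 2" for X t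
        using that even_C[of "t + 2"] C_even[of t] n2 by simp
    qed (use e' r0 in auto)
  qed
qed

lemma typeAB: "v \<in> S \<Longrightarrow> typeA (C v) (n v) (r v) \<or> typeB (C v) (n v) (r v)"
  using types[of v] r_pos[of v] S_V by blast

text \<open>A loop is merged with another item at \<open>v\<close>, at the cost of at most one jump;
  if there is no other item at \<open>v\<close>, the loop and its complement are both
  admissible.\<close>

lemma loopless_merge:
  assumes v: "v \<in> S" and T: "typeA (C v) (n v) (r v) \<and> r v \<le> 2 \<or> typeB (C v) (n v) (r v) \<and> r v = 1"
  shows "L v v = {}"
proof (rule ccontr)
  assume "L v v \<noteq> {}"
  then obtain l where l: "l \<in> L v v" by blast
  have vV: "v \<in> V" using v S_V by blast
  have r1: "r v = 1 \<or> r v = 2" using T r_pos[OF v] by linarith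
  have dl: "d {l} w = (if w = v then 2 else 0)" for w
    using d_L[of "{l}" v v w] l by simp
  have n2: "n v \<ge> 2" using dl[of v] d_le[of "{l}" v] l L_in by auto
  show False
  proof (cases "n v = 2")
    case True
    have ne: "{l} \<noteq> I" using card_I_ge by auto
    have "d {l} u \<in> C u" "n u - d {l} u \<in> C u" if "u \<in> V" for u
      using zero_C[OF that] n_C[OF that] True by (auto simp: dl)
    then show False
      using l L_in by (intro valid_covalid[OF _ _ ne]) auto
  next
    case False
    have dIl: "d (I - {l}) v = n v - 2"
      using ideg_Diff[of I "{l}" inc v] l L_in by (simp add: dl)
    then have "d (I - {l}) v > 0" using n2 False by simp
    then obtain e where e: "e \<in> I - {l}" "inc e v > 0"
      unfolding ideg_def by (metis bot_nat_0.not_eq_extremum sum.neutral)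
    obtain x where x: "x \<in> V" "inc e = (\<lambda>w. of_bool (w = v) + of_bool (w = x))"
      using link_endpoint[OF link[of e] e(2)] e by blast
    have inc_l: "inc l = (\<lambda>w. of_bool (w = v) + of_bool (w = v))" using l by (simp add: L_def)
    \<comment> \<open>The numbers of the good parity stay admissible when 2 is added. The extra
      number 0 can only be the degree of a set without the merged item, and \<open>n v - 2\<close>
      only that of a set with it, where it stands for \<open>n v\<close>. For type A the numbers 0
      and 1 still form one jump.\<close>
    define D where "D = insert (n v - 2) (insert 0 {k. if typeA (C v) (n v) (r v) then odd k else even k})"
    have small: "d (X - {e}) v < n v - 2" if "X \<subseteq> I - {l}" for X
    proof -
      have "d (X - {e}) v \<le> d (I - {l} - {e}) v"
        using that by (intro ideg_mono) auto
      also have "\<dots> = n v - 2 - inc e v"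
        using ideg_Diff[of "I - {l}" "{e}" inc v] e dIl by (simp add: ideg_def)
      finally show ?thesis using e(2) n2 False by linarith
    qed
    show False
    proof (rule merge[OF _ _ _ vV x(1) vV x(2) inc_l, of D])
      show "isolated_holes D (n v - 2)"
        by (auto simp: isolated_holes_def D_def)
      show "r v \<le> Suc (jumps D (n v - 2))"
      proof (cases "r v = 1")
        case False
        then have "typeA (C v) (n v) (r v)" using T by auto
        then have "jumps D (Suc 0) = 1" by (simp add: D_def)
        moreover have "Suc 0 \<le> n v - 2" using n2 \<open>n v \<noteq> 2\<close> by simp
        ultimately have "jumps D (n v - 2) \<ge> 1" using jumps_mono[of "Suc 0" "n v - 2" D] by linarith
        then show ?thesis using r1 by linarith
      qed simp
      show "(if e \<in> X then t + 2 else t) \<in> C v"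
        if X: "X \<subseteq> I - {l}" and t: "t \<in> D" "t \<le> n v - 2"
          "t = d (X - {e}) v + (if e \<in> X then of_bool (v = x) + of_bool (v = v) else 0)" for X t
      proof (cases "typeA (C v) (n v) (r v)")
        case True
        show ?thesis
        proof (cases "e \<in> X")
          case e: True
          then have "odd (t + 2) \<or> t + 2 = n v" using t True n2 by (auto simp: D_def)
          moreover have "t + 2 \<le> n v" using t(2) n2 by simp
          ultimately have "t + 2 \<in> C v"
            using True n_C[OF vV] unfolding typeA_def by metis
          then show ?thesis using e by simp
        next
          case e: False
          then have "t < n v - 2" using small[OF X] t(3) by simp
          then show ?thesis
            using e True t(1) zero_C[OF vV] by (auto simp: typeA_def D_def)
        qed
      next
        case False
        then have B: "typeB (C v) (n v) (r v)" using T by auto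
        show ?thesis
        proof (cases "e \<in> X")
          case e: True
          then have "even (t + 2) \<or> t + 2 = n v" using t False n2 by (auto simp: D_def)
          moreover have "t + 2 \<le> n v" using t(2) n2 by simp
          ultimately have "t + 2 \<in> C v"
            using B n_C[OF vV] unfolding typeB_def by metis
          then show ?thesis using e by simp
        next
          case e: False
          then have "t < n v - 2" using small[OF X] t(3) by simp
          then show ?thesis
            using e B False t(1) zero_C[OF vV] by (auto simp: typeB_def D_def)
        qed
      qed
    qed (use e l L_in in auto)
  qed
qed

text \<open>With one jump this is the merging argument. With more, \<open>2\<close> and
  \<open>n v - 2\<close> both lie in \<open>C v\<close>, so a loop would be admissible and have an
  admissible complement.\<close>

lemma loopless_typeB:
  assumes v: "v \<in> S" and B: "typeB (C v) (n v) (r v)"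
  shows "L v v = {}"
proof (cases "r v = 1")
  case True
  then show ?thesis using loopless_merge[OF v] B by simp
next
  case False
  then have r2: "r v \<ge> 2" using r_pos[OF v] by linarith
  show ?thesis
  proof (rule ccontr)
    assume "L v v \<noteq> {}"
    then obtain l where l: "l \<in> L v v" by blast
    have dl: "d {l} w = (if w = v then 2 else 0)" for w
      using d_L[of "{l}" v v w] l by simp
    have ne: "{l} \<noteq> I" using card_I_ge by auto
    have "2 \<in> C v" "n v - 2 \<in> C v" using B r2 by (auto simp: typeB_def)
    then show False
      using l L_in zero_C n_C by (intro valid_covalid[OF _ _ ne]) (auto simp: dl)
  qed
qed

section \<open>Admissible degrees by type, and the resulting bounds on weights\<close>

lemma val:
  assumes "v \<in> V" "k \<le> n v"
  shows "typeA (C v) (n v) (r v) \<Longrightarrow> odd k \<or> k = 0 \<or> n v < k + r v \<Longrightarrow> k \<in> C v"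
    and "typeB (C v) (n v) (r v) \<Longrightarrow> even k \<or> n v \<le> k + r v \<Longrightarrow> k \<in> C v"
  using assms zero_C by (auto simp: typeA_def typeB_def)

text \<open>\<open>n v\<close> and \<open>r v\<close> have the same parity, so
  \<open>n v - k\<close> is even iff \<open>r v + k\<close> is; the other alternatives place
  \<open>n v - k\<close> near the top or at 0.\<close>

lemma cov:
  assumes "v \<in> V" "k \<le> n v"
  shows "typeA (C v) (n v) (r v) \<Longrightarrow> odd (r v + k) \<or> k < r v \<or> k = n v \<Longrightarrow> n v - k \<in> C v"
    and "typeB (C v) (n v) (r v) \<Longrightarrow> even (r v + k) \<or> k \<le> r v \<Longrightarrow> n v - k \<in> C v"
proof -
  have par: "even (n v - k) \<longleftrightarrow> even (r v + k)"
    using parity_n[OF assms(1)] assms(2) by (simp add: even_diff_nat)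
  show "n v - k \<in> C v" if "typeA (C v) (n v) (r v)" "odd (r v + k) \<or> k < r v \<or> k = n v"
  proof (rule val(1)[OF assms(1) _ that(1)])
    show "odd (n v - k) \<or> n v - k = 0 \<or> n v < n v - k + r v"
      using that(2) par assms(2) by linarith
  qed simp
  show "n v - k \<in> C v" if "typeB (C v) (n v) (r v)" "even (r v + k) \<or> k \<le> r v"
  proof (rule val(2)[OF assms(1) _ that(1)])
    show "even (n v - k) \<or> n v \<le> n v - k + r v"
      using that(2) par assms(2) by linarith
  qed simp
qed

lemma not_all_nonpos: "\<exists>i\<in>I. \<Delta> i > 0"
  using pos sum_nonpos[of I \<Delta>] by (meson not_less)

text \<open>At least two items, each weighing at least the positive total, would exceed the total.
  With \<open>not_all_nonpos\<close> this settles every configuration in which all items obey the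
  same bound.\<close>

lemma not_all_ge: "\<exists>i\<in>I. \<Delta> i < sum \<Delta> I"
proof (rule ccontr)
  assume "\<not> ?thesis"
  then have "of_nat (card I) * sum \<Delta> I \<le> sum \<Delta> I"
    by (intro sum_bounded_below) (auto simp: not_less)
  moreover have "of_nat (card I) * sum \<Delta> I \<ge> 2 * sum \<Delta> I"
    using card_I_ge pos by (intro mult_right_mono) auto
  ultimately show False using pos by simp
qed

lemma single_nonpos:
  assumes "i \<in> L x y" "x \<noteq> y" "x \<in> S" "y \<in> S" "1 \<in> C x" "1 \<in> C y"
  shows "\<Delta> i \<le> 0"
proof -
  have "d {i} w = of_bool (w = x) + of_bool (w = y)" for w
    using d_L[of "{i}" x y w] assms by simp
  then have "sum \<Delta> {i} \<le> 0"
    using assms card_I_ge zero_C S_V L_in by (intro nonposI) auto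
  then show ?thesis by simp
qed

lemma single_ge:
  assumes "i \<in> L x y" "x \<noteq> y" "x \<in> S" "y \<in> S" "n x - 1 \<in> C x" "n y - 1 \<in> C y"
  shows "\<Delta> i \<ge> sum \<Delta> I"
proof -
  have "d {i} w = of_bool (w = x) + of_bool (w = y)" for w
    using d_L[of "{i}" x y w] assms by simp
  then have "sum \<Delta> {i} \<ge> sum \<Delta> I"
    using assms n_C S_V L_in by (intro geI) auto
  then show ?thesis by simp
qed

lemma pair_nonpos:
  assumes "i \<in> L x y" "j \<in> L x y" "i \<noteq> j" "x \<noteq> y" "x \<in> S" "y \<in> S" "2 \<in> C x" "2 \<in> C y" "n y \<noteq> 2"
  shows "\<Delta> i + \<Delta> j \<le> 0"
proof -
  have d: "d {i, j} w = (if w = x \<or> w = y then 2 else 0)" for w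
    using d_L[of "{i, j}" x y w] assms by auto
  have ne: "{i, j} \<noteq> I" using d[of y] assms by auto
  have "d {i, j} w \<in> C w" if "w \<in> S" for w
    using assms(7,8) zero_C[OF S_V[OF that]] by (auto simp: d)
  then have "sum \<Delta> {i, j} \<le> 0"
    using assms L_in by (intro nonposI[OF _ ne]) auto
  then show ?thesis using assms by simp
qed

lemma pair_ge:
  assumes "i \<in> L x y" "j \<in> L x y" "i \<noteq> j" "x \<noteq> y" "x \<in> S" "y \<in> S" "n x - 2 \<in> C x" "n y - 2 \<in> C y"
  shows "\<Delta> i + \<Delta> j \<ge> sum \<Delta> I"
proof -
  have d: "d {i, j} w = (if w = x \<or> w = y then 2 else 0)" for w
    using d_L[of "{i, j}" x y w] assms by auto
  have "n w - d {i, j} w \<in> C w" if "w \<in> S" for w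
    using assms(7,8) n_C[OF S_V[OF that]] by (auto simp: d)
  then have "sum \<Delta> {i, j} \<ge> sum \<Delta> I"
    using assms L_in by (intro geI) auto
  then show ?thesis using assms by simp
qed

lemma loop_ge:
  assumes "i \<in> L v v" "v \<in> S" "n v - 2 \<in> C v"
  shows "\<Delta> i \<ge> sum \<Delta> I"
proof -
  have "d {i} w = (if w = v then 2 else 0)" for w
    using d_L[of "{i}" v v w] assms by simp
  then have "sum \<Delta> {i} \<ge> sum \<Delta> I"
    using assms n_C S_V L_in by (intro geI) auto
  then show ?thesis by simp
qed

lemma two_in: "card F \<ge> 2 \<Longrightarrow> \<exists>i\<in>F. \<exists>j\<in>F. i \<noteq> j"
  using card_le_Suc0_iff_eq[of F] by (cases "finite F") auto

lemma L_le: "x \<noteq> y \<Longrightarrow> card (L x y) \<le> n x"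
  using d_le[OF L_sub, of x y x] d_L[of "L x y" x y x] by simp

subsection \<open>At most two vertices\<close>

text \<open>All items are loops, so the vertex has type A. Its top four numbers are admissible, so
  every loop has an admissible complement and weighs at least the total.\<close>

lemma not_single: "S \<noteq> {v}"
proof
  assume S: "S = {v}"
  have v: "v \<in> S" "v \<in> V" using S S_V by auto
  have r4: "r v = 4" using sum_r S by simp
  have I: "I = L v v" using I_two[of v v] S unfolding Un_absorb insert_absorb2 by blast
  have "card (L v v) \<ge> 2" using card_I_ge unfolding arg_cong[OF I, of card] .
  then have "L v v \<noteq> {}" by auto
  then have A: "typeA (C v) (n v) (r v)" using typeAB loopless_typeB v by blast
  then have "2 \<le> n v" using r4 by (simp add: typeA_def)
  then have "n v - 2 \<in> C v" using r4 cov(1)[OF v(2) _ A] by simp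
  then have "\<Delta> i \<ge> sum \<Delta> I" if "i \<in> I" for i
    using loop_ge[OF _ v(1)] that eqset_imp_iff[OF I, of i] by blast
  then show False using not_all_ge by (metis not_less)
qed

text \<open>Loops occur only at \<open>v\<close>. If \<open>w\<close> has type B, every item has an
  admissible complement. If \<open>w\<close> has type A, this holds for pairs of parallel items, and
  the type of \<open>v\<close> decides: for type A parallel items are nonpositive, so there is just
  one; for type B all items are parallel and there are at least four.\<close>

lemma not_3_1:
  assumes S: "S = {v, w}" and ne: "v \<noteq> w" and r: "r v = 3" "r w = 1"
  shows False
proof -
  have v: "v \<in> S" "v \<in> V" and w: "w \<in> S" "w \<in> V" using S S_V by auto
  have wl: "L w w = {}" using typeAB[OF w(1)] loopless_merge[OF w(1)] r by auto
  have I: "I = L v v \<union> L v w" using I_two[OF S] unfolding wl Un_empty_right .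
  have disj: "L v v \<inter> L v w = {}" by (rule L_disjoint) (use ne in auto)
  have n: "n u = d (L v v) u + d (L v w) u" for u
    by (rule trans[OF arg_cong[OF I, of "\<lambda>T. d T u"] ideg_Un[OF fin_L fin_L disj]])
  have nw: "n w = card (L v w)"
    unfolding n[of w] using d_L[of "L v v" v v w] d_L[of "L v w" v w w] ne by simp
  have nv: "n v = 2 * card (L v v) + card (L v w)"
    unfolding n[of v] using d_L[of "L v v" v v v] d_L[of "L v w" v w v] ne by simp
  have nw_pos: "n w > 0" "n v > 0" using S_pos v w by auto
  have vge: "n v \<ge> 3" using typeAB[OF v(1)] r by (auto simp: typeA_def typeB_def)
  have v1: "n v - 1 \<in> C v" "n v - 2 \<in> C v"
    using typeAB[OF v(1)] cov[OF v(2), of 1] cov[OF v(2), of 2] r vge by auto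
  show False
  proof (cases "typeA (C w) (n w) (r w)")
    case wA: True
    have w2: "n w - 2 \<in> C w" if "n w \<ge> 2" using cov(1)[OF w(2) that wA] r by simp
    have ge: "\<Delta> i + \<Delta> j \<ge> sum \<Delta> I" if "i \<in> L v w" "j \<in> L v w" "i \<noteq> j" for i j
    proof -
      have "card {i, j} \<le> card (L v w)" using that by (intro card_mono) auto
      then have "n w \<ge> 2" using nw that by simp
      then show ?thesis using pair_ge[OF that ne v(1) w(1) v1(2)] w2 by simp
    qed
    show False
    proof (cases "typeA (C v) (n v) (r v)")
      case vA: True
      have np: "\<Delta> i \<le> 0" if "i \<in> L v w" for i
        using single_nonpos[OF that ne v(1) w(1)] val(1)[OF v(2), of 1] val(1)[OF w(2), of 1] vA wA nw_pos by simp
      have "card (L v w) < 2"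
      proof (rule ccontr)
        assume "\<not> card (L v w) < 2"
        then obtain i j where "i \<in> L v w" "j \<in> L v w" "i \<noteq> j"
          using two_in[of "L v w"] by auto
        then show False using ge[of i j] np[of i] np[of j] pos by linarith
      qed
      then have n1: "n w = 1" using nw nw_pos by simp
      then obtain i where i: "i \<in> L v w" using nw by (metis card_1_singletonE insertI1)
      have "n w - 1 \<in> C w" using zero_C w n1 by simp
      then show False
        using single_ge[OF i ne v(1) w(1) v1(1)] np[OF i] pos by simp
    next
      case False
      then have vB: "typeB (C v) (n v) (r v)" using typeAB v by blast
      then have vl: "L v v = {}" using loopless_typeB v by blast
      have IL: "L v w = I" using I unfolding vl Un_empty_left by (rule sym)
      have c4: "card (L v w) \<ge> 4" using nv vl vB r by (simp add: typeB_def)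
      \<comment> \<open>Two disjoint pairs fit into the parallel items, and each weighs at least the
        total.\<close>
      have "real (card (L v w) div 2) * sum \<Delta> I \<le> sum \<Delta> (L v w)"
        using ge pos c4 by (intro sum_pairs_ge) auto
      moreover have "2 * sum \<Delta> I \<le> real (card (L v w) div 2) * sum \<Delta> I"
        using c4 pos by (intro mult_right_mono) auto
      ultimately show False using pos unfolding IL by simp
    qed
  next
    case False
    then have wB: "typeB (C w) (n w) (r w)" using typeAB w by blast
    have wge: "n w \<ge> 3" using wB r by (simp add: typeB_def)
    have w1: "n w - 1 \<in> C w" using cov(2)[OF w(2) _ wB, of 1] r wge by simp
    have ge: "\<Delta> i \<ge> sum \<Delta> I" if "i \<in> I" for i
      using eqset_imp_iff[OF I, of i] that single_ge[OF _ ne v(1) w(1) v1(1) w1] loop_ge[OF _ v(1) v1(2)] by blast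
    then show False using not_all_ge by (metis not_less)
  qed
qed

text \<open>There are no loops, and \<open>n u - 1\<close> is admissible at both vertices for either
  type, so every item has an admissible complement.\<close>

lemma not_2_2:
  assumes S: "S = {v, w}" and ne: "v \<noteq> w" and r: "r v = 2" "r w = 2"
  shows False
proof -
  have v: "v \<in> S" "v \<in> V" and w: "w \<in> S" "w \<in> V" using S S_V by auto
  have wl: "L w w = {}" "L v v = {}"
    using typeAB[OF w(1)] loopless_merge[OF w(1)] loopless_typeB[OF w(1)]
      typeAB[OF v(1)] loopless_merge[OF v(1)] loopless_typeB[OF v(1)] r by auto
  have I: "I = L v w" using I_two[OF S] unfolding wl Un_empty_left .
  have one: "n u - 1 \<in> C u" if "u \<in> S" for u
  proof -
    have "u \<in> V" "1 \<le> n u" "r u = 2" using that S r S_V S_pos[OF that] by auto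
    then show ?thesis using typeAB[OF that] cov[of u 1] by auto
  qed
  have ge: "\<Delta> i \<ge> sum \<Delta> I" if "i \<in> I" for i
    using single_ge[OF _ ne v(1) w(1) one one] v w that eqset_imp_iff[OF I, of i] by blast
  then show False using not_all_ge by (metis not_less)
qed

subsection \<open>Three vertices\<close>

abbreviation "tA v \<equiv> typeA (C v) (n v) (r v)"
abbreviation "tB v \<equiv> typeB (C v) (n v) (r v)"

lemma nonpos_types:
  assumes "T \<subseteq> I" "i \<in> I - T"
    "\<And>u. u \<in> S \<Longrightarrow> tA u \<and> (odd (d T u) \<or> d T u = 0 \<or> d T u = n u) \<or>
       tB u \<and> (even (d T u) \<or> n u \<le> d T u + r u)"
  shows "sum \<Delta> T \<le> 0"
proof (rule nonposI[OF assms(1)])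
  show "T \<noteq> I" using assms(2) by blast
  show "d T u \<in> C u" if u: "u \<in> S" for u
    using assms(3)[OF u] val[OF S_V[OF u] d_le[OF assms(1)]] n_C[OF S_V[OF u]] by auto
qed

lemma ge_types:
  assumes "T \<subseteq> I" "T \<noteq> {}"
    "\<And>u. u \<in> S \<Longrightarrow> tA u \<and> (odd (r u + d T u) \<or> d T u < r u \<or> d T u = n u) \<or>
       tB u \<and> (even (r u + d T u) \<or> d T u \<le> r u)"
  shows "sum \<Delta> T \<ge> sum \<Delta> I"
proof (rule geI[OF assms(1,2)])
  show "n u - d T u \<in> C u" if u: "u \<in> S" for u
    using assms(3)[OF u] cov[OF S_V[OF u] d_le[OF assms(1)]] by auto
qed

lemma L_neq: "i \<in> L a b \<Longrightarrow> j \<in> L x y \<Longrightarrow> {a, b} \<noteq> {x, y} \<Longrightarrow> i \<noteq> j"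
  and L_notin: "i \<in> L a b \<Longrightarrow> {a, b} \<noteq> {x, y} \<Longrightarrow> i \<notin> L x y"
  using L_disjoint[of a b x y] by blast+

lemma d_insert:
  "i \<in> L x y \<Longrightarrow> finite T \<Longrightarrow> i \<notin> T \<Longrightarrow> d (insert i T) u = of_bool (u = x) + of_bool (u = y) + d T u"
  by (simp add: ideg_insert inc_L)

lemma n_sum:
  assumes v: "v \<in> S" and ll: "L v v = {}"
  shows "n v = (\<Sum>w\<in>S - {v}. card (L v w))"
proof -
  let ?U = "\<Union>w\<in>S - {v}. L v w"
  have one: "inc i v = 1" if "i \<in> ?U" for i
    using that inc_L by fastforce
  have zero: "inc i v = 0" if i: "i \<in> I - ?U" for i
  proof -
    obtain x y where xy: "x \<in> S" "y \<in> S" "i \<in> L x y"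
      using L_ends i by blast
    then have "x \<noteq> v" "y \<noteq> v"
      using i ll L_sym[of x v] by auto
    then show ?thesis using inc_L[OF xy(3), of v] by simp
  qed
  have "n v = (\<Sum>i\<in>?U. inc i v)"
    unfolding ideg_def
  proof (rule sum.mono_neutral_right)
    show "?U \<subseteq> I" using L_sub by blast
  qed (use zero in auto)
  also have "\<dots> = (\<Sum>i\<in>?U. 1)"
    by (rule sum.cong[OF refl one])
  also have "\<dots> = card ?U" by simp
  also have "\<dots> = (\<Sum>w\<in>S - {v}. card (L v w))"
  proof (rule card_UN_disjoint)
    show "\<forall>w\<in>S - {v}. \<forall>w'\<in>S - {v}. w \<noteq> w' \<longrightarrow> L v w \<inter> L v w' = {}"
    proof (intro ballI impI)
      fix w w' :: 'v assume "w \<noteq> w'"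
      then show "L v w \<inter> L v w' = {}"
        by (intro L_disjoint) (auto simp: doubleton_eq_iff)
    qed
  qed auto
  finally show ?thesis .
qed

lemma item_cases:
  assumes "i \<in> I" "\<And>v. v \<in> S \<Longrightarrow> L v v = {}"
  obtains x y where "x \<in> S" "y \<in> S" "x \<noteq> y" "i \<in> L x y"
  using L_ends[OF assms(1)] assms(2) by (metis empty_iff)

lemma one_C: "v \<in> S \<Longrightarrow> tA v \<Longrightarrow> 1 \<in> C v"
  and pred_C: "v \<in> S \<Longrightarrow> tB v \<or> r v \<ge> 2 \<Longrightarrow> n v - 1 \<in> C v"
proof -
  assume v: "v \<in> S"
  then have 1: "1 \<le> n v" using S_pos[of v] by simp
  show "1 \<in> C v" if "tA v" using val(1)[OF S_V[OF v] 1 that] by simp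
  show "n v - 1 \<in> C v" if "tB v \<or> r v \<ge> 2"
    using cov[OF S_V[OF v] 1] typeAB[OF v] that r_pos[OF v] by auto
qed

lemma loopless_small:
  assumes "v \<in> S" "r v \<le> 2"
  shows "L v v = {}"
  using assms typeAB loopless_merge loopless_typeB by blast

text \<open>In a triangle with \<open>a\<close> between \<open>v\<close> and \<open>x\<close>,
  \<open>b\<close> between \<open>v\<close> and \<open>y\<close>, and \<open>c\<close> between
  \<open>x\<close> and \<open>y\<close>, the set \<open>{b, c}\<close> is admissible and
  \<open>{a, c}\<close> has an admissible complement, while \<open>a\<close> weighs at most 0 and
  \<open>b\<close> at least the total; no weight of \<open>c\<close> fits. If a side is missing,
  parity makes all parallel items of another side admissible together.\<close>

lemma not_2_1_1_mixed:
  assumes S: "S = {v, x, y}" and ne: "v \<noteq> x" "v \<noteq> y" "x \<noteq> y" and r: "r v = 2" "r x = 1" "r y = 1"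
    and t: "tA v" "tA x" "tB y"
  shows False
proof -
  have in_S: "v \<in> S" "x \<in> S" "y \<in> S" using S by auto
  have ll: "L u u = {}" if "u \<in> S" for u using loopless_small[OF that] that S r by auto
  have SD: "S - {v} = {x, y}" "S - {x} = {v, y}" "S - {y} = {v, x}" using S ne by auto
  have nv: "n v = card (L v x) + card (L v y)"
    using n_sum[OF in_S(1) ll[OF in_S(1)]] ne unfolding SD by simp
  have nx: "n x = card (L v x) + card (L x y)"
    using n_sum[OF in_S(2) ll[OF in_S(2)]] ne L_sym[of x v] unfolding SD by simp
  have ny: "n y = card (L v y) + card (L x y)"
    using n_sum[OF in_S(3) ll[OF in_S(3)]] ne L_sym[of y v] L_sym[of y x] unfolding SD by simp
  have par: "even (n v)" "odd (n x)" "odd (n y)"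
    using parity_n[OF S_V] in_S r by (metis odd_one even_add even_numeral)+
  have vx: "\<Delta> i \<le> 0" if "i \<in> L v x" for i
    using single_nonpos[OF that ne(1)] in_S one_C t by blast
  have vy: "\<Delta> i \<ge> sum \<Delta> I" if "i \<in> L v y" for i
    using single_ge[OF that ne(2)] in_S pred_C t r by simp
  have pos': "n v > 0" "n x > 0" "n y > 0" using S_pos in_S by auto
  show False
  proof (cases "L v x = {} \<or> L x y = {}")
    case True
    let ?T = "L v y"
    have dT: "d ?T u = card ?T * (of_bool (u = v) + of_bool (u = y))" for u
      by (rule d_L) simp
    have "L v x \<union> L x y \<noteq> {}" using nx pos' by auto
    then obtain i where i': "i \<in> L v x \<or> i \<in> L x y" by blast
    have "i \<notin> ?T"
      using i' L_notin[of i v x v y] L_notin[of i x y v y] ne by (auto simp: doubleton_eq_iff)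
    then have i: "i \<in> I - ?T" using i' L_in by blast
    have "sum \<Delta> ?T \<le> 0"
    proof (rule nonpos_types[OF L_sub i])
      fix u assume "u \<in> S"
      then show "tA u \<and> (odd (d ?T u) \<or> d ?T u = 0 \<or> d ?T u = n u) \<or>
         tB u \<and> (even (d ?T u) \<or> n u \<le> d ?T u + r u)"
        using S dT[of u] True t ne nv nx ny par by auto
    qed
    moreover have "?T \<noteq> {}" using True pos' nv ny by auto
    then obtain j where "j \<in> ?T" by blast
    then have "sum \<Delta> ?T > 0" using vy pos by (intro sum_pos2[of _ j]) (auto intro: less_le_trans order.trans[OF less_imp_le[OF pos]])
    ultimately show False by simp
  next
    case False
    then obtain a c where a: "a \<in> L v x" and c: "c \<in> L x y" by blast
    show False
    proof (cases "L v y = {}")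
      case True
      let ?T = "L x y"
      have dT: "d ?T u = card ?T * (of_bool (u = x) + of_bool (u = y))" for u
        by (rule d_L) simp
      have "a \<notin> ?T" using L_notin[OF a, of x y] ne by (auto simp: doubleton_eq_iff)
      then have i: "a \<in> I - ?T" using L_in[OF a] by simp
      have "sum \<Delta> ?T \<le> 0"
      proof (rule nonpos_types[OF L_sub i])
        fix u assume "u \<in> S"
        then show "tA u \<and> (odd (d ?T u) \<or> d ?T u = 0 \<or> d ?T u = n u) \<or>
           tB u \<and> (even (d ?T u) \<or> n u \<le> d ?T u + r u)"
          using S dT[of u] True t ne nv nx ny par by auto
      qed
      moreover have "sum \<Delta> (I - ?T) \<le> 0"
      proof (rule sum_nonpos)
        fix i assume i: "i \<in> I - ?T"
        then obtain p q where "p \<in> S" "q \<in> S" "p \<noteq> q" "i \<in> L p q"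
          using item_cases[of i] ll by auto
        then have "i \<in> L v x"
          using S i True L_sym[of x v] L_sym[of y v] L_sym[of y x] by auto
        then show "\<Delta> i \<le> 0" by (rule vx)
      qed
      ultimately show False
        using pos sum.subset_diff[OF L_sub finI, of \<Delta> x y] by simp
    next
      case False
      then obtain b where b: "b \<in> L v y" by blast
      have neq: "a \<noteq> b" "b \<noteq> c" "a \<noteq> c"
        using L_neq[OF a b] L_neq[OF b c] L_neq[OF a c] ne by (auto simp: doubleton_eq_iff)
      have "sum \<Delta> {b, c} \<le> 0"
      proof (rule nonpos_types)
        show "a \<in> I - {b, c}" using neq L_in[OF a] by auto
        fix u assume "u \<in> S"
        then show "tA u \<and> (odd (d {b, c} u) \<or> d {b, c} u = 0 \<or> d {b, c} u = n u) \<or>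
           tB u \<and> (even (d {b, c} u) \<or> n u \<le> d {b, c} u + r u)"
          using S t ne neq by (auto simp: d_insert[OF b] d_insert[OF c])
      qed (use L_in b c in auto)
      moreover have "sum \<Delta> {a, c} \<ge> sum \<Delta> I"
      proof (rule ge_types)
        fix u assume "u \<in> S"
        then show "tA u \<and> (odd (r u + d {a, c} u) \<or> d {a, c} u < r u \<or> d {a, c} u = n u) \<or>
           tB u \<and> (even (r u + d {a, c} u) \<or> d {a, c} u \<le> r u)"
          using S t ne neq r by (auto simp: d_insert[OF a] d_insert[OF c])
      qed (use L_in a c in auto)
      ultimately show False
        using vx[OF a] vy[OF b] pos neq by simp
    qed
  qed
qed

text \<open>A set of \<open>n v - 1\<close> items between \<open>v\<close> and \<open>x\<close> is
  admissible: the number is odd, as type A at \<open>x\<close> wants, and close enough to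
  \<open>n v\<close> for \<open>v\<close>. But pairs of such items have admissible complements,
  which makes the weight of the set positive.\<close>

lemma not_2_1_1_B:
  assumes S: "S = {v, x, y}" and ne: "v \<noteq> x" "v \<noteq> y" "x \<noteq> y" and r: "r v = 2" "r x = 1" "r y = 1"
    and t: "tB v" "tA x" and few: "card (L v y) \<le> 1"
  shows False
proof -
  have in_S: "v \<in> S" "x \<in> S" "y \<in> S" using S by auto
  have ll: "L u u = {}" if "u \<in> S" for u using loopless_small[OF that] that S r by auto
  have SD: "S - {v} = {x, y}" using S ne by auto
  have nv: "n v = card (L v x) + card (L v y)"
    using n_sum[OF in_S(1) ll[OF in_S(1)]] ne unfolding SD by simp
  have n4: "n v \<ge> 4" using t(1) r by (simp add: typeB_def)
  have ev: "even (n v)" using parity_n[OF S_V[OF in_S(1)]] r by simp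
  have tyy: "tA y \<or> tB y" using typeAB in_S by blast
  have nx: "n x \<ge> 3" using L_le[of x v] ne L_sym[of x v] few nv n4 by simp
  have ge: "\<Delta> i + \<Delta> j \<ge> sum \<Delta> I" if "i \<in> L v x" "j \<in> L v x" "i \<noteq> j" for i j
  proof (rule pair_ge[OF that ne(1) in_S(1,2)])
    show "n v - 2 \<in> C v" using cov(2)[OF S_V[OF in_S(1)] _ t(1), of 2] n4 r by simp
    show "n x - 2 \<in> C x" using cov(1)[OF S_V[OF in_S(2)] _ t(2), of 2] nx r by simp
  qed
  have key: False if T: "T \<subseteq> L v x" "card T = n v - 1" and i: "i \<in> I - T" for T i
  proof -
    have dT: "d T u = (n v - 1) * (of_bool (u = v) + of_bool (u = x))" for u
      using d_L[OF T(1)] T(2) by simp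
    have "sum \<Delta> T \<le> 0"
    proof (rule nonpos_types[OF _ i])
      fix u assume "u \<in> S"
      then show "tA u \<and> (odd (d T u) \<or> d T u = 0 \<or> d T u = n u) \<or>
         tB u \<and> (even (d T u) \<or> n u \<le> d T u + r u)"
        using S dT[of u] t ne r tyy ev n4 by auto
    qed (use T L_sub in blast)
    moreover have "sum \<Delta> T \<ge> real (card T div 2) * sum \<Delta> I"
      using T n4 ge pos finite_subset[OF T(1)] by (intro sum_pairs_ge) auto
    moreover have "real (card T div 2) > 0" using T n4 by simp
    then have "real (card T div 2) * sum \<Delta> I > 0" using pos by (rule mult_pos_pos)
    ultimately show False by linarith
  qed
  show False
  proof (cases "L v y = {}")
    case True
    then have c: "card (L v x) = n v" using nv by simp
    then obtain e where e: "e \<in> L v x" using n4 by (metis card.empty equals0I not_numeral_le_zero)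
    show False
      using key[of "L v x - {e}" e] e c L_in[OF e] by simp
  next
    case False
    then obtain f where f: "f \<in> L v y" by blast
    have "card (L v y) > 0" using f by (auto simp: card_gt_0_iff)
    then have "card (L v x) = n v - 1" using few nv by simp
    moreover have "f \<notin> L v x" using L_notin[OF f, of v x] ne by (auto simp: doubleton_eq_iff)
    ultimately show False using key[of "L v x" f] L_in[OF f] by simp
  qed
qed

lemma not_2_1_1:
  assumes S: "S = {v, x, y}" and ne: "v \<noteq> x" "v \<noteq> y" "x \<noteq> y" and r: "r v = 2" "r x = 1" "r y = 1"
  shows False
proof -
  have in_S: "v \<in> S" "x \<in> S" "y \<in> S" using S by auto
  have S': "S = {v, y, x}" using S by auto
  have ll: "L u u = {}" if "u \<in> S" for u using loopless_small[OF that] that S r by auto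
  have SD: "S - {v} = {x, y}" using S ne by auto
  have nv: "n v = card (L v x) + card (L v y)"
    using n_sum[OF in_S(1) ll[OF in_S(1)]] ne unfolding SD by simp
  have ty: "tA v \<or> tB v" "tA x \<or> tB x" "tA y \<or> tB y" using typeAB in_S by blast+
  show False
  proof (cases "tA v")
    case vA: True
    consider "tA x" "tA y" | "tB x" "tB y" | "tA x" "tB y" | "tB x" "tA y" using ty by blast
    then show False
    proof cases
      case 1
      have "\<Delta> i \<le> 0" if i: "i \<in> I" for i
      proof -
        obtain p q where pq: "p \<in> S" "q \<in> S" "p \<noteq> q" "i \<in> L p q"
          using item_cases[OF i] ll by blast
        then have "tA p" "tA q" using S 1 vA by auto
        then show ?thesis using single_nonpos[OF pq(4,3,1,2)] one_C pq by blast
      qed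
      then show False using not_all_nonpos by (metis not_less)
    next
      case 2
      have "\<Delta> i \<ge> sum \<Delta> I" if i: "i \<in> I" for i
      proof -
        obtain p q where pq: "p \<in> S" "q \<in> S" "p \<noteq> q" "i \<in> L p q"
          using item_cases[OF i] ll by blast
        then have "tB p \<or> r p \<ge> 2" "tB q \<or> r q \<ge> 2" using S 2 r by auto
        then show ?thesis using single_ge[OF pq(4,3,1,2)] pred_C pq by blast
      qed
      then show False using not_all_ge by (metis not_less)
    next
      case 3
      then show False using not_2_1_1_mixed[OF S ne r vA] by blast
    next
      case 4
      then show False using not_2_1_1_mixed[OF S' ne(2,1) not_sym[OF ne(3)] r(1,3,2) vA] by blast
    qed
  next
    case False
    then have vB: "tB v" using ty by blast
    have n4: "n v \<ge> 4" using vB r by (simp add: typeB_def)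
    \<comment> \<open>Two such items form an admissible pair, although the complement of each single
      one is admissible too.\<close>
    have one: "card (L v w) \<le> 1" if w: "w \<in> S" "w \<noteq> v" "tB w" for w
    proof (rule ccontr)
      assume "\<not> card (L v w) \<le> 1"
      then obtain i j where ij: "i \<in> L v w" "j \<in> L v w" "i \<noteq> j"
        using two_in[of "L v w"] by auto
      have "n w \<ge> 3" using w S r by (auto simp: typeB_def)
      then have "\<Delta> i + \<Delta> j \<le> 0"
        using pair_nonpos[OF ij not_sym[OF w(2)] in_S(1) w(1)] n4
          val(2)[OF S_V[OF in_S(1)] _ vB, of 2] val(2)[OF S_V[OF w(1)] _ w(3), of 2] by simp
      moreover have "\<Delta> i \<ge> sum \<Delta> I" "\<Delta> j \<ge> sum \<Delta> I"
        using single_ge[OF _ not_sym[OF w(2)] in_S(1) w(1)] pred_C vB w in_S ij by blast+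
      ultimately show False using pos by simp
    qed
    consider "tA x" "tA y" | "tB x" "tB y" | "tA x" "tB y" | "tB x" "tA y" using ty by blast
    then show False
    proof cases
      case 1
      \<comment> \<open>Four items are paired in two ways: pairs with one item on each side are
        admissible, while parallel pairs have admissible complements.\<close>
      have "\<not> (card (L v x) \<ge> 2 \<and> card (L v y) \<ge> 2)"
      proof
        assume "card (L v x) \<ge> 2 \<and> card (L v y) \<ge> 2"
        then obtain a a' b b' where a: "a \<in> L v x" "a' \<in> L v x" "a \<noteq> a'"
          and b: "b \<in> L v y" "b' \<in> L v y" "b \<noteq> b'"
          and c: "n x \<ge> 2" "n y \<ge> 2"
          using two_in[of "L v x"] two_in[of "L v y"] L_le[of x v] L_le[of y v] ne
            L_sym[of x v] L_sym[of y v] by auto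
        have le: "\<Delta> i + \<Delta> j \<le> 0" if ij: "i \<in> L v x" "j \<in> L v y" for i j
        proof -
          have "i \<noteq> j" using L_neq[OF ij] ne by (auto simp: doubleton_eq_iff)
          obtain k where k': "k \<in> L v x" "k \<noteq> i" using a by metis
          moreover have "k \<noteq> j" using L_neq[OF k'(1) ij(2)] ne by (auto simp: doubleton_eq_iff)
          ultimately have k: "k \<in> I - {i, j}" using L_in[OF k'(1)] by blast
          have "sum \<Delta> {i, j} \<le> 0"
          proof (rule nonpos_types[OF _ k])
            fix u assume "u \<in> S"
            then show "tA u \<and> (odd (d {i, j} u) \<or> d {i, j} u = 0 \<or> d {i, j} u = n u) \<or>
               tB u \<and> (even (d {i, j} u) \<or> n u \<le> d {i, j} u + r u)"
              using S 1 vB ne \<open>i \<noteq> j\<close> by (auto simp: d_insert[OF ij(1)] d_insert[OF ij(2)])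
          qed (use L_in ij in auto)
          then show ?thesis using \<open>i \<noteq> j\<close> by simp
        qed
        have v2: "n v - 2 \<in> C v" using cov(2)[OF S_V[OF in_S(1)] _ vB, of 2] n4 r by simp
        have "n x - 2 \<in> C x" "n y - 2 \<in> C y"
          using cov(1)[OF S_V[OF in_S(2)] c(1)] cov(1)[OF S_V[OF in_S(3)] c(2)] 1 r by simp_all
        then have "\<Delta> a + \<Delta> a' \<ge> sum \<Delta> I" "\<Delta> b + \<Delta> b' \<ge> sum \<Delta> I"
          using pair_ge[OF a ne(1) in_S(1,2) v2] pair_ge[OF b ne(2) in_S(1,3) v2] by auto
        then show False
          using le[OF a(1) b(1)] le[OF a(2) b(2)] pos by simp
      qed
      then have "card (L v x) \<le> 1 \<or> card (L v y) \<le> 1" by linarith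
      then show False
        using not_2_1_1_B[OF S ne r vB 1(1)]
          not_2_1_1_B[OF S' ne(2,1) not_sym[OF ne(3)] r(1,3,2) vB 1(2)] by blast
    next
      case 2
      then show False using one[of x] one[of y] in_S ne nv n4 by simp
    next
      case 3
      then show False using not_2_1_1_B[OF S ne r vB] one[of y] in_S ne by simp
    next
      case 4
      then show False
        using not_2_1_1_B[OF S' ne(2,1) not_sym[OF ne(3)] r(1,3,2) vB] one[of x] in_S ne by simp
    qed
  qed
qed

end

lemma finite_arg_max_real:
  fixes f :: "'a \<Rightarrow> real"
  assumes "finite Y" "Y \<noteq> {}"
  obtains e where "e \<in> Y" "\<And>i. i \<in> Y \<Longrightarrow> f i \<le> f e"
proof -
  have "Max (f ` Y) \<in> f ` Y" using assms by (intro Max_in) auto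
  then obtain e where e: "e \<in> Y" "Max (f ` Y) = f e" by auto
  have "f i \<le> f e" if "i \<in> Y" for i
    using Max_ge[of "f ` Y" "f i"] assms that unfolding e(2) by auto
  then show ?thesis using that e by blast
qed

lemma sum_eq_4_cases:
  fixes f :: "'a \<Rightarrow> nat"
  assumes "finite S" "\<And>v. v \<in> S \<Longrightarrow> f v \<ge> 1" "sum f S = 4"
  obtains v where "S = {v}"
  | v w where "S = {v, w}" "v \<noteq> w" "f v = 3" "f w = 1"
  | v w where "S = {v, w}" "v \<noteq> w" "f v = 2" "f w = 2"
  | v x y where "S = {v, x, y}" "v \<noteq> x" "v \<noteq> y" "x \<noteq> y" "f v = 2" "f x = 1" "f y = 1"
  | "card S = 4" "\<And>v. v \<in> S \<Longrightarrow> f v = 1"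
proof -
  have "card S \<le> sum f S"
    using sum_mono[of S "\<lambda>_. 1" f] assms(2) by simp
  moreover have "card S \<noteq> 0" using assms(1,3) by auto
  ultimately consider "card S = 1" | "card S = 2" | "card S = 3" | "card S = 4"
    using assms(3) by linarith
  then show ?thesis
  proof cases
    case 1
    then show ?thesis using that(1) by (metis card_1_singletonE)
  next
    case 2
    then obtain v w where vw: "S = {v, w}" "v \<noteq> w" by (auto simp: card_2_iff)
    then have "f v + f w = 4" "f v \<ge> 1" "f w \<ge> 1" using assms by auto
    then consider "f v = 3" "f w = 1" | "f v = 2" "f w = 2" | "f w = 3" "f v = 1" by linarith
    then show ?thesis
      using that(2)[OF vw] that(3)[OF vw] that(2)[of w v] vw by (metis insert_commute)
  next
    case 3
    then obtain v w u where vw: "S = {v, w, u}" "v \<noteq> w" "v \<noteq> u" "w \<noteq> u" by (auto simp: card_3_iff)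
    then have "f v + f w + f u = 4" "f v \<ge> 1" "f w \<ge> 1" "f u \<ge> 1" using assms by auto
    then consider "f v = 2" "f w = 1" "f u = 1" | "f v = 1" "f w = 2" "f u = 1"
      | "f v = 1" "f w = 1" "f u = 2" by linarith
    then show ?thesis
    proof cases
      case 1
      then show ?thesis using that(4) vw by blast
    next
      case 2
      have "S = {w, v, u}" using vw by auto
      then show ?thesis using that(4)[of w v u] vw 2 by blast
    next
      case 3
      have "S = {u, v, w}" using vw by auto
      then show ?thesis using that(4)[of u v w] vw 3 by blast
    qed
  next
    case 4
    have "f v = 1" if v: "v \<in> S" for v
    proof -
      have "card (S - {v}) \<le> sum f (S - {v})"
        using sum_mono[of "S - {v}" "\<lambda>_. 1" f] assms(2) by simp
      then have "3 + f v \<le> 4"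
        using assms(1,3) v 4 by (simp add: sum.remove[of S v])
      then show ?thesis using assms(2)[OF v] by linarith
    qed
    then show ?thesis using that(5) 4 by blast
  qed
qed

subsection \<open>Four vertices\<close>

text \<open>All full degrees are odd here. Type A therefore admits odd degrees and 0, and type B
  even degrees and the full one. For an admissible complement it is the other way round: even or
  full for type A, odd or 0 for type B.\<close>

locale critical_four = critical V N inc C I \<Delta>
  for V :: "'v set" and N and inc :: "'i \<Rightarrow> 'v \<Rightarrow> nat" and C I \<Delta> +
  assumes four: "card S = 4" and r1: "\<And>v. v \<in> S \<Longrightarrow> r v = 1"
begin

lemma loopless: "v \<in> S \<Longrightarrow> L v v = {}"
  using loopless_small r1 by simp

lemma odd_n: "v \<in> S \<Longrightarrow> odd (n v)"
  using parity_n[OF S_V] r1 by (metis odd_one even_add)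

lemma nonposI1:
  assumes "T \<subseteq> I" "i \<in> I - T"
    "\<And>u. u \<in> S \<Longrightarrow> tA u \<and> (odd (d T u) \<or> d T u = 0) \<or> tB u \<and> (even (d T u) \<or> d T u = n u)"
  shows "sum \<Delta> T \<le> 0"
  by (rule nonpos_types[OF assms(1,2)]) (use assms(3) in fastforce)

lemma geI1:
  assumes "T \<subseteq> I" "T \<noteq> {}"
    "\<And>u. u \<in> S \<Longrightarrow> tA u \<and> (even (d T u) \<or> d T u = n u) \<or> tB u \<and> (odd (d T u) \<or> d T u = 0)"
  shows "sum \<Delta> T \<ge> sum \<Delta> I"
  by (rule ge_types[OF assms(1,2)]) (use assms(3) r1 in fastforce)

lemma items:
  assumes "i \<in> I"
  obtains x y where "x \<in> S" "y \<in> S" "x \<noteq> y" "i \<in> L x y"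
  using item_cases[OF assms loopless] by blast

lemma AA: "i \<in> L x y \<Longrightarrow> x \<noteq> y \<Longrightarrow> x \<in> S \<Longrightarrow> y \<in> S \<Longrightarrow> tA x \<Longrightarrow> tA y \<Longrightarrow> \<Delta> i \<le> 0"
  using single_nonpos one_C by blast

lemma BB: "i \<in> L x y \<Longrightarrow> x \<noteq> y \<Longrightarrow> x \<in> S \<Longrightarrow> y \<in> S \<Longrightarrow> tB x \<Longrightarrow> tB y \<Longrightarrow> \<Delta> i \<ge> sum \<Delta> I"
  using single_ge pred_C by blast

lemma tAB: "u \<in> S \<Longrightarrow> tA u \<or> tB u"
  using typeAB by blast

lemma other_item:
  assumes "v \<in> S" "w \<in> S" "v \<noteq> w" "card (L v w) \<noteq> n v"
  obtains u g where "u \<in> S" "u \<noteq> v" "u \<noteq> w" "g \<in> L v u"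
proof -
  have "n v = card (L v w) + (\<Sum>u\<in>S - {v} - {w}. card (L v u))"
    unfolding n_sum[OF assms(1) loopless[OF assms(1)]] using assms by (intro sum.remove) auto
  then have "(\<Sum>u\<in>S - {v} - {w}. card (L v u)) \<noteq> 0" using assms(4) by linarith
  then obtain u where u: "u \<in> S - {v} - {w}" "card (L v u) \<noteq> 0"
    by (meson sum.neutral)
  then obtain g where "g \<in> L v u" by fastforce
  then show ?thesis using that[of u g] u by blast
qed

lemma item_outside:
  assumes "U \<subseteq> S" "card U \<le> 3" "\<And>u. u \<in> S - U \<Longrightarrow> d T u = 0" "T \<subseteq> I"
  obtains i where "i \<in> I - T"
proof -
  have "\<not> S \<subseteq> U"
  proof
    assume "S \<subseteq> U"
    then have "card S \<le> card U" using card_mono[OF finite_subset[OF assms(1) finS]] by blast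
    then show False using assms(2) four by linarith
  qed
  then obtain u where u: "u \<in> S" "u \<notin> U" by blast
  then have "d T u = 0" "n u > 0" using assms(3) S_pos by blast+
  then have "\<not> I \<subseteq> T" using ideg_mono[OF fin_sub[OF assms(4)], of I inc u] by fastforce
  then show ?thesis using that by blast
qed

lemma card3: "card {x, y, z :: 'v} \<le> 3"
  by (simp add: card_insert_if)

lemma sum_split: "T \<subseteq> I \<Longrightarrow> sum \<Delta> I = sum \<Delta> T + sum \<Delta> (I - T)"
  using sum.subset_diff[OF _ finI, of T \<Delta>] by simp

text \<open>A heaviest item \<open>e\<close> at \<open>y\<close> is positive and ends at some
  \<open>x\<close>. Any item from \<open>y\<close> to a third vertex forms an admissible pair with
  \<open>e\<close>, so all positive weight sits between \<open>x\<close> and \<open>y\<close>. An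
  admissible proper set containing all these items is then contradictory.\<close>

lemma not_one_B:
  assumes y: "y \<in> S" "tB y" and A: "\<And>x. x \<in> S \<Longrightarrow> x \<noteq> y \<Longrightarrow> tA x"
  shows False
proof -
  define Y where "Y = {i \<in> I. inc i y > 0}"
  have Y_L: "\<exists>x\<in>S. x \<noteq> y \<and> i \<in> L x y" if "i \<in> Y" for i
  proof -
    have i: "i \<in> I" "inc i y > 0" using that by (auto simp: Y_def)
    then obtain p q where pq: "p \<in> S" "q \<in> S" "p \<noteq> q" "i \<in> L p q" using items by blast
    then have "p = y \<or> q = y" using i inc_L[OF pq(4), of y] by auto
    then show ?thesis using pq L_sym[of p q] by auto
  qed
  have notY: "\<Delta> i \<le> 0" if i: "i \<in> I" "i \<notin> Y" for i
  proof -
    obtain p q where pq: "p \<in> S" "q \<in> S" "p \<noteq> q" "i \<in> L p q" using items i by blast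
    then have "p \<noteq> y" "q \<noteq> y" using i inc_L[OF pq(4), of y] by (auto simp: Y_def)
    then show ?thesis using AA[OF pq(4,3,1,2)] A pq by blast
  qed
  obtain i0 where i0: "i0 \<in> I" "\<Delta> i0 > 0" using not_all_nonpos by blast
  then have i0Y: "i0 \<in> Y" using notY by force
  have "finite Y" by (simp add: Y_def)
  then obtain e where e: "e \<in> Y" "\<And>i. i \<in> Y \<Longrightarrow> \<Delta> i \<le> \<Delta> e"
    using finite_arg_max_real[of Y \<Delta>] i0Y by blast
  have e_pos: "\<Delta> e > 0" using e(2)[OF i0Y] i0 by simp
  obtain x where x: "x \<in> S" "x \<noteq> y" "e \<in> L x y" using Y_L[OF e(1)] by blast
  let ?F = "L x y"
  have dF: "d ?F u = card ?F * (of_bool (u = x) + of_bool (u = y))" for u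
    by (rule d_L) simp
  have outside: "\<Delta> i \<le> 0" if i: "i \<in> I" "i \<notin> ?F" for i
  proof (cases "i \<in> Y")
    case True
    then obtain z where z: "z \<in> S" "z \<noteq> y" "i \<in> L z y" using Y_L by blast
    then have zx: "z \<noteq> x" using i by auto
    have ne: "e \<noteq> i" using x(3) i by auto
    have dT: "d {e, i} u = of_bool (u = x) + of_bool (u = z) + 2 * of_bool (u = y)" for u
      using ne by (simp add: d_insert[OF x(3)] d_insert[OF z(3)])
    obtain k where k: "k \<in> I - {e, i}"
    proof (rule item_outside[OF _ card3[of x y z], of "{e, i}"])
      show "d {e, i} u = 0" if "u \<in> S - {x, y, z}" for u using that by (auto simp: dT)
    qed (use x z y L_in i in auto)
    have "sum \<Delta> {e, i} \<le> 0"
    proof (rule nonposI1[OF _ k])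
      fix u assume "u \<in> S"
      then show "tA u \<and> (odd (d {e, i} u) \<or> d {e, i} u = 0) \<or> tB u \<and> (even (d {e, i} u) \<or> d {e, i} u = n u)"
        using y A x z zx by (cases "u = y") (auto simp: dT)
    qed (use L_in x i in auto)
    then show ?thesis using ne e_pos by simp
  next
    case False
    then show ?thesis using notY i by blast
  qed
  have key: False
    if T: "?F \<subseteq> T" "T \<subseteq> I" "k \<in> I - T" and
      ok: "\<And>u. u \<in> S \<Longrightarrow> tA u \<and> (odd (d T u) \<or> d T u = 0) \<or> tB u \<and> (even (d T u) \<or> d T u = n u)" for T k
  proof -
    have "sum \<Delta> T \<le> 0" by (rule nonposI1[OF T(2,3) ok])
    moreover have "sum \<Delta> (I - T) \<le> 0" using outside T(1) by (intro sum_nonpos) auto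
    ultimately show False using sum_split[OF T(2)] pos by simp
  qed
  have oddn: "odd (n x)" "odd (n y)" using odd_n x y by auto
  \<comment> \<open>An odd degree is needed at \<open>x\<close>, and an even or full one at
    \<open>y\<close>. If \<open>?F\<close> has the wrong parity for one of them, a single item from
    there to a third vertex corrects it and adds only degree 1 at that vertex.\<close>
  show False
  proof (cases "even (card ?F)")
    case True
    then have "card ?F \<noteq> n x" using oddn by auto
    then obtain u g where u: "u \<in> S" "u \<noteq> x" "u \<noteq> y" and g: "g \<in> L x u"
      using other_item[OF x(1) y(1) x(2)] by blast
    have gF: "g \<notin> ?F" using L_notin[OF g] u x by (auto simp: doubleton_eq_iff)
    have dT: "d (insert g ?F) w = of_bool (w = x) + of_bool (w = u) + card ?F * (of_bool (w = x) + of_bool (w = y))" for w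
      using d_insert[OF g fin_L gF] dF by simp
    obtain k where k: "k \<in> I - insert g ?F"
    proof (rule item_outside[OF _ card3[of x y u], of "insert g ?F"])
      show "d (insert g ?F) w = 0" if "w \<in> S - {x, y, u}" for w using that by (auto simp: dT)
    qed (use x y u L_in[OF g] L_sub in auto)
    show False
    proof (rule key[OF _ _ k])
      fix w assume "w \<in> S"
      then show "tA w \<and> (odd (d (insert g ?F) w) \<or> d (insert g ?F) w = 0) \<or>
          tB w \<and> (even (d (insert g ?F) w) \<or> d (insert g ?F) w = n w)"
        using y A x u True by (cases "w = y") (auto simp: dT)
    qed (use L_in[OF g] L_sub in auto)
  next
    case oddF: False
    show False
    proof (cases "card ?F = n y")
      case True
      obtain k where k: "k \<in> I - ?F"
      proof (rule item_outside[OF _ card3[of x y y], of "?F"])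
        show "d ?F w = 0" if "w \<in> S - {x, y, y}" for w using that by (auto simp: dF)
      qed (use x y L_sub in auto)
      show False
      proof (rule key[OF _ _ k])
        fix w assume "w \<in> S"
        then show "tA w \<and> (odd (d ?F w) \<or> d ?F w = 0) \<or> tB w \<and> (even (d ?F w) \<or> d ?F w = n w)"
          using y A x True oddF by (cases "w = y") (auto simp: dF)
      qed (use L_sub in auto)
    next
      case False
      then obtain u g where u: "u \<in> S" "u \<noteq> x" "u \<noteq> y" and g: "g \<in> L y u"
        using other_item[OF y(1) x(1) not_sym[OF x(2)]] L_sym[of x y] by metis
      have gF: "g \<notin> ?F" using L_notin[OF g] u x by (auto simp: doubleton_eq_iff)
      have dT: "d (insert g ?F) w = of_bool (w = y) + of_bool (w = u) + card ?F * (of_bool (w = x) + of_bool (w = y))" for w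
        using d_insert[OF g fin_L gF] dF by simp
      obtain k where k: "k \<in> I - insert g ?F"
      proof (rule item_outside[OF _ card3[of x y u], of "insert g ?F"])
        show "d (insert g ?F) w = 0" if "w \<in> S - {x, y, u}" for w using that by (auto simp: dT)
      qed (use x y u L_in[OF g] L_sub in auto)
      show False
      proof (rule key[OF _ _ k])
        fix w assume "w \<in> S"
        then show "tA w \<and> (odd (d (insert g ?F) w) \<or> d (insert g ?F) w = 0) \<or>
            tB w \<and> (even (d (insert g ?F) w) \<or> d (insert g ?F) w = n w)"
          using y A x u oddF by (cases "w = y") (auto simp: dT)
      qed (use L_in[OF g] L_sub in auto)
    qed
  qed
qed

text \<open>The mirror image of \<open>not_one_B\<close>: with a lightest item \<open>e\<close>,
  everything outside the parallel class of \<open>e\<close> is positive, and the class is extended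
  to a proper set with admissible complement, which already weighs the total.\<close>

lemma not_one_A:
  assumes y: "y \<in> S" "tA y" and B: "\<And>x. x \<in> S \<Longrightarrow> x \<noteq> y \<Longrightarrow> tB x"
  shows False
proof -
  define Y where "Y = {i \<in> I. inc i y > 0}"
  have Y_L: "\<exists>x\<in>S. x \<noteq> y \<and> i \<in> L x y" if "i \<in> Y" for i
  proof -
    have i: "i \<in> I" "inc i y > 0" using that by (auto simp: Y_def)
    then obtain p q where pq: "p \<in> S" "q \<in> S" "p \<noteq> q" "i \<in> L p q" using items by blast
    then have "p = y \<or> q = y" using i inc_L[OF pq(4), of y] by auto
    then show ?thesis using pq L_sym[of p q] by auto
  qed
  have notY: "\<Delta> i \<ge> sum \<Delta> I" if i: "i \<in> I" "i \<notin> Y" for i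
  proof -
    obtain p q where pq: "p \<in> S" "q \<in> S" "p \<noteq> q" "i \<in> L p q" using items i by blast
    then have "p \<noteq> y" "q \<noteq> y" using i inc_L[OF pq(4), of y] by (auto simp: Y_def)
    then show ?thesis using BB[OF pq(4,3,1,2)] B pq by blast
  qed
  obtain i0 where i0: "i0 \<in> I" "\<Delta> i0 < sum \<Delta> I" using not_all_ge by blast
  then have i0Y: "i0 \<in> Y" using notY by force
  have "finite Y" by (simp add: Y_def)
  then obtain e where e: "e \<in> Y" "\<And>i. i \<in> Y \<Longrightarrow> \<Delta> e \<le> \<Delta> i"
    using finite_arg_max_real[of Y "\<lambda>i. - \<Delta> i"] i0Y by auto
  have e_lt: "\<Delta> e < sum \<Delta> I" using e(2)[OF i0Y] i0 by simp
  obtain x where x: "x \<in> S" "x \<noteq> y" "e \<in> L x y" using Y_L[OF e(1)] by blast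
  let ?F = "L x y"
  have dF: "d ?F u = card ?F * (of_bool (u = x) + of_bool (u = y))" for u
    by (rule d_L) simp
  have outside: "\<Delta> i > 0" if i: "i \<in> I" "i \<notin> ?F" for i
  proof (cases "i \<in> Y")
    case True
    then obtain z where z: "z \<in> S" "z \<noteq> y" "i \<in> L z y" using Y_L by blast
    then have zx: "z \<noteq> x" using i by auto
    have ne: "e \<noteq> i" using x(3) i by auto
    have dT: "d {e, i} u = of_bool (u = x) + of_bool (u = z) + 2 * of_bool (u = y)" for u
      using ne by (simp add: d_insert[OF x(3)] d_insert[OF z(3)])
    have "sum \<Delta> {e, i} \<ge> sum \<Delta> I"
    proof (rule geI1)
      fix u assume "u \<in> S"
      then show "tA u \<and> (even (d {e, i} u) \<or> d {e, i} u = n u) \<or> tB u \<and> (odd (d {e, i} u) \<or> d {e, i} u = 0)"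
        using y B x z zx by (cases "u = y") (auto simp: dT)
    qed (use L_in x i in auto)
    then show ?thesis using ne e_lt by simp
  next
    case False
    then have "\<Delta> i \<ge> sum \<Delta> I" using notY i by blast
    then show ?thesis using pos by simp
  qed
  have key: False
    if T: "?F \<subseteq> T" "T \<subseteq> I" "k \<in> I - T" and
      ok: "\<And>u. u \<in> S \<Longrightarrow> tA u \<and> (even (d T u) \<or> d T u = n u) \<or> tB u \<and> (odd (d T u) \<or> d T u = 0)" for T k
  proof -
    have "sum \<Delta> T \<ge> sum \<Delta> I" by (rule geI1[OF T(2) _ ok]) (use T(1) x in blast)
    moreover have "sum \<Delta> (I - T) > 0" using outside T by (intro sum_pos) auto
    ultimately show False using sum_split[OF T(2)] pos by simp
  qed
  have oddn: "odd (n x)" "odd (n y)" using odd_n x y by auto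
  show False
  proof (cases "even (card ?F)")
    case True
    then have "card ?F \<noteq> n x" using oddn by auto
    then obtain u g where u: "u \<in> S" "u \<noteq> x" "u \<noteq> y" and g: "g \<in> L x u"
      using other_item[OF x(1) y(1) x(2)] by blast
    have gF: "g \<notin> ?F" using L_notin[OF g] u x by (auto simp: doubleton_eq_iff)
    have dT: "d (insert g ?F) w = of_bool (w = x) + of_bool (w = u) + card ?F * (of_bool (w = x) + of_bool (w = y))" for w
      using d_insert[OF g fin_L gF] dF by simp
    obtain k where k: "k \<in> I - insert g ?F"
    proof (rule item_outside[OF _ card3[of x y u], of "insert g ?F"])
      show "d (insert g ?F) w = 0" if "w \<in> S - {x, y, u}" for w using that by (auto simp: dT)
    qed (use x y u L_in[OF g] L_sub in auto)
    show False
    proof (rule key[OF _ _ k])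
      fix w assume "w \<in> S"
      then show "tA w \<and> (even (d (insert g ?F) w) \<or> d (insert g ?F) w = n w) \<or>
          tB w \<and> (odd (d (insert g ?F) w) \<or> d (insert g ?F) w = 0)"
        using y B x u True by (cases "w = y") (auto simp: dT)
    qed (use L_in[OF g] L_sub in auto)
  next
    case oddF: False
    show False
    proof (cases "card ?F = n y")
      case True
      obtain k where k: "k \<in> I - ?F"
      proof (rule item_outside[OF _ card3[of x y y], of "?F"])
        show "d ?F w = 0" if "w \<in> S - {x, y, y}" for w using that by (auto simp: dF)
      qed (use x y L_sub in auto)
      show False
      proof (rule key[OF _ _ k])
        fix w assume "w \<in> S"
        then show "tA w \<and> (even (d ?F w) \<or> d ?F w = n w) \<or> tB w \<and> (odd (d ?F w) \<or> d ?F w = 0)"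
          using y B x True oddF by (cases "w = y") (auto simp: dF)
      qed (use L_sub in auto)
    next
      case False
      then obtain u g where u: "u \<in> S" "u \<noteq> x" "u \<noteq> y" and g: "g \<in> L y u"
        using other_item[OF y(1) x(1) not_sym[OF x(2)]] L_sym[of x y] by metis
      have gF: "g \<notin> ?F" using L_notin[OF g] u x by (auto simp: doubleton_eq_iff)
      have dT: "d (insert g ?F) w = of_bool (w = y) + of_bool (w = u) + card ?F * (of_bool (w = x) + of_bool (w = y))" for w
        using d_insert[OF g fin_L gF] dF by simp
      obtain k where k: "k \<in> I - insert g ?F"
      proof (rule item_outside[OF _ card3[of x y u], of "insert g ?F"])
        show "d (insert g ?F) w = 0" if "w \<in> S - {x, y, u}" for w using that by (auto simp: dT)
      qed (use x y u L_in[OF g] L_sub in auto)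
      show False
      proof (rule key[OF _ _ k])
        fix w assume "w \<in> S"
        then show "tA w \<and> (even (d (insert g ?F) w) \<or> d (insert g ?F) w = n w) \<or>
            tB w \<and> (odd (d (insert g ?F) w) \<or> d (insert g ?F) w = 0)"
          using y B x u oddF by (cases "w = y") (auto simp: dT)
      qed (use L_in[OF g] L_sub in auto)
    qed
  qed
qed

lemma nonposI2:
  assumes "T \<subseteq> I" "v \<in> S" "d T v \<noteq> n v"
    "\<And>u. u \<in> S \<Longrightarrow> tA u \<and> (odd (d T u) \<or> d T u = 0) \<or> tB u \<and> (even (d T u) \<or> d T u = n u)"
  shows "sum \<Delta> T \<le> 0"
proof -
  have "\<not> I \<subseteq> T" using assms(1,3) by (metis subset_antisym)
  then obtain k where "k \<in> I - T" by blast
  then show ?thesis using nonposI1[OF assms(1) _ assms(4)] by blast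
qed

lemma one_le_card: "i \<in> L x y \<Longrightarrow> 1 \<le> card (L x y)"
  using fin_L[of x y] by (metis One_nat_def Suc_leI card_gt_0_iff empty_iff)

lemma typeB_ge: "y \<in> S \<Longrightarrow> tB y \<Longrightarrow> n y \<ge> 3"
  using r1[of y] by (simp add: typeB_def)

lemma path_nonpos:
  assumes "p \<in> L x y" "q \<in> L x' y" "x \<noteq> x'" "x \<noteq> y" "x' \<noteq> y" "x \<in> S" "x' \<in> S" "y \<in> S" "tA x" "tA x'" "tB y"
  shows "\<Delta> p + \<Delta> q \<le> 0"
proof -
  have ne: "p \<noteq> q" using L_neq[OF assms(1,2)] assms(3-5) by (auto simp: doubleton_eq_iff)
  have dT: "d {p, q} u = of_bool (u = x) + of_bool (u = x') + 2 * of_bool (u = y)" for u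
    using ne by (simp add: d_insert[OF assms(1)] d_insert[OF assms(2)])
  have "sum \<Delta> {p, q} \<le> 0"
  proof (rule nonposI2[OF _ assms(8)])
    have "n y \<noteq> 2" using odd_n[OF assms(8)] by (metis even_numeral)
    then show "d {p, q} y \<noteq> n y" using assms(3-5) by (simp add: dT)
    show "tA u \<and> (odd (d {p, q} u) \<or> d {p, q} u = 0) \<or> tB u \<and> (even (d {p, q} u) \<or> d {p, q} u = n u)"
      if "u \<in> S" for u
      using assms tAB[OF that] by (cases "u = x"; cases "u = x'"; cases "u = y") (auto simp: dT)
  qed (use assms L_in in auto)
  then show ?thesis using ne by simp
qed

lemma path_ge:
  assumes "p \<in> L x y" "q \<in> L x y'" "y \<noteq> y'" "x \<noteq> y" "x \<noteq> y'" "x \<in> S" "y' \<in> S" "y \<in> S" "tA x" "tB y" "tB y'"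
  shows "\<Delta> p + \<Delta> q \<ge> sum \<Delta> I"
proof -
  have ne: "p \<noteq> q" using L_neq[OF assms(1,2)] assms(3-5) by (auto simp: doubleton_eq_iff)
  have dT: "d {p, q} u = of_bool (u = y) + of_bool (u = y') + 2 * of_bool (u = x)" for u
    using ne by (simp add: d_insert[OF assms(1)] d_insert[OF assms(2)])
  have "sum \<Delta> {p, q} \<ge> sum \<Delta> I"
  proof (rule geI1)
    show "tA u \<and> (even (d {p, q} u) \<or> d {p, q} u = n u) \<or> tB u \<and> (odd (d {p, q} u) \<or> d {p, q} u = 0)"
      if "u \<in> S" for u
      using assms tAB[OF that] by (cases "u = x"; cases "u = y'"; cases "u = y") (auto simp: dT)
  qed (use assms L_in in auto)
  then show ?thesis using ne by simp
qed

text \<open>Besides the missing pair, items joining equal types are rare: at most one between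
  \<open>x1\<close> and \<open>x2\<close>, with weight at most 0, and at most one between
  \<open>y1\<close> and \<open>y2\<close>, with weight at least the total. Which of them exist fixes
  the parities of \<open>?E\<close> and \<open>?G\<close>, and these supply the sets for the
  contradiction.\<close>

lemma not_two_two_missing:
  assumes S: "S = {x1, x2, y1, y2}" and distinct: "distinct [x1, x2, y1, y2]"
    and t: "tA x1" "tA x2" "tB y1" "tB y2" and missing: "L x2 y2 = {}"
  shows False
proof -
  have ne: "x1 \<noteq> x2" "x1 \<noteq> y1" "x1 \<noteq> y2" "x2 \<noteq> y1" "x2 \<noteq> y2" "y1 \<noteq> y2"
    "x2 \<noteq> x1" "y1 \<noteq> x1" "y2 \<noteq> x1" "y1 \<noteq> x2" "y2 \<noteq> x2" "y2 \<noteq> y1"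
    using distinct by auto
  have in_S: "x1 \<in> S" "x2 \<in> S" "y1 \<in> S" "y2 \<in> S" using S by auto
  have SD: "S - {x1} = {x2, y1, y2}" "S - {x2} = {x1, y1, y2}" "S - {y1} = {x1, x2, y2}"
    "S - {y2} = {x1, x2, y1}" using S ne by auto
  have sym: "L x2 x1 = L x1 x2" "L y1 x1 = L x1 y1" "L y2 x1 = L x1 y2" "L y1 x2 = L x2 y1"
    "L y2 x2 = L x2 y2" "L y2 y1 = L y1 y2"
    by (rule L_sym)+
  have nx1: "n x1 = card (L x1 x2) + card (L x1 y1) + card (L x1 y2)"
    using n_sum[OF in_S(1) loopless[OF in_S(1)]] ne unfolding SD by (simp add: sym)
  have nx2: "n x2 = card (L x1 x2) + card (L x2 y1)"
    using n_sum[OF in_S(2) loopless[OF in_S(2)]] ne missing unfolding SD by (simp add: sym)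
  have ny1: "n y1 = card (L y1 y2) + card (L x1 y1) + card (L x2 y1)"
    using n_sum[OF in_S(3) loopless[OF in_S(3)]] ne unfolding SD by (simp add: sym)
  have ny2: "n y2 = card (L y1 y2) + card (L x1 y2)"
    using n_sum[OF in_S(4) loopless[OF in_S(4)]] ne missing unfolding SD by (simp add: sym)
  have odds: "odd (n x1)" "odd (n x2)" "odd (n y1)" "odd (n y2)" using odd_n in_S by auto
  have n3: "n y1 \<ge> 3" "n y2 \<ge> 3" using typeB_ge in_S t by auto
  have npos: "n y1 > 0" "n y2 > 0" "n y2 \<noteq> 2" using n3 by auto
  have A: "\<Delta> i \<le> 0" if "i \<in> L x1 x2" for i using AA[OF that] ne in_S t by blast
  have B: "\<Delta> i \<ge> sum \<Delta> I" if "i \<in> L y1 y2" for i using BB[OF that] ne in_S t by blast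
  have cA: "card (L x1 x2) \<le> 1"
  proof (rule ccontr)
    assume c: "\<not> card (L x1 x2) \<le> 1"
    then obtain i j where ij: "i \<in> L x1 x2" "j \<in> L x1 x2" "i \<noteq> j"
      using two_in[of "L x1 x2"] by auto
    have c2: "2 \<le> n x1" "2 \<le> n x2" using c unfolding nx1 nx2 by linarith+
    have "n x1 - 2 \<in> C x1" "n x2 - 2 \<in> C x2"
      using cov(1)[OF S_V[OF in_S(1)] c2(1) t(1)] cov(1)[OF S_V[OF in_S(2)] c2(2) t(2)] r1 in_S by simp_all
    then show False using pair_ge[OF ij ne(1) in_S(1,2)] A[OF ij(1)] A[OF ij(2)] pos by simp
  qed
  have cB: "card (L y1 y2) \<le> 1"
  proof (rule ccontr)
    assume c: "\<not> card (L y1 y2) \<le> 1"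
    then obtain i j where ij: "i \<in> L y1 y2" "j \<in> L y1 y2" "i \<noteq> j"
      using two_in[of "L y1 y2"] by auto
    have "2 \<in> C y1" "2 \<in> C y2"
      using val(2)[OF S_V[OF in_S(3)] _ t(3), of 2] val(2)[OF S_V[OF in_S(4)] _ t(4), of 2] n3 by auto
    then show False using pair_nonpos[OF ij ne(6) in_S(3,4)] n3 B[OF ij(1)] B[OF ij(2)] pos by simp
  qed
  let ?E = "L x2 y1" and ?G = "L x1 y2"
  have dE: "d ?E u = card ?E * (of_bool (u = x2) + of_bool (u = y1))" for u by (rule d_L) simp
  have dG: "d ?G u = card ?G * (of_bool (u = x1) + of_bool (u = y2))" for u by (rule d_L) simp
  have cG: "card ?G \<ge> 2" using ny2 n3 cB by simp
  then obtain g where g: "g \<in> ?G" by (metis card.empty equals0I not_numeral_le_zero)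
  have notin: "i \<notin> L a b" if "i \<in> L a' b'" "{a', b'} \<noteq> {a, b}" for i a b a' b'
    using L_notin[OF that] .
  have G_valid: "sum \<Delta> ?G \<le> 0" if "L y1 y2 = {}"
  proof (rule nonposI2[OF L_sub in_S(3)])
    show "d ?G y1 \<noteq> n y1" using ne npos by (simp add: dG)
    show "tA u \<and> (odd (d ?G u) \<or> d ?G u = 0) \<or> tB u \<and> (even (d ?G u) \<or> d ?G u = n u)"
      if "u \<in> S" for u
      using \<open>u \<in> S\<close> \<open>L y1 y2 = {}\<close> S ne t odds ny2 by (auto simp: dG)
  qed
  have G_f: "sum \<Delta> ?G + \<Delta> f \<ge> sum \<Delta> I" if f: "f \<in> L x1 y1" and "odd (card ?G)" for f
  proof -
    have nf: "f \<notin> ?G" using notin[OF f] ne by (auto simp: doubleton_eq_iff)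
    have dT: "d (insert f ?G) u = of_bool (u = x1) + of_bool (u = y1) + card ?G * (of_bool (u = x1) + of_bool (u = y2))" for u
      using d_insert[OF f fin_L nf] dG by simp
    have "sum \<Delta> (insert f ?G) \<ge> sum \<Delta> I"
    proof (rule geI1)
      show "tA u \<and> (even (d (insert f ?G) u) \<or> d (insert f ?G) u = n u) \<or>
          tB u \<and> (odd (d (insert f ?G) u) \<or> d (insert f ?G) u = 0)" if "u \<in> S" for u
        using \<open>u \<in> S\<close> \<open>odd (card ?G)\<close> S ne t by (auto simp: dT)
    qed (use L_in[OF f] L_sub in auto)
    then show ?thesis using nf by simp
  qed
  show False
  proof (cases "L x1 x2 = {}")
    case no_h: True
    have oddE: "odd (card ?E)" "card ?E = n x2" using nx2 odds no_h by auto
    then have neE: "?E \<noteq> {}" by auto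
    have E_ge: "sum \<Delta> ?E \<ge> sum \<Delta> I"
    proof (rule geI1[OF L_sub neE])
      show "tA u \<and> (even (d ?E u) \<or> d ?E u = n u) \<or> tB u \<and> (odd (d ?E u) \<or> d ?E u = 0)"
        if "u \<in> S" for u
        using \<open>u \<in> S\<close> oddE S ne t by (auto simp: dE)
    qed
    have E_f: "sum \<Delta> ?E + \<Delta> f \<le> 0" if f: "f \<in> L x1 y1" for f
    proof -
      have nf: "f \<notin> ?E" using notin[OF f] ne by (auto simp: doubleton_eq_iff)
      have dT: "d (insert f ?E) u = of_bool (u = x1) + of_bool (u = y1) + card ?E * (of_bool (u = x2) + of_bool (u = y1))" for u
        using d_insert[OF f fin_L nf] dE by simp
      have "sum \<Delta> (insert f ?E) \<le> 0"
      proof (rule nonposI2[OF _ in_S(4)])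
        show "d (insert f ?E) y2 \<noteq> n y2" using ne npos by (simp add: dT)
        show "tA u \<and> (odd (d (insert f ?E) u) \<or> d (insert f ?E) u = 0) \<or>
            tB u \<and> (even (d (insert f ?E) u) \<or> d (insert f ?E) u = n u)" if "u \<in> S" for u
          using \<open>u \<in> S\<close> oddE S ne t by (auto simp: dT)
      qed (use L_in[OF f] L_sub in auto)
      then show ?thesis using nf by simp
    qed
    show False
    proof (cases "L y1 y2 = {}")
      case no_m: True
      show False
      proof (cases "L x1 y1 = {}")
        case True
        have "sum \<Delta> ?E \<le> 0"
        proof (rule nonposI2[OF L_sub in_S(4)])
          show "d ?E y2 \<noteq> n y2" using ne npos by (simp add: dE)
          show "tA u \<and> (odd (d ?E u) \<or> d ?E u = 0) \<or> tB u \<and> (even (d ?E u) \<or> d ?E u = n u)"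
            if "u \<in> S" for u
            using \<open>u \<in> S\<close> oddE S ne t ny1 no_m True by (auto simp: dE)
        qed
        then show False using E_ge pos by simp
      next
        case False
        then obtain f where f: "f \<in> L x1 y1" by blast
        have "odd (card ?G)" using ny2 no_m odds by simp
        \<comment> \<open>\<open>?E\<close> forces \<open>f\<close> below minus the total or equal
          to it, so \<open>?G\<close> would weigh at least twice the total.\<close>
        then show False using E_ge E_f[OF f] G_valid[OF no_m] G_f[OF f] pos by simp
      qed
    next
      case False
      then obtain m where m: "m \<in> L y1 y2" by blast
      have cm: "card (L y1 y2) = 1" using cB one_le_card[OF m] by (rule le_antisym)
      have "even (card ?G)" using ny2 cm odds by simp
      then have "L x1 y1 \<noteq> {}" using nx1 odds(1) no_h by (metis add_0 card.empty)
      then obtain f where f: "f \<in> L x1 y1" by blast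
      have nm: "g \<notin> ?E" "m \<notin> insert g ?E"
        using notin[OF g, of x2 y1] notin[OF m, of x2 y1] L_neq[OF m g] ne by (auto simp: doubleton_eq_iff)
      have dT: "d (insert m (insert g ?E)) u = of_bool (u = y1) + of_bool (u = y2) + (of_bool (u = x1) + of_bool (u = y2)
          + card ?E * (of_bool (u = x2) + of_bool (u = y1)))" for u
        using d_insert[OF m _ nm(2)] d_insert[OF g fin_L nm(1)] dE by simp
      have "sum \<Delta> (insert m (insert g ?E)) \<le> 0"
      proof (rule nonposI2[OF _ in_S(4)])
        show "d (insert m (insert g ?E)) y2 \<noteq> n y2" using ne npos n3 by (simp add: dT)
        show "tA u \<and> (odd (d (insert m (insert g ?E)) u) \<or> d (insert m (insert g ?E)) u = 0) \<or>
            tB u \<and> (even (d (insert m (insert g ?E)) u) \<or> d (insert m (insert g ?E)) u = n u)" if "u \<in> S" for u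
          using \<open>u \<in> S\<close> oddE S ne t by (auto simp: dT)
      qed (use L_in[OF g] L_in[OF m] L_sub in auto)
      then have "\<Delta> m + \<Delta> g + sum \<Delta> ?E \<le> 0" using nm by simp
      moreover have "\<Delta> f + \<Delta> g \<ge> sum \<Delta> I" using path_ge[OF f g] ne in_S t by simp
      \<comment> \<open>Here \<open>f\<close> is at most minus the total, so \<open>g\<close> is at
        least twice the total; then \<open>m\<close>, \<open>g\<close> and \<open>?E\<close>
        together cannot be nonpositive.\<close>
      ultimately show False
        using B[OF m] E_f[OF f] E_ge pos by simp
    qed
  next
    case False
    then obtain h where h: "h \<in> L x1 x2" by blast
    have ch: "card (L x1 x2) = 1" using cA one_le_card[OF h] by (rule le_antisym)
    show False
    proof (cases "?E = {}")
      case noE: True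
      then have n1: "n x2 = 1" using nx2 ch by simp
      have hf: "\<Delta> h + \<Delta> f \<ge> sum \<Delta> I" if f: "f \<in> L x1 y" "y = y1 \<or> y = y2" for f y
      proof -
        have nf: "h \<noteq> f" using L_neq[OF h f(1)] f(2) ne by (auto simp: doubleton_eq_iff)
        have dT: "d {h, f} u = 2 * of_bool (u = x1) + of_bool (u = x2) + of_bool (u = y)" for u
          using nf by (simp add: d_insert[OF h] d_insert[OF f(1)])
        have "sum \<Delta> {h, f} \<ge> sum \<Delta> I"
        proof (rule geI1)
          show "tA u \<and> (even (d {h, f} u) \<or> d {h, f} u = n u) \<or> tB u \<and> (odd (d {h, f} u) \<or> d {h, f} u = 0)"
            if "u \<in> S" for u
            using \<open>u \<in> S\<close> S ne t n1 f(2) by (auto simp: dT)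
        qed (use L_in[OF h] L_in[OF f(1)] in auto)
        then show ?thesis using nf by simp
      qed
      \<comment> \<open>Since \<open>h\<close> is nonpositive, the bound \<open>hf\<close> makes its
        partner positive. So \<open>{h, g}\<close> already weighs at least the total and the
        remaining items add to it.\<close>
      have rest: "\<Delta> i > 0" if i: "i \<in> I - {h, g}" for i
      proof -
        obtain p q where pq: "p \<in> S" "q \<in> S" "p \<noteq> q" "i \<in> L p q" using items i by blast
        have "L x1 x2 = {h}" using ch h by (metis card_1_singletonE singletonD)
        then have "i \<in> L x1 y1 \<or> i \<in> L x1 y2 \<or> i \<in> L y1 y2"
          using pq S missing noE i L_sym[of q p] by auto
        then show ?thesis
          using hf[of i y1] hf[of i y2] B[of i] A[OF h] pos by auto
      qed
      obtain g' where g': "g' \<in> ?G" "g' \<noteq> g" using two_in[OF cG] by metis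
      have "g' \<noteq> h" using L_neq[OF g'(1) h] ne by (auto simp: doubleton_eq_iff)
      then have "sum \<Delta> (I - {h, g}) > 0"
        using rest g' L_in[OF g'(1)] by (intro sum_pos) auto
      moreover have "h \<noteq> g" using L_neq[OF h g] ne by (auto simp: doubleton_eq_iff)
      then have "sum \<Delta> {h, g} \<ge> sum \<Delta> I" using hf[OF g] by simp
      moreover have "{h, g} \<subseteq> I" using L_in[OF h] L_in[OF g] by simp
      ultimately show False using sum_split[of "{h, g}"] by simp
    next
      case False
      then obtain e where e: "e \<in> ?E" by blast
      show False
      proof (cases "L y1 y2 = {}")
        case no_m: True
        have oG: "odd (card ?G)" using ny2 no_m odds by simp
        have "even (card ?E)" using nx2 ch odds by simp
        then have "L x1 y1 \<noteq> {}" using ny1 odds(3) no_m by (metis add_0 card.empty)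
        then obtain f where f: "f \<in> L x1 y1" by blast
        have nm: "e \<notin> ?G" "h \<notin> insert e ?G"
          using notin[OF e, of x1 y2] notin[OF h, of x1 y2] L_neq[OF h e] ne by (auto simp: doubleton_eq_iff)
        have dT: "d (insert h (insert e ?G)) u = of_bool (u = x1) + of_bool (u = x2) + (of_bool (u = x2) + of_bool (u = y1)
            + card ?G * (of_bool (u = x1) + of_bool (u = y2)))" for u
          using d_insert[OF h _ nm(2)] d_insert[OF e fin_L nm(1)] dG by simp
        have "sum \<Delta> (insert h (insert e ?G)) \<ge> sum \<Delta> I"
        proof (rule geI1)
          show "tA u \<and> (even (d (insert h (insert e ?G)) u) \<or> d (insert h (insert e ?G)) u = n u) \<or>
              tB u \<and> (odd (d (insert h (insert e ?G)) u) \<or> d (insert h (insert e ?G)) u = 0)" if "u \<in> S" for u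
            using \<open>u \<in> S\<close> oG S ne t by (auto simp: dT)
        qed (use L_in[OF e] L_in[OF h] L_sub in auto)
        then have "\<Delta> h + \<Delta> e + sum \<Delta> ?G \<ge> sum \<Delta> I" using nm by simp
        moreover have "\<Delta> f + \<Delta> e \<le> 0" using path_nonpos[OF f e] ne in_S t by simp
        \<comment> \<open>As \<open>?G\<close> is nonpositive, \<open>f\<close> is at least the
          total and \<open>e\<close> at most its negative, so \<open>h\<close>, \<open>e\<close> and
          \<open>?G\<close> add up to a negative number.\<close>
        ultimately show False
          using A[OF h] G_valid[OF no_m] G_f[OF f oG] pos by simp
      next
        case False
        then obtain m where m: "m \<in> L y1 y2" by blast
        have neq: "e \<noteq> m" "e \<noteq> g" "m \<noteq> g" "h \<noteq> e" "h \<noteq> g"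
          using L_neq[OF e m] L_neq[OF e g] L_neq[OF m g] L_neq[OF h e] L_neq[OF h g] ne
          by (auto simp: doubleton_eq_iff)
        have dT: "d {e, m, g} u = of_bool (u = x1) + of_bool (u = x2) + 2 * of_bool (u = y1) + 2 * of_bool (u = y2)" for u
          using neq by (simp add: d_insert[OF e] d_insert[OF m] d_insert[OF g])
        have "sum \<Delta> {e, m, g} \<le> 0"
        proof (rule nonposI2[OF _ in_S(4)])
          show "d {e, m, g} y2 \<noteq> n y2" using ne npos n3 by (simp add: dT)
          show "tA u \<and> (odd (d {e, m, g} u) \<or> d {e, m, g} u = 0) \<or> tB u \<and> (even (d {e, m, g} u) \<or> d {e, m, g} u = n u)"
            if "u \<in> S" for u
            using \<open>u \<in> S\<close> S ne t by (auto simp: dT)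
        qed (use L_in e m g in auto)
        moreover have dT': "d {g, h, e} u = 2 * of_bool (u = x1) + 2 * of_bool (u = x2) + of_bool (u = y1) + of_bool (u = y2)" for u
          using neq by (simp add: d_insert[OF e] d_insert[OF h] d_insert[OF g])
        have "sum \<Delta> {g, h, e} \<ge> sum \<Delta> I"
        proof (rule geI1)
          show "tA u \<and> (even (d {g, h, e} u) \<or> d {g, h, e} u = n u) \<or> tB u \<and> (odd (d {g, h, e} u) \<or> d {g, h, e} u = 0)"
            if "u \<in> S" for u
            using \<open>u \<in> S\<close> S ne t by (auto simp: dT')
        qed (use L_in e h g in auto)
        ultimately show False using A[OF h] B[OF m] neq pos by simp
      qed
    qed
  qed
qed

text \<open>By symmetry all four pairs of different type are joined. On the resulting cycle of
  length 4 the two paths through \<open>y1\<close> and \<open>y2\<close> are admissible, while those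
  through \<open>x1\<close> and \<open>x2\<close> have admissible complements, and both families
  cover the same items.\<close>

lemma not_two_two:
  assumes S: "S = {x1, x2, y1, y2}" and distinct: "distinct [x1, x2, y1, y2]"
    and t: "tA x1" "tA x2" "tB y1" "tB y2"
  shows False
proof -
  have perm: "S = {x2, x1, y1, y2}" "S = {x1, x2, y2, y1}" "S = {x2, x1, y2, y1}" using S by auto
  have dist: "distinct [x2, x1, y1, y2]" "distinct [x1, x2, y2, y1]" "distinct [x2, x1, y2, y1]"
    using distinct by auto
  have "L x2 y2 \<noteq> {}" using not_two_two_missing[OF S distinct t] by blast
  moreover have "L x1 y2 \<noteq> {}" using not_two_two_missing[OF perm(1) dist(1) t(2,1,3,4)] by blast
  moreover have "L x2 y1 \<noteq> {}" using not_two_two_missing[OF perm(2) dist(2) t(1,2,4,3)] by blast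
  moreover have "L x1 y1 \<noteq> {}" using not_two_two_missing[OF perm(3) dist(3) t(2,1,4,3)] by blast
  ultimately obtain a b c e where abce: "a \<in> L x1 y1" "b \<in> L x2 y1" "c \<in> L x2 y2" "e \<in> L x1 y2" by blast
  have in_S: "x1 \<in> S" "x2 \<in> S" "y1 \<in> S" "y2 \<in> S" using S by auto
  have "\<Delta> a + \<Delta> b \<le> 0" "\<Delta> e + \<Delta> c \<le> 0" "\<Delta> a + \<Delta> e \<ge> sum \<Delta> I" "\<Delta> b + \<Delta> c \<ge> sum \<Delta> I"
    using path_nonpos[OF abce(1,2)] path_nonpos[OF abce(4,3)] path_ge[OF abce(1,4)] path_ge[OF abce(2,3)]
      in_S t distinct by auto
  then show False using pos by simp
qed

lemma contradiction: False
proof -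
  define P where "P = {v \<in> S. tA v}"
  have finP: "finite P" "finite (S - P)" by (auto simp: P_def)
  have cc: "card P + card (S - P) = 4"
    using four card_Diff_subset[of P S] card_mono[OF finS, of P] finP by (simp add: P_def)
  have B: "tB v" if "v \<in> S - P" for v using that tAB by (auto simp: P_def)
  have A: "tA v" "v \<in> S" if "v \<in> P" for v using that by (auto simp: P_def)
  consider "card P = 4" | "card P = 3" | "card P = 2" | "card P = 1" | "card P = 0" using cc by linarith
  then show False
  proof cases
    case 1
    then have "S - P = {}" using cc finP by auto
    then have SP: "v \<in> P" if "v \<in> S" for v using that by blast
    have "\<Delta> i \<le> 0" if i: "i \<in> I" for i
    proof -
      obtain p q where pq: "p \<in> S" "q \<in> S" "p \<noteq> q" "i \<in> L p q" by (rule items[OF i])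
      then show ?thesis using AA[OF pq(4,3,1,2)] A SP by blast
    qed
    then show False using not_all_nonpos by (metis not_less)
  next
    case 2
    then have "card (S - P) = 1" using cc by linarith
    then obtain y where y: "S - P = {y}" by (rule card_1_singletonE)
    have yS: "y \<in> S - P" unfolding y by simp
    have "tA v" if "v \<in> S" "v \<noteq> y" for v
    proof (rule A(1), rule ccontr)
      assume "v \<notin> P"
      then have "v \<in> S - P" using that by blast
      then show False using that(2) unfolding y by simp
    qed
    then show False using not_one_B[of y] yS B[OF yS] by blast
  next
    case 3
    then obtain x1 x2 where x: "P = {x1, x2}" "x1 \<noteq> x2" by (auto simp: card_2_iff)
    have "card (S - P) = 2" using 3 cc by simp
    then obtain y1 y2 where y: "S - P = {y1, y2}" "y1 \<noteq> y2" by (auto simp: card_2_iff)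
    have "S = P \<union> (S - P)" by (auto simp: P_def)
    then have "S = {x1, x2, y1, y2}" unfolding x(1) y(1)[unfolded x(1)] by (metis insert_is_Un Un_assoc)
    moreover have mem: "x1 \<in> P" "x2 \<in> P" "y1 \<in> S - P" "y2 \<in> S - P" unfolding x(1)
      using y(1) x(1) by simp_all
    then have "distinct [x1, x2, y1, y2]" using x(2) y(2) by auto
    ultimately show False
      using not_two_two A(1)[OF mem(1)] A(1)[OF mem(2)] B[OF mem(3)] B[OF mem(4)] by blast
  next
    case 4
    then obtain x where x: "P = {x}" by (metis card_1_singletonE)
    have xP: "x \<in> P" unfolding x by simp
    have "tB v" if "v \<in> S" "v \<noteq> x" for v
      using that B[of v] x by blast
    then show False using not_one_A[of x] A[OF xP] by blast
  next
    case 5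
    then have "P = {}" using finP by simp
    then have SP: "v \<in> S - P" if "v \<in> S" for v using that by blast
    have "\<Delta> i \<ge> sum \<Delta> I" if i: "i \<in> I" for i
    proof -
      obtain p q where pq: "p \<in> S" "q \<in> S" "p \<noteq> q" "i \<in> L p q" by (rule items[OF i])
      then show ?thesis using BB[OF pq(4,3,1,2)] B SP by blast
    qed
    then show False using not_all_ge by (metis not_less)
  qed
qed

end

section \<open>Conclusion of the induction on the number of blocks\<close>

context critical
begin

lemma contradiction: False
proof (rule sum_eq_4_cases[OF finS r_pos sum_r])
  show False if "S = {v}" for v using that not_single by blast
  show False if "S = {v, w}" "v \<noteq> w" "r v = 3" "r w = 1" for v w using that not_3_1 by blast
  show False if "S = {v, w}" "v \<noteq> w" "r v = 2" "r w = 2" for v w using that not_2_2 by blast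
  show False if "S = {v, x, y}" "v \<noteq> x" "v \<noteq> y" "x \<noteq> y" "r v = 2" "r x = 1" "r y = 1" for v x y
    using that not_2_1_1 by blast
  show False if "card S = 4" "\<And>v. v \<in> S \<Longrightarrow> r v = 1"
  proof -
    interpret critical_four V N inc C I \<Delta>
      by unfold_locales (use that in auto)
    show False by (rule contradiction)
  qed
qed

end

text \<open>Incidences, degree sets and weights vary in the induction, because merging, cutting at a
  set and raising weights change all of them. Evenness of the norm leaves only the value 4 below
  5.\<close>

theorem improvable_if_norm_ge_3:
  assumes "inst V inc C (I :: 'i set)" "norm_type V inc C I \<ge> 3" "sum \<Delta> I > 0"
  shows "improvable V inc C I \<Delta>"
  using assms
proof (induction "card I" arbitrary: I inc C \<Delta> rule: less_induct)
  case less
  interpret induction_step V "card I" inc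
    by unfold_locales (use less.hyps in blast)
  show ?case
  proof (rule ccontr)
    assume no: "\<not> ?case"
    then have "norm_type V inc C I < 5"
      using improvable_large_norm[OF less.prems(1) refl _ less.prems(3)] by (meson not_less)
    then have "norm_type V inc C I = 4"
      using norm_type_even[OF less.prems(1)] less.prems(2) by (cases "norm_type V inc C I = 3") auto
    then interpret critical V "card I" inc C I \<Delta>
      by unfold_locales (use less.prems no in auto)
    show False by (rule contradiction)
  qed
qed

section \<open>Types of degrees\<close>

text \<open>This is how the gap hypothesis enters: consecutive elements of \<open>S\<close> differ
  by at most 2.\<close>

lemma next_element:
  assumes gaps: "\<forall>p>1. \<not> has_gap S p" and x: "x \<in> S" "z \<in> S" "x < z"
  shows "Suc x \<in> S \<or> Suc (Suc x) \<in> S"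
proof -
  define y where "y = (LEAST y. y \<in> S \<and> x < y)"
  have y: "y \<in> S" "x < y"
    using LeastI[of "\<lambda>y. y \<in> S \<and> x < y" z] x by (auto simp: y_def)
  have between: "i \<notin> S" if "x < i" "i < y" for i
    using not_less_Least[of i "\<lambda>y. y \<in> S \<and> x < y"] that by (auto simp: y_def)
  have "\<not> y - x - 1 > 1"
  proof
    assume "y - x - 1 > 1"
    then have "\<not> has_gap S (y - x - 1)" using gaps by blast
    moreover have "\<forall>i\<in>{x + 1..x + (y - x - 1)}. i \<notin> S" using between y by auto
    moreover have "x + (y - x - 1) + 1 \<in> S" using y by simp
    ultimately show False using x(1) unfolding has_gap_def by blast
  qed
  then have "y = Suc x \<or> y = Suc (Suc x)" using y(2) by linarith
  then show ?thesis using y(1) by auto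
qed

lemma isolated_holes_up:
  assumes gaps: "\<forall>p>1. \<not> has_gap S p" and S: "m \<in> S" "m' \<in> S" "m \<le> m'"
  shows "isolated_holes {c. m + c \<in> S} (m' - m)"
  unfolding isolated_holes_def
proof (intro conjI allI impI)
  fix h assume h: "h < m' - m" "h \<notin> {c. m + c \<in> S}"
  define x where "x = Max {z \<in> S. z \<le> m + h}"
  have fin: "finite {z \<in> S. z \<le> m + h}" by simp
  have "m \<in> {z \<in> S. z \<le> m + h}" using S(1) by simp
  then have "x \<in> {z \<in> S. z \<le> m + h}"
    unfolding x_def by (intro Max_in[OF fin]) blast
  then have x: "x \<in> S" "x \<le> m + h" by auto
  have max: "z \<le> x" if "z \<in> S" "z \<le> m + h" for z
    using Max_ge[OF fin] that by (simp add: x_def)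
  have "x \<noteq> m + h" using x h by auto
  moreover have "x < m'" using x h by simp
  then have "Suc x \<in> S \<or> Suc (Suc x) \<in> S" using next_element[OF gaps x(1) S(2)] by blast
  ultimately have "Suc (Suc x) \<in> S \<and> Suc x = m + h"
    using max[of "Suc x"] max[of "Suc (Suc x)"] x(2) by linarith
  then have mem: "Suc (Suc x) \<in> S" and eq: "Suc x = m + h" by blast+
  have "m + Suc h = Suc (Suc x)" using eq by simp
  then show "Suc h \<in> {c. m + c \<in> S}" using mem by (simp only: mem_Collect_eq)
qed (use S in auto)

lemma isolated_holes_down:
  assumes gaps: "\<forall>p>1. \<not> has_gap S p" and S: "m \<in> S" "m' \<in> S" "m' \<le> m"
  shows "isolated_holes {c. c \<le> m \<and> m - c \<in> S} (m - m')"
  unfolding isolated_holes_def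
proof (intro conjI allI impI)
  fix h assume h: "h < m - m'" "h \<notin> {c. c \<le> m \<and> m - c \<in> S}"
  define x where "x = Max {z \<in> S. z < m - h}"
  have fin: "finite {z \<in> S. z < m - h}" by simp
  have "m' \<in> {z \<in> S. z < m - h}" using S h by auto
  then have "x \<in> {z \<in> S. z < m - h}"
    unfolding x_def by (intro Max_in[OF fin]) blast
  then have x: "x \<in> S" "x < m - h" by auto
  have max: "z \<le> x" if "z \<in> S" "z < m - h" for z
    using Max_ge[OF fin] that by (simp add: x_def)
  have "x < m" using x by simp
  then have "Suc x \<in> S \<or> Suc (Suc x) \<in> S" using next_element[OF gaps x(1) S(1)] by blast
  moreover have "m - h \<notin> S" using h by auto
  ultimately have "Suc x = m - h"
    using max[of "Suc x"] max[of "Suc (Suc x)"] x(2) by (metis Suc_lessI Suc_n_not_le_n le_Suc_eq)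
  then have "m - Suc h = x" "Suc h \<le> m" using h by auto
  then show "Suc h \<in> {c. c \<le> m \<and> m - c \<in> S}" using x by simp
qed (use S in auto)

lemma jumps_down: "k \<le> m \<Longrightarrow> jumps S m = jumps S (m - k) + jumps {c. c \<le> m \<and> m - c \<in> S} k"
proof (induction k)
  case (Suc k)
  then have "m - k = Suc (m - Suc k)" by simp
  then have "jumps S (m - k) = jumps S (m - Suc k) + of_bool (m - Suc k \<in> S \<and> m - k \<in> S)"
    by (metis jumps_Suc)
  then show ?case using Suc by (auto simp: conj_commute)
qed simp

text \<open>A discrete intermediate value argument: \<open>jumps\<close> starts at 0 and never grows
  by more than one.\<close>

lemma jump_at:
  assumes "a < jumps S y"
  obtains c where "c < y" "c \<in> S" "Suc c \<in> S" "jumps S c = a"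
proof -
  have "\<exists>c<y. c \<in> S \<and> Suc c \<in> S \<and> jumps S c = a"
    using assms
  proof (induction y)
    case (Suc y)
    show ?case
    proof (cases "a < jumps S y")
      case True
      then show ?thesis using Suc.IH by (auto simp: less_Suc_eq)
    next
      case False
      then have "y \<in> S \<and> Suc y \<in> S \<and> jumps S y = a"
        using Suc.prems by (cases "y \<in> S \<and> Suc y \<in> S") auto
      then show ?thesis by blast
    qed
  qed simp
  then show ?thesis using that by blast
qed

text \<open>Consecutive elements differ by 1 or 2; only the first kind of step changes the parity,
  and it is a jump.\<close>

lemma same_parity_iff_jumps:
  assumes gaps: "\<forall>p>1. \<not> has_gap S p" and S: "x \<in> S" "y \<in> S" "x \<le> y"
  shows "(\<forall>i \<in> S \<inter> {x..y}. even i \<longleftrightarrow> even x) \<longleftrightarrow> jumps S y = jumps S x"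
    and "(\<forall>i \<in> S \<inter> {x..y}. even i \<longleftrightarrow> even y) \<longleftrightarrow> jumps S y = jumps S x"
proof -
  have par: "even i \<longleftrightarrow> even x" if "i \<in> S" "x \<le> i" "jumps S i = jumps S x" for i
  proof -
    have "i - x \<in> {c. x + c \<in> S}" using that by simp
    then have "even (i - x + jumps {c. x + c \<in> S} (i - x))"
      using mem_iff_even_jumps[OF isolated_holes_up[OF gaps S(1) that(1,2)], of "i - x"] by simp
    moreover have "jumps {c. x + c \<in> S} (i - x) = 0"
      using jumps_shift[of S x "i - x"] that by simp
    ultimately show ?thesis using that(2) by simp
  qed
  have eq: "jumps S i = jumps S x" if "jumps S y = jumps S x" "x \<le> i" "i \<le> y" for i
    using jumps_mono[OF that(2), of S] jumps_mono[OF that(3), of S] that(1) by simp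
  have jump: "\<exists>c. c \<in> S \<inter> {x..y} \<and> Suc c \<in> S \<inter> {x..y}" if "jumps S y \<noteq> jumps S x"
  proof -
    have "jumps S x < jumps S y" using that jumps_mono[OF S(3), of S] by simp
    then obtain c where c: "c < y" "c \<in> S" "Suc c \<in> S" "jumps S c = jumps S x" by (rule jump_at)
    then have "jumps S (Suc c) > jumps S x" by simp
    then have "\<not> Suc c \<le> x" using jumps_mono[of "Suc c" x S] by linarith
    then show ?thesis using c by auto
  qed
  show "(\<forall>i \<in> S \<inter> {x..y}. even i \<longleftrightarrow> even x) \<longleftrightarrow> jumps S y = jumps S x"
    using par eq jump by (metis IntE atLeastAtMost_iff even_Suc)
  show "(\<forall>i \<in> S \<inter> {x..y}. even i \<longleftrightarrow> even y) \<longleftrightarrow> jumps S y = jumps S x"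
    using par eq jump S by (metis IntE atLeastAtMost_iff even_Suc)
qed

section \<open>Uniform parts as level sets of the jump count\<close>

context
  fixes S :: "nat set"
  assumes fin: "finite S" and gaps: "\<forall>p>1. \<not> has_gap S p"
begin

lemma le_upper_end_iff:
  assumes "k \<in> S" "j \<in> S" "k \<le> j"
  shows "j \<le> upper_end S k \<longleftrightarrow> jumps S j = jumps S k"
proof -
  let ?A = "{u \<in> S. \<forall>i \<in> S \<inter> {k..u}. even i \<longleftrightarrow> even k}"
  have "finite ?A" "?A \<noteq> {}" using fin assms(1) by auto
  then have "j \<le> upper_end S k \<longleftrightarrow> (\<exists>u\<in>?A. j \<le> u)"
    unfolding upper_end_def by (rule Max_ge_iff)
  also have "\<dots> \<longleftrightarrow> jumps S j = jumps S k"
  proof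
    assume "\<exists>u\<in>?A. j \<le> u"
    then obtain u where u: "u \<in> S" "\<forall>i \<in> S \<inter> {k..u}. even i \<longleftrightarrow> even k" "j \<le> u" by blast
    then have "jumps S u = jumps S k" using same_parity_iff_jumps(1)[OF gaps assms(1) u(1)] assms by simp
    then show "jumps S j = jumps S k"
      using jumps_mono[OF assms(3), of S] jumps_mono[OF u(3), of S] by simp
  next
    assume "jumps S j = jumps S k"
    then show "\<exists>u\<in>?A. j \<le> u" using same_parity_iff_jumps(1)[OF gaps assms] assms by blast
  qed
  finally show ?thesis .
qed

lemma lower_end_le_iff:
  assumes "k \<in> S" "j \<in> S" "j \<le> k"
  shows "lower_end S k \<le> j \<longleftrightarrow> jumps S j = jumps S k"
proof -
  let ?A = "{l \<in> S. \<forall>i \<in> S \<inter> {l..k}. even i \<longleftrightarrow> even k}"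
  have "finite ?A" "?A \<noteq> {}" using fin assms(1) by auto
  then have "lower_end S k \<le> j \<longleftrightarrow> (\<exists>u\<in>?A. u \<le> j)"
    unfolding lower_end_def by (rule Min_le_iff)
  also have "\<dots> \<longleftrightarrow> jumps S j = jumps S k"
  proof
    assume "\<exists>u\<in>?A. u \<le> j"
    then obtain u where u: "u \<in> S" "\<forall>i \<in> S \<inter> {u..k}. even i \<longleftrightarrow> even k" "u \<le> j" by blast
    then have "jumps S k = jumps S u" using same_parity_iff_jumps(2)[OF gaps u(1) assms(1)] assms by simp
    then show "jumps S j = jumps S k"
      using jumps_mono[OF assms(3), of S] jumps_mono[OF u(3), of S] by simp
  next
    assume "jumps S j = jumps S k"
    then have "\<forall>i \<in> S \<inter> {j..k}. even i \<longleftrightarrow> even k"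
      using same_parity_iff_jumps(2)[OF gaps assms(2,1,3)] by simp
    then show "\<exists>u\<in>?A. u \<le> j" using assms by blast
  qed
  finally show ?thesis .
qed

lemma uniform_part_eq:
  assumes "k \<in> S"
  shows "uniform_part S k = {j \<in> S. jumps S j = jumps S k}"
proof -
  have "k \<le> upper_end S k" "lower_end S k \<le> k"
    using le_upper_end_iff[OF assms assms] lower_end_le_iff[OF assms assms] by auto
  then have "lower_end S k \<le> j \<and> j \<le> upper_end S k \<longleftrightarrow> jumps S j = jumps S k" if "j \<in> S" for j
    using le_upper_end_iff[OF assms that] lower_end_le_iff[OF assms that] by (cases "k \<le> j") auto
  then show ?thesis by (auto simp: uniform_part_def)
qed

text \<open>Some jump from \<open>c\<close> to \<open>Suc c\<close> leaves the level of
  \<open>x\<close>. By monotonicity \<open>c\<close> is the largest element of this level and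
  \<open>Suc c\<close> the smallest one of the next.\<close>

lemma adjacent_uniform_parts:
  assumes "x \<in> S" "y \<in> S" "jumps S y = Suc (jumps S x)"
  shows "adjacent (uniform_part S x) (uniform_part S y)"
proof -
  obtain c where c: "c < y" "c \<in> S" "Suc c \<in> S" "jumps S c = jumps S x"
    using jump_at[of "jumps S x" S y] assms by auto
  then have sc: "jumps S (Suc c) = jumps S y" using assms by simp
  have "Max (uniform_part S x) = c"
    unfolding uniform_part_eq[OF assms(1)]
  proof (rule Max_eqI)
    show "j \<le> c" if "j \<in> {j \<in> S. jumps S j = jumps S x}" for j
      using jumps_mono[of "Suc c" j S] that sc assms(3) by (cases "j \<le> c") auto
  qed (use fin c in auto)
  moreover have "Min (uniform_part S y) = Suc c"
    unfolding uniform_part_eq[OF assms(2)]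
  proof (rule Min_eqI)
    show "Suc c \<le> j" if "j \<in> {j \<in> S. jumps S j = jumps S y}" for j
      using jumps_mono[of j c S] that c(4) assms(3) by (cases "j \<le> c") auto
  qed (use fin c sc in auto)
  ultimately show ?thesis by (simp add: adjacent_def)
qed

lemma part_between:
  assumes "x \<in> S" "y \<in> S" "jumps S y = jumps S x + 2"
  obtains k where "k \<in> S" "adjacent (uniform_part S k) (uniform_part S x)"
    "adjacent (uniform_part S k) (uniform_part S y)"
proof -
  obtain c where c: "c < y" "c \<in> S" "Suc c \<in> S" "jumps S c = jumps S x"
    using jump_at[of "jumps S x" S y] assms by auto
  then have "jumps S (Suc c) = Suc (jumps S x)" by simp
  then show ?thesis
    using that[of "Suc c"] adjacent_uniform_parts[OF assms(1) c(3)]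
      adjacent_uniform_parts[OF c(3) assms(2)] c(3) assms(3)
    by (auto simp: adjacent_def)
qed

end

section \<open>Blocks of a symmetric difference\<close>

lemma sum_sym_diff:
  fixes f :: "'a \<Rightarrow> 'b :: ab_group_add"
  assumes "finite M" "finite P"
  shows "sum f (sym_diff M P) = sum f M + (\<Sum>e\<in>P. if e \<in> M then - f e else f e)"
proof -
  have "(\<Sum>e\<in>P. if e \<in> M then - f e else f e) = (\<Sum>e\<in>P \<inter> M. - f e) + (\<Sum>e\<in>P - M. f e)"
    using assms(2) by (simp add: sum.If_cases Int_def Diff_eq)
  moreover have "sum f M = sum f (M - P) + sum f (P \<inter> M)"
    using sum.subset_diff[of "P \<inter> M" M f] assms(1) by (simp add: Diff_Int_distrib2 Diff_Int)
  moreover have "sum f (sym_diff M P) = sum f (M - P) + sum f (P - M)"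
    using assms by (intro sum.union_disjoint) auto
  ultimately show ?thesis by (simp add: sum_negf)
qed

lemma int_deg: "finite F \<Longrightarrow> int (deg F v) = (\<Sum>e\<in>F. of_bool (v \<in> e))"
  by (simp add: deg_def of_bool_def sum.If_cases Int_def)

text \<open>The change of the degree of \<open>v\<close> when \<open>M\<close> is replaced by its symmetric difference with \<open>P\<close>.\<close>

definition ddeg :: "'v set set \<Rightarrow> 'v set set \<Rightarrow> 'v \<Rightarrow> int" where
  "ddeg M P v = (\<Sum>e\<in>P. if e \<in> M then - of_bool (v \<in> e) else of_bool (v \<in> e))"

lemma deg_sym_diff:
  "finite M \<Longrightarrow> finite P \<Longrightarrow> int (deg (sym_diff M P) v) = int (deg M v) + ddeg M P v"
  unfolding ddeg_def using sum_sym_diff[of M P "\<lambda>e. of_bool (v \<in> e) :: int"]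
  by (simp only: int_deg finite_Un finite_Diff)

lemma ddeg_Un: "finite P \<Longrightarrow> finite Q \<Longrightarrow> P \<inter> Q = {} \<Longrightarrow> ddeg M (P \<union> Q) v = ddeg M P v + ddeg M Q v"
  unfolding ddeg_def by (rule sum.union_disjoint)

text \<open>Each edge contributes the same sign at exactly two vertices, and absolute values do not
  alter parity.\<close>

lemma sum_abs_ddeg_even:
  assumes "finite V" "finite P" "\<forall>e\<in>P. e \<subseteq> V \<and> card e = 2"
  shows "even (\<Sum>v\<in>V. \<bar>ddeg M P v\<bar>)"
proof -
  have "(\<Sum>v\<in>V. of_bool (v \<in> e)) = (2 :: int)" if "e \<in> P" for e
  proof -
    have "{v \<in> V. v \<in> e} = e" using assms(3) that by blast
    then show ?thesis using assms that by (simp add: of_bool_def sum.If_cases Int_def)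
  qed
  then have "even (\<Sum>v\<in>V. if e \<in> M then - of_bool (v \<in> e) else of_bool (v \<in> e) :: int)" if "e \<in> P" for e
    using that by (cases "e \<in> M") (simp_all add: sum_negf)
  then have "even (\<Sum>e\<in>P. \<Sum>v\<in>V. if e \<in> M then - of_bool (v \<in> e) else of_bool (v \<in> e) :: int)"
    by (rule dvd_sum)
  then have "even (\<Sum>v\<in>V. ddeg M P v)"
    unfolding ddeg_def by (subst sum.swap)
  moreover have "even (\<Sum>v\<in>V. \<bar>ddeg M P v\<bar> - ddeg M P v)"
    by (intro dvd_sum) (auto simp: abs_if)
  ultimately show ?thesis by (simp add: sum_subtractf)
qed

text \<open>A total of 2 consists of two units, possibly at one vertex. Vanishing outside
  \<open>V\<close> is required because \<open>link\<close> prescribes the whole function.\<close>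

lemma link_if_sum_2:
  assumes "finite V" "sum f V = 2" "\<And>v. v \<notin> V \<Longrightarrow> f v = 0"
  shows "link V f"
proof -
  have "\<exists>x\<in>V. f x > 0" using assms(2) by (metis bot_nat_0.not_eq_extremum sum.neutral zero_neq_numeral)
  then obtain x where x: "x \<in> V" "f x > 0" by blast
  define g where "g v = f v - of_bool (v = x)" for v
  have f: "f v = of_bool (v = x) + g v" for v using x by (auto simp: g_def)
  have g1: "sum g V = 1"
    using assms(1,2) x(1) unfolding f by (simp add: sum.distrib of_bool_def)
  then obtain y where y: "y \<in> V" "g y = 1" "\<And>z. z \<in> V \<Longrightarrow> z \<noteq> y \<Longrightarrow> g z = 0"
    using sum_eq_1_iff[OF assms(1), of g] by (metis)
  have "g v = of_bool (v = y)" for v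
    using y assms(3)[of v] by (cases "v \<in> V") (auto simp: g_def)
  then have "f = (\<lambda>v. of_bool (v = x) + of_bool (v = y))" using f by auto
  then show ?thesis using x y unfolding link_def by blast
qed

text \<open>In a partition into as few blocks as possible, two blocks never change the degree of a vertex in
  opposite directions, since they could be merged.\<close>

lemma ex_blocks:
  assumes V: "finite V" and D: "finite D" "\<forall>e\<in>D. e \<subseteq> V \<and> card e = 2"
  obtains \<P> where "partition_on D \<P>" "\<And>P. P \<in> \<P> \<Longrightarrow> (\<Sum>v\<in>V. \<bar>ddeg M P v\<bar>) \<le> 2"
    "\<And>P Q v. P \<in> \<P> \<Longrightarrow> Q \<in> \<P> \<Longrightarrow> v \<in> V \<Longrightarrow> ddeg M P v > 0 \<Longrightarrow> ddeg M Q v \<ge> 0"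
proof -
  define good where "good \<P> \<longleftrightarrow> partition_on D \<P> \<and> (\<forall>P\<in>\<P>. (\<Sum>v\<in>V. \<bar>ddeg M P v\<bar>) \<le> 2)" for \<P>
  have "good ((\<lambda>e. {e}) ` D)"
  proof -
    have "(\<Sum>v\<in>V. \<bar>ddeg M {e} v\<bar>) \<le> 2" if "e \<in> D" for e
    proof -
      have "(\<Sum>v\<in>V. \<bar>ddeg M {e} v\<bar>) = (\<Sum>v\<in>V. of_bool (v \<in> e))"
        by (intro sum.cong) (auto simp: ddeg_def)
      also have "{v \<in> V. v \<in> e} = e" using D that by blast
      then have "(\<Sum>v\<in>V. of_bool (v \<in> e)) = (2 :: int)"
        using V D that by (simp add: of_bool_def sum.If_cases Int_def)
      finally show ?thesis by simp
    qed
    moreover have "partition_on D ((\<lambda>e. {e}) ` D)"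
      by (auto simp: partition_on_def disjoint_def)
    ultimately show ?thesis by (auto simp: good_def)
  qed
  then obtain \<P> where good: "good \<P>" and min: "\<And>\<Q>. good \<Q> \<Longrightarrow> card \<P> \<le> card \<Q>"
    using ex_has_least_nat[of good _ card] by blast
  have part: "partition_on D \<P>" and le2: "\<And>P. P \<in> \<P> \<Longrightarrow> (\<Sum>v\<in>V. \<bar>ddeg M P v\<bar>) \<le> 2"
    using good by (auto simp: good_def)
  have fin\<P>: "finite \<P>" using finite_elements[OF D(1) part] .
  have sub: "P \<subseteq> D" if "P \<in> \<P>" for P using part that by (auto simp: partition_on_def)
  have "ddeg M Q v \<ge> 0" if PQ: "P \<in> \<P>" "Q \<in> \<P>" "v \<in> V" and p: "ddeg M P v > 0" for P Q v
  proof (rule ccontr)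
    assume "\<not> ddeg M Q v \<ge> 0"
    then have q: "ddeg M Q v < 0" by simp
    then have ne: "P \<noteq> Q" using p by auto
    then have disj: "P \<inter> Q = {}" using part PQ by (auto simp: partition_on_def disjoint_def)
    have fin: "finite P" "finite Q" using sub PQ D(1) by (auto intro: finite_subset)
    define \<Q> where "\<Q> = insert (P \<union> Q) (\<P> - {P, Q})"
    \<comment> \<open>Opposite signs at \<open>v\<close> cancel at least 1 from each of the two
      blocks, so the union changes the degrees by at most 2 + 2 - 2.\<close>
    have "(\<Sum>u\<in>V. \<bar>ddeg M (P \<union> Q) u\<bar>) \<le> 2"
    proof -
      have "(\<Sum>u\<in>V. \<bar>ddeg M (P \<union> Q) u\<bar>) + 2
          \<le> (\<Sum>u\<in>V. \<bar>ddeg M P u\<bar> + \<bar>ddeg M Q u\<bar> - 2 * of_bool (u = v)) + 2"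
        unfolding ddeg_Un[OF fin disj] using p q by (intro add_right_mono sum_mono) (auto simp: abs_if)
      also have "\<dots> = (\<Sum>u\<in>V. \<bar>ddeg M P u\<bar>) + (\<Sum>u\<in>V. \<bar>ddeg M Q u\<bar>)"
        using V PQ(3) by (simp add: sum_subtractf sum.distrib sum_distrib_left[symmetric] of_bool_def)
      finally show ?thesis using le2[OF PQ(1)] le2[OF PQ(2)] by simp
    qed
    moreover have "partition_on D \<Q>"
    proof (rule partition_onI)
      show "\<Union>\<Q> = D" using part PQ by (auto simp: partition_on_def \<Q>_def)
      show "disjnt X Y" if XY: "X \<in> \<Q>" "Y \<in> \<Q>" "X \<noteq> Y" for X Y
      proof -
        have dj: "X \<inter> Y = {}" if "X \<in> \<P>" "Y \<in> \<P>" "X \<noteq> Y" for X Y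
          using part that by (auto simp: partition_on_def disjoint_def)
        have new: "(P \<union> Q) \<inter> Z = {}" if "Z \<in> \<P> - {P, Q}" for Z
          using dj[OF PQ(1), of Z] dj[OF PQ(2), of Z] that by blast
        consider "X = P \<union> Q" "Y \<in> \<P> - {P, Q}" | "Y = P \<union> Q" "X \<in> \<P> - {P, Q}"
          | "X \<in> \<P>" "Y \<in> \<P>"
          using XY unfolding \<Q>_def by blast
        then have "X \<inter> Y = {}"
        proof cases
          case 2
          then show ?thesis using new[of X] by (simp only: Int_commute)
        qed (use new[of Y] dj[of X Y] XY(3) in simp_all)
        then show ?thesis by (simp add: disjnt_def)
      qed
      show "{} \<notin> \<Q>" using part PQ by (auto simp: partition_on_def \<Q>_def)
    qed
    ultimately have "good \<Q>" using le2 by (auto simp: good_def \<Q>_def)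
    then have "card \<P> \<le> card \<Q>" by (rule min)
    also have "\<dots> \<le> Suc (card (\<P> - {P, Q}))" unfolding \<Q>_def using fin\<P> by (simp add: card_insert_if)
    also have "card (\<P> - {P, Q}) = card \<P> - 2"
      using PQ ne fin\<P> by (subst card_Diff_subset) auto
    finally have "card \<P> \<le> Suc (card \<P> - 2)" .
    moreover have "card {P, Q} \<le> card \<P>" using PQ fin\<P> by (intro card_mono) auto
    ultimately show False using ne by simp
  qed
  then show ?thesis using that part le2 by blast
qed

section \<open>Small type distance\<close>

lemma adjacent_commute: "adjacent S T \<longleftrightarrow> adjacent T S"
  by (auto simp: adjacent_def)

lemma uniform_or_neighbouring_type:
  assumes V: "finite V" and B: "\<And>v. v \<in> V \<Longrightarrow> finite (B v)" "\<forall>v\<in>V. \<forall>p>1. \<not> has_gap (B v) p"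
    and M: "\<And>v. v \<in> V \<Longrightarrow> deg M v \<in> B v" and N: "\<And>v. v \<in> V \<Longrightarrow> deg N v \<in> B v"
    and j: "\<And>v. v \<in> V \<Longrightarrow> jumps (B v) (deg N v) = jumps (B v) (deg M v) + j v \<or>
      jumps (B v) (deg M v) = jumps (B v) (deg N v) + j v"
    and sum_j: "sum j V = 0 \<or> sum j V = 2"
  shows "same_uniform_type V B M N \<or> neighbouring_type V B M N"
proof -
  have part: "deg N v \<in> matching_part B M v \<longleftrightarrow> j v = 0" if "v \<in> V" for v
    using uniform_part_eq[OF B(1)[OF that] bspec[OF B(2) that] M[OF that]] N[OF that] j[OF that]
    unfolding matching_part_def by (elim disjE) simp_all
  have adj: "adjacent (matching_part B M v) (matching_part B N v)" if "v \<in> V" "j v = 1" for v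
    using j[OF that(1)]
  proof
    assume "jumps (B v) (deg N v) = jumps (B v) (deg M v) + j v"
    then show ?thesis
      using adjacent_uniform_parts[OF B(1)[OF that(1)] bspec[OF B(2) that(1)] M[OF that(1)] N[OF that(1)]]
        that(2) by (simp add: matching_part_def)
  next
    assume "jumps (B v) (deg M v) = jumps (B v) (deg N v) + j v"
    then show ?thesis
      using adjacent_uniform_parts[OF B(1)[OF that(1)] bspec[OF B(2) that(1)] N[OF that(1)] M[OF that(1)]]
        that(2) unfolding matching_part_def by (subst adjacent_commute) simp
  qed
  have mid: "\<exists>k\<in>B v. adjacent (uniform_part (B v) k) (matching_part B M v) \<and>
      adjacent (uniform_part (B v) k) (matching_part B N v)" if "v \<in> V" "j v = 2" for v
    using j[OF that(1)]
  proof
    assume "jumps (B v) (deg N v) = jumps (B v) (deg M v) + j v"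
    then show ?thesis
      using part_between[OF B(1)[OF that(1)] bspec[OF B(2) that(1)] M[OF that(1)] N[OF that(1)]] that(2)
      unfolding matching_part_def by simp blast
  next
    assume "jumps (B v) (deg M v) = jumps (B v) (deg N v) + j v"
    then show ?thesis
      using part_between[OF B(1)[OF that(1)] bspec[OF B(2) that(1)] N[OF that(1)] M[OF that(1)]] that(2)
      unfolding matching_part_def by simp blast
  qed
  show ?thesis
  proof (cases "sum j V = 0")
    case True
    then show ?thesis using V part by (simp add: same_uniform_type_def)
  next
    case False
    \<comment> \<open>Extended by 0, \<open>j\<close> becomes a link: its ends are two vertices one
      jump away, or a single vertex two jumps away.\<close>
    define j' where "j' v = (if v \<in> V then j v else 0)" for v
    have "sum j' V = 2" using False sum_j by (simp add: j'_def)
    then have "link V j'" by (intro link_if_sum_2 V) (auto simp: j'_def)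
    then obtain x y where xy: "x \<in> V" "y \<in> V" "j' = (\<lambda>v. of_bool (v = x) + of_bool (v = y))"
      unfolding link_def by blast
    have jv: "j v = of_bool (v = x) + of_bool (v = y)" if "v \<in> V" for v
      using fun_cong[OF xy(3), of v] that by (simp add: j'_def)
    have "neighbouring_type V B M N"
      unfolding neighbouring_type_def
    proof (intro exI[of _ "{x, y}"] conjI)
      show "{x, y} \<subseteq> V" "card {x, y} \<le> 2" using xy(1,2) by (simp_all add: card_insert_if)
      show "\<forall>v\<in>{x, y}. deg N v \<notin> matching_part B M v" "\<forall>v\<in>V - {x, y}. deg N v \<in> matching_part B M v"
        using part jv xy(1,2) by simp_all
      show "card {x, y} = 0 \<or>
        card {x, y} = 2 \<and> (\<forall>v\<in>{x, y}. adjacent (matching_part B M v) (matching_part B N v)) \<or>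
        card {x, y} = 1 \<and> (\<forall>v\<in>{x, y}. \<exists>k\<in>B v. adjacent (uniform_part (B v) k) (matching_part B M v) \<and>
          adjacent (uniform_part (B v) k) (matching_part B N v))"
      proof (cases "x = y")
        case True
        then show ?thesis using mid[OF xy(1)] jv[OF xy(1)] by simp
      next
        case False
        then show ?thesis using adj[OF xy(1)] adj[OF xy(2)] jv[OF xy(1)] jv[OF xy(2)] by simp
      qed
    qed
    then show ?thesis by blast
  qed
qed

section \<open>From the blocks back to the graph\<close>

theorem theorem2:
  fixes V :: "'v set" and E :: "'v set set" and w :: "'v set \<Rightarrow> real"
    and B :: "'v \<Rightarrow> nat set" and M :: "'v set set"
  assumes "simple_graph V E"
    and "\<forall>v\<in>V. B v \<subseteq> {0..deg E v}"
    and "\<forall>v\<in>V. \<forall>p>1. \<not> has_gap (B v) p"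
    and "B_matching V E B M"
    and "\<exists>M'. B_matching V E B M' \<and> sum w M' > sum w M"
  shows "\<exists>N. B_matching V E B N \<and> sum w N > sum w M \<and>
           (same_uniform_type V B M N \<or> neighbouring_type V B M N)"
proof -
  have V: "finite V" and E: "\<forall>e\<in>E. e \<subseteq> V \<and> card e = 2"
    using assms(1) by (auto simp: simple_graph_def)
  have "finite E" using V E by (intro finite_subset[of E "Pow V"]) auto
  have finB: "finite (B v)" if "v \<in> V" for v
    using assms(2) that by (meson finite_atLeastAtMost finite_subset)
  have gaps: "\<forall>p>1. \<not> has_gap (B v) p" if "v \<in> V" for v using assms(3) that by blast
  define better where "better N \<longleftrightarrow> B_matching V E B N \<and> sum w N > sum w M" for N
  have "\<exists>N. better N" using assms(5) by (simp add: better_def)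
  then obtain N where N: "better N" and min: "\<And>N'. better N' \<Longrightarrow> card (sym_diff M N) \<le> card (sym_diff M N')"
    using ex_has_least_nat[of better _ "\<lambda>N. card (sym_diff M N)"] by blast
  have ME: "M \<subseteq> E" and degM: "\<And>v. v \<in> V \<Longrightarrow> deg M v \<in> B v"
    using assms(4) by (auto simp: B_matching_def)
  have NE: "N \<subseteq> E" and degN: "\<And>v. v \<in> V \<Longrightarrow> deg N v \<in> B v" and wN: "sum w N > sum w M"
    using N by (auto simp: better_def B_matching_def)
  define D where "D = sym_diff M N"
  have DE: "D \<subseteq> E" using ME NE by (auto simp: D_def)
  have fin: "finite M" "finite N" "finite D"
    using ME NE DE \<open>finite E\<close> by (auto intro: finite_subset)
  obtain \<P> where part: "partition_on D \<P>" and le2: "\<And>P. P \<in> \<P> \<Longrightarrow> (\<Sum>v\<in>V. \<bar>ddeg M P v\<bar>) \<le> 2"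
    and sign: "\<And>P Q v. P \<in> \<P> \<Longrightarrow> Q \<in> \<P> \<Longrightarrow> v \<in> V \<Longrightarrow> ddeg M P v > 0 \<Longrightarrow> ddeg M Q v \<ge> 0"
    using ex_blocks[OF V fin(3), of M] E DE by blast
  have finP: "finite \<P>" using finite_elements[OF fin(3) part] .
  have blocks: "\<Union>\<P> = D" "{} \<notin> \<P>" "\<And>P Q. P \<in> \<P> \<Longrightarrow> Q \<in> \<P> \<Longrightarrow> P \<noteq> Q \<Longrightarrow> P \<inter> Q = {}"
    using part by (auto simp: partition_on_def disjoint_def)
  have finb: "finite P" if "P \<in> \<P>" for P
    using that blocks(1) fin(3) by (meson Union_upper finite_subset)
  define gain where "gain P = (\<Sum>e\<in>P. if e \<in> M then - w e else w e)" for P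
  have deg_exchange: "int (deg (sym_diff M (\<Union>\<T>)) v) = int (deg M v) + (\<Sum>P\<in>\<T>. ddeg M P v)"
    and w_exchange: "sum w (sym_diff M (\<Union>\<T>)) = sum w M + sum gain \<T>" if "\<T> \<subseteq> \<P>" for \<T> v
  proof -
    have "finite (\<Union>\<T>)" using that blocks(1) fin(3) by (metis Union_mono finite_subset)
    moreover have "sum f (\<Union>\<T>) = (\<Sum>P\<in>\<T>. sum f P)" for f :: "'v set \<Rightarrow> 'c::comm_monoid_add"
      using that finb blocks(3) sum.Union_disjoint[of \<T> f] by (auto simp: subset_iff)
    ultimately show "int (deg (sym_diff M (\<Union>\<T>)) v) = int (deg M v) + (\<Sum>P\<in>\<T>. ddeg M P v)"
      "sum w (sym_diff M (\<Union>\<T>)) = sum w M + sum gain \<T>"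
      using fin(1) by (simp_all add: deg_sym_diff sum_sym_diff ddeg_def gain_def)
  qed
  have "sym_diff M D = N" by (auto simp: D_def)
  then have degN_eq: "int (deg N v) = int (deg M v) + (\<Sum>P\<in>\<P>. ddeg M P v)"
    and gain_pos: "sum gain \<P> > 0" for v
    using deg_exchange[of \<P> v] w_exchange[of \<P>] wN by (auto simp: blocks(1))
  have no_gain: "sum gain \<T> \<le> 0"
    if \<T>: "\<T> \<subset> \<P>" "\<T> \<noteq> {}" and ok: "\<And>v. v \<in> V \<Longrightarrow> deg (sym_diff M (\<Union>\<T>)) v \<in> B v" for \<T>
  proof (rule ccontr)
    assume "\<not> sum gain \<T> \<le> 0"
    then have "sum w (sym_diff M (\<Union>\<T>)) > sum w M" using w_exchange[of \<T>] \<T> by simp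
    moreover have sub: "\<Union>\<T> \<subseteq> D" using \<T> blocks(1) by blast
    ultimately have "better (sym_diff M (\<Union>\<T>))"
      using ok ME DE by (auto simp: better_def B_matching_def)
    moreover have "sym_diff M (sym_diff M (\<Union>\<T>)) = \<Union>\<T>" by blast
    ultimately have "card D \<le> card (\<Union>\<T>)" using min unfolding D_def by metis
    moreover have "\<Union>\<T> \<noteq> D"
    proof -
      obtain P where P: "P \<in> \<P>" "P \<notin> \<T>" using \<T> by blast
      then obtain e where "e \<in> P" using blocks(2) by (metis ex_in_conv)
      then have "e \<notin> \<Union>\<T>" using P \<T>(1) blocks(3)[of P] by blast
      then show ?thesis using \<open>e \<in> P\<close> P blocks(1) by blast
    qed
    ultimately show False using psubset_card_mono[OF fin(3), of "\<Union>\<T>"] sub by auto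
  qed
  have "same_uniform_type V B M N \<or> neighbouring_type V B M N"
  proof (cases "\<exists>P\<in>\<P>. \<forall>v\<in>V. ddeg M P v = 0")
    case True
    then obtain P where P: "P \<in> \<P>" "\<And>v. v \<in> V \<Longrightarrow> ddeg M P v = 0" by blast
    have degP: "deg (sym_diff M (\<Union>{P})) v = deg M v" if "v \<in> V" for v
      using deg_exchange[of "{P}" v] P that by simp
    have "(\<Sum>Q\<in>\<P>. ddeg M Q v) = (\<Sum>Q\<in>\<P> - {P}. ddeg M Q v)" if "v \<in> V" for v
      using finP P that by (simp add: sum.remove[of \<P> P])
    then have deg_rest: "deg (sym_diff M (\<Union>(\<P> - {P}))) v = deg N v" if "v \<in> V" for v
      using deg_exchange[of "\<P> - {P}" v] degN_eq[of v] that by simp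
    \<comment> \<open>Otherwise \<open>P\<close> alone keeps the degrees of \<open>M\<close> and the
      remaining blocks reach those of \<open>N\<close>. Both exchanges are admissible, so neither
      has positive gain, although their gains add up to a positive number.\<close>
    have "\<P> = {P}"
    proof (rule ccontr)
      assume "\<P> \<noteq> {P}"
      then have sub: "{P} \<subset> \<P>" "\<P> - {P} \<subset> \<P>" "\<P> - {P} \<noteq> {}" using P(1) by auto
      have "sum gain {P} \<le> 0" by (rule no_gain[OF sub(1)]) (simp_all only: degP degM, simp)
      moreover have "sum gain (\<P> - {P}) \<le> 0"
        by (rule no_gain[OF sub(2,3)]) (simp only: deg_rest degN)
      ultimately show False using gain_pos finP P by (simp add: sum.remove[of \<P> P])
    qed
    then have "deg N v = deg M v" if "v \<in> V" for v
      using degN_eq[of v] P(2)[OF that] by simp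
    then show ?thesis
      using uniform_part_eq[OF finB gaps degM] degM
      by (simp add: same_uniform_type_def matching_part_def)
  next
    case False
    define inc where "inc P v = (if v \<in> V then nat \<bar>ddeg M P v\<bar> else 0)" for P v
    \<comment> \<open>Degrees are counted from \<open>M\<close> towards \<open>N\<close>, hence
      downwards where \<open>N\<close> has the smaller degree; there the guard keeps truncated
      subtraction from mapping all large \<open>c\<close> to 0.\<close>
    define C where "C v = (if deg M v \<le> deg N v then {c. deg M v + c \<in> B v}
      else {c. c \<le> deg M v \<and> deg M v - c \<in> B v})" for v
    have links: "link V (inc P)" if "P \<in> \<P>" for P
    proof (rule link_if_sum_2[OF V])
      \<comment> \<open>The total change is even, at most 2 and not 0 in this case, so every block
        is an item with two ends.\<close>
      have "even (\<Sum>v\<in>V. \<bar>ddeg M P v\<bar>)"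
        using sum_abs_ddeg_even[OF V finb[OF that]] that blocks(1) DE E by blast
      moreover have "(\<Sum>v\<in>V. \<bar>ddeg M P v\<bar>) \<noteq> 0"
        using False that V by (simp add: sum_nonneg_eq_0_iff)
      moreover have "(\<Sum>v\<in>V. \<bar>ddeg M P v\<bar>) \<ge> 0" by (intro sum_nonneg) auto
      ultimately have "(\<Sum>v\<in>V. \<bar>ddeg M P v\<bar>) = 2" using le2[OF that] by presburger
      moreover have "int (sum (inc P) V) = (\<Sum>v\<in>V. \<bar>ddeg M P v\<bar>)" by (simp add: inc_def)
      ultimately show "sum (inc P) V = 2" by linarith
    qed (simp add: inc_def)
    \<comment> \<open>By \<open>sign\<close> all blocks change the degree of \<open>v\<close> in one
      direction, and this must be the direction from \<open>M\<close> to \<open>N\<close>.\<close>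
    have nonneg: "ddeg M Q v \<ge> 0" if "v \<in> V" "deg M v \<le> deg N v" "Q \<in> \<P>" for Q v
    proof (rule ccontr)
      assume neg: "\<not> ddeg M Q v \<ge> 0"
      then have "ddeg M P v \<le> 0" if "P \<in> \<P>" for P
        using sign[OF that \<open>Q \<in> \<P>\<close> \<open>v \<in> V\<close>] by linarith
      then have "(\<Sum>P\<in>\<P>. ddeg M P v) < (\<Sum>P\<in>\<P>. 0)"
        using neg \<open>Q \<in> \<P>\<close> finP by (intro sum_strict_mono_ex1) (auto simp: not_le)
      then show False using degN_eq[of v] that(2) by simp
    qed
    have nonpos: "ddeg M Q v \<le> 0" if "v \<in> V" "\<not> deg M v \<le> deg N v" "Q \<in> \<P>" for Q v
    proof (rule ccontr)
      assume "\<not> ddeg M Q v \<le> 0"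
      then have "ddeg M P v \<ge> 0" if "P \<in> \<P>" for P
        using sign[OF \<open>Q \<in> \<P>\<close> that \<open>v \<in> V\<close>] by linarith
      then have "(\<Sum>P\<in>\<P>. ddeg M P v) \<ge> 0" by (intro sum_nonneg) auto
      then show False using degN_eq[of v] that(2) by simp
    qed
    have ideg_up: "int (ideg inc \<T> v) = (\<Sum>P\<in>\<T>. ddeg M P v)"
      if "\<T> \<subseteq> \<P>" "v \<in> V" "deg M v \<le> deg N v" for \<T> v
      using that nonneg[OF that(2,3)] by (auto simp: ideg_def inc_def intro!: sum.cong)
    have ideg_down: "int (ideg inc \<T> v) = - (\<Sum>P\<in>\<T>. ddeg M P v)"
      if "\<T> \<subseteq> \<P>" "v \<in> V" "\<not> deg M v \<le> deg N v" for \<T> v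
      using that nonpos[OF that(2,3)] by (auto simp: ideg_def inc_def sum_negf[symmetric] intro!: sum.cong)
    have ideg_P: "ideg inc \<P> v = (if deg M v \<le> deg N v then deg N v - deg M v else deg M v - deg N v)"
      if "v \<in> V" for v
      using ideg_up[OF order.refl that] ideg_down[OF order.refl that] degN_eq[of v] by auto
    have inst: "inst V inc C \<P>"
      unfolding inst_def
      using V finP links ideg_P isolated_holes_up[OF gaps degM degN] isolated_holes_down[OF gaps degM degN]
      by (auto simp: C_def)
    have "\<not> improvable V inc C \<P> gain"
    proof
      assume "improvable V inc C \<P> gain"
      then obtain \<T> where \<T>: "\<T> \<subset> \<P>" "\<T> \<noteq> {}" "valid V inc C \<T>" "sum gain \<T> > 0"
        unfolding improvable_def by blast
      have "deg (sym_diff M (\<Union>\<T>)) v \<in> B v" if v: "v \<in> V" for v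
      proof -
        have c: "ideg inc \<T> v \<in> C v" using \<T>(3) v by (simp add: valid_def)
        have sub: "\<T> \<subseteq> \<P>" using \<T>(1) by blast
        show ?thesis
        proof (cases "deg M v \<le> deg N v")
          case True
          then have "deg (sym_diff M (\<Union>\<T>)) v = deg M v + ideg inc \<T> v"
            using deg_exchange[OF sub, of v] ideg_up[OF sub v True] by linarith
          then show ?thesis using c True by (simp add: C_def)
        next
          case False
          then have "deg (sym_diff M (\<Union>\<T>)) v = deg M v - ideg inc \<T> v"
            using deg_exchange[OF sub, of v] ideg_down[OF sub v False] by linarith
          then show ?thesis using c False by (simp add: C_def)
        qed
      qed
      then show False using no_gain[OF \<T>(1,2)] \<T>(4) by simp
    qed
    then have "\<not> norm_type V inc C \<P> \<ge> 3"
      using improvable_if_norm_ge_3[OF inst _ gain_pos] by blast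
    then have "norm_type V inc C \<P> = 0 \<or> norm_type V inc C \<P> = 1 \<or> norm_type V inc C \<P> = 2"
      by linarith
    then have "norm_type V inc C \<P> = 0 \<or> norm_type V inc C \<P> = 2"
      using norm_type_even[OF inst] by auto
    then have small: "(\<Sum>v\<in>V. jumps (C v) (ideg inc \<P> v)) = 0 \<or>
        (\<Sum>v\<in>V. jumps (C v) (ideg inc \<P> v)) = 2"
      unfolding norm_type_def .
    have "jumps (B v) (deg N v) = jumps (B v) (deg M v) + jumps (C v) (ideg inc \<P> v) \<or>
        jumps (B v) (deg M v) = jumps (B v) (deg N v) + jumps (C v) (ideg inc \<P> v)"
      if v: "v \<in> V" for v
    proof (cases "deg M v \<le> deg N v")
      case True
      then have "C v = {c. deg M v + c \<in> B v}" "ideg inc \<P> v = deg N v - deg M v"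
        using ideg_P[OF v] by (simp_all add: C_def)
      then show ?thesis using jumps_shift[of "B v" "deg M v" "deg N v - deg M v"] True by simp
    next
      case False
      then have "C v = {c. c \<le> deg M v \<and> deg M v - c \<in> B v}" "ideg inc \<P> v = deg M v - deg N v"
        using ideg_P[OF v] by (simp_all add: C_def)
      then show ?thesis using jumps_down[of "deg M v - deg N v" "deg M v" "B v"] False by simp
    qed
    then show ?thesis
      using uniform_or_neighbouring_type[where j = "\<lambda>v. jumps (C v) (ideg inc \<P> v)",
          OF V finB assms(3) degM degN _ small] by blast
  qed
  then show ?thesis using N unfolding better_def by blast
qed

end
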